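(* Let $c\in(0,\infty)$ and let $p_n\in[0,1]$ satisfy $p_n\sim c\ln n/n$ as $n\to\infty$ (critical regime). Let $f_{n,1}^\downarrow$ be the size (number of vertices) of the largest fireproof subtree after the fire dynamics with parameter $p_n$ on a random recursive tree $\mathsf{T}_n$ with $n$ vertices. (i) On the event that the root $1$ burns (i.e. under the conditional law given this event), the sequence $\big(\frac{\ln n}{n}f_{n,1}^\downarrow,\ n\ge1\big)$ is tight. (ii) On the event that the root $1$ is fireproof (i.e. under the conditional law given this event), $n^{-1}f_{n,1}^\downarrow$ converges to $1$ in probability as $n\to\infty$.
   Context: Write $[n]=\{1,\dots,n\}$. A tree on the vertex set $[n]$ is called recursive if, when rooted at $1$, the sequence of vertices along any branch from the root to a leaf is increasing. There are $(n-1)!$ such trees; the random recursive tree $\mathsf{T}_n$ is one of them picked uniformly at random. Fire dynamics with parameter $p_n$ on a tree with $n$ vertices: initially every edge is flammable. The edges are considered successively in a uniform random order; an edge which has already burnt is not subject to the dynamics any more and is skipped. Otherwise, independently of everything else, the edge becomes fireproof with probability $1-p_n$ or is set on fire with probability $p_n$; in the latter case the edge burns, sets on fire its flammable neighbouring edges, and the fire propagates instantly, stopped only by fireproof edges (so that the whole connected set of flammable edges containing it burns). The dynamics continue until all edges are either burnt or fireproof. A vertex is called fireproof if all its adjacent edges are fireproof, and burnt otherwise. The fireproof edges with at least one burnt extremity are then discarded; the connected components of the resulting forest are either composed of fireproof vertices (the fireproof subtrees) or of burnt vertices (the burnt subtrees). The size of the largest fireproof subtree is $0$ if there is no fireproof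 vertex. *)

theory Defs
  imports "HOL-Probability.Probability" "HOL-Library.Landau_Symbols"
begin

text \<open>A finite simple graph is given by a vertex set and a set of edges, each edge being
  the two-element set of its extremities.\<close>

definition graph_path :: "nat set set \<Rightarrow> nat list \<Rightarrow> bool" where
  "graph_path E xs \<longleftrightarrow> xs \<noteq> [] \<and> distinct xs \<and> successively (\<lambda>u v. {u, v} \<in> E) xs"

definition graph_cycle :: "nat set set \<Rightarrow> nat list \<Rightarrow> bool" where
  "graph_cycle E xs \<longleftrightarrow> length xs \<ge> 3 \<and> graph_path E xs \<and> {last xs, hd xs} \<in> E"

definition joined :: "nat set set \<Rightarrow> nat \<Rightarrow> nat \<Rightarrow> bool" where
  "joined E u v \<longleftrightarrow> (\<exists>xs. graph_path E xs \<and> hd xs = u \<and> last xs = v)"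

definition components :: "nat set \<Rightarrow> nat set set \<Rightarrow> nat set set" where
  "components V E = (\<lambda>u. {v \<in> V. joined E u v}) ` V"

definition is_tree :: "nat set \<Rightarrow> nat set set \<Rightarrow> bool" where
  "is_tree V E \<longleftrightarrow>
     finite V \<and> V \<noteq> {} \<and> (\<forall>e\<in>E. e \<subseteq> V \<and> card e = 2) \<and>
     (\<forall>u\<in>V. \<forall>v\<in>V. joined E u v) \<and> (\<nexists>xs. graph_cycle E xs)"

text \<open>In a tree rooted at \<open>r\<close>, a path starting at \<open>r\<close> can be prolonged by \<open>v\<close> iff \<open>v\<close> is a
  child of its last vertex; hence a path that cannot be prolonged ends at a leaf.\<close>

definition branch :: "nat set set \<Rightarrow> nat \<Rightarrow> nat list \<Rightarrow> bool" where
  "branch E r xs \<longleftrightarrow> graph_path E xs \<and> hd xs = r \<and> (\<nexists>v. graph_path E (xs @ [v]))"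

definition recursive_trees :: "nat \<Rightarrow> nat set set set" where
  "recursive_trees n =
     {E. is_tree {1..n} E \<and> (\<forall>xs. branch E 1 xs \<longrightarrow> sorted_wrt (<) xs)}"

lemma finite_recursive_trees: "finite (recursive_trees n)"
proof (rule finite_subset)
  show "recursive_trees n \<subseteq> Pow (Pow {1..n})"
    by (auto simp: recursive_trees_def is_tree_def)
qed simp

lemma recursive_trees_nonempty:
  assumes "n \<ge> 1"
  shows "recursive_trees n \<noteq> {}"
proof -
  define S :: "nat set set" where "S = (\<lambda>k. {1, k}) ` {2..n}"
  have S_iff: "{u, v} \<in> S \<longleftrightarrow> u = 1 \<and> v \<in> {2..n} \<or> v = 1 \<and> u \<in> {2..n}" for u v
    unfolding S_def image_iff doubleton_eq_iff by blast
  have conn: "joined S u v" if "u \<in> {1..n}" "v \<in> {1..n}" for u v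
  proof -
    define xs where "xs = (if u = v then [u] else if u = 1 \<or> v = 1 then [u, v] else [u, 1, v])"
    have "graph_path S xs"
      using that by (simp add: xs_def graph_path_def S_iff)
    moreover have "hd xs = u" "last xs = v"
      by (simp_all add: xs_def)
    ultimately show ?thesis
      unfolding joined_def by blast
  qed
  have no_cycle: "\<not> graph_cycle S xs" for xs
  proof
    assume cyc: "graph_cycle S xs"
    then have "Suc (Suc (Suc 0)) \<le> length xs"
      by (simp add: graph_cycle_def)
    then obtain a b d ys where xs: "xs = a # b # d # ys"
      by (metis Suc_le_length_iff)
    have path: "distinct (a # b # d # ys)" "{a, b} \<in> S" "{b, d} \<in> S"
        "successively (\<lambda>u v. {u, v} \<in> S) (d # ys)"
      using cyc unfolding graph_cycle_def graph_path_def xs by simp_all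
    then have ne: "a \<noteq> 1" "d \<noteq> 1" "1 \<notin> set ys"
      unfolding S_iff by auto
    show False
    proof (cases ys)
      case Nil
      then show ?thesis
        using cyc ne unfolding graph_cycle_def xs by (simp add: S_iff)
    next
      case (Cons y zs)
      then show ?thesis
        using path(4) ne by (simp add: S_iff)
    qed
  qed
  have incr: "sorted_wrt (<) xs" if "branch S 1 xs" for xs
  proof -
    have path: "distinct xs" "successively (\<lambda>u v. {u, v} \<in> S) xs" "hd xs = 1"
      using that by (simp_all add: branch_def graph_path_def)
    consider "xs = []" | a where "xs = [a]" | a b where "xs = [a, b]"
      | a b d ys where "xs = a # b # d # ys"
      by (metis neq_Nil_conv)
    then show ?thesis
    proof cases
      case 3
      then show ?thesis using path by (simp add: S_iff)
    next
      case 4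
      then show ?thesis using path by (simp add: S_iff)
    qed simp_all
  qed
  have "\<forall>e\<in>S. e \<subseteq> {1..n} \<and> card e = 2"
    using assms by (simp add: S_def)
  then have "S \<in> recursive_trees n"
    using assms conn no_cycle incr unfolding recursive_trees_def is_tree_def by simp
  then show ?thesis by blast
qed

datatype edge_status = Flammable | Fireproof | Burnt

inductive_set fire_cluster ::
    "nat set set \<Rightarrow> (nat set \<Rightarrow> edge_status) \<Rightarrow> nat set \<Rightarrow> nat set set"
  for E s e where
  start: "e \<in> fire_cluster E s e"
| spread: "\<lbrakk>e' \<in> fire_cluster E s e; e'' \<in> E; s e'' = Flammable; e' \<inter> e'' \<noteq> {}\<rbrakk>
    \<Longrightarrow> e'' \<in> fire_cluster E s e"

definition ignite ::
    "nat set set \<Rightarrow> nat set \<Rightarrow> (nat set \<Rightarrow> edge_status) \<Rightarrow> nat set \<Rightarrow> edge_status" where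
  "ignite E e s = (\<lambda>e'. if e' \<in> fire_cluster E s e then Burnt else s e')"

definition fire_step ::
    "real \<Rightarrow> nat set set \<Rightarrow> nat set \<Rightarrow> (nat set \<Rightarrow> edge_status) \<Rightarrow> (nat set \<Rightarrow> edge_status) pmf" where
  "fire_step p E e s =
     (if s e = Burnt then return_pmf s
      else map_pmf (\<lambda>b. if b then ignite E e s else s(e := Fireproof)) (bernoulli_pmf p))"

primrec fire_run ::
    "real \<Rightarrow> nat set set \<Rightarrow> nat set list \<Rightarrow> (nat set \<Rightarrow> edge_status) \<Rightarrow> (nat set \<Rightarrow> edge_status) pmf" where
  "fire_run p E [] s = return_pmf s"
| "fire_run p E (e # es) s = bind_pmf (fire_step p E e s) (fire_run p E es)"

definition fire_dynamics :: "real \<Rightarrow> nat set set \<Rightarrow> (nat set \<Rightarrow> edge_status) pmf" where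
  "fire_dynamics p E =
     bind_pmf (pmf_of_set (permutations_of_set E)) (\<lambda>es. fire_run p E es (\<lambda>_. Flammable))"

text \<open>Joint law of the random recursive tree on \<open>{1..n}\<close> and of the final status of its edges.\<close>

definition fire_on_rrt :: "real \<Rightarrow> nat \<Rightarrow> (nat set set \<times> (nat set \<Rightarrow> edge_status)) pmf" where
  "fire_on_rrt p n =
     bind_pmf (pmf_of_set (recursive_trees n)) (\<lambda>E. map_pmf (\<lambda>s. (E, s)) (fire_dynamics p E))"

definition fireproof_vertex :: "nat set set \<Rightarrow> (nat set \<Rightarrow> edge_status) \<Rightarrow> nat \<Rightarrow> bool" where
  "fireproof_vertex E s v \<longleftrightarrow> (\<forall>e\<in>E. v \<in> e \<longrightarrow> s e = Fireproof)"

definition final_forest :: "nat set set \<Rightarrow> (nat set \<Rightarrow> edge_status) \<Rightarrow> nat set set" where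
  "final_forest E s = E - {e \<in> E. s e = Fireproof \<and> (\<exists>v\<in>e. \<not> fireproof_vertex E s v)}"

definition fireproof_subtrees :: "nat \<Rightarrow> nat set set \<Rightarrow> (nat set \<Rightarrow> edge_status) \<Rightarrow> nat set set" where
  "fireproof_subtrees n E s =
     {C \<in> components {1..n} (final_forest E s). \<forall>v\<in>C. fireproof_vertex E s v}"

definition largest_fireproof :: "nat \<Rightarrow> nat set set \<Rightarrow> (nat set \<Rightarrow> edge_status) \<Rightarrow> nat" where
  "largest_fireproof n E s = Max (insert 0 (card ` fireproof_subtrees n E s))"

text \<open>The conditional laws given the state of the root. The conditioning event can be null
  (the root burns: when \<open>n = 1\<close> or \<open>p = 0\<close>; the root is fireproof: when \<open>n \<ge> 2\<close> and \<open>p = 1\<close>);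
  \<^const>\<open>cond_pmf\<close> is then some unspecified probability mass function. In the regime
  \<open>p\<^sub>n \<sim> c ln n / n\<close> this occurs for at most finitely many \<open>n\<close>, which influences neither
  tightness nor limits.\<close>

definition root_burns_law :: "real \<Rightarrow> nat \<Rightarrow> (nat set set \<times> (nat set \<Rightarrow> edge_status)) pmf" where
  "root_burns_law p n = cond_pmf (fire_on_rrt p n) {(E, s). \<not> fireproof_vertex E s 1}"

definition root_fireproof_law :: "real \<Rightarrow> nat \<Rightarrow> (nat set set \<times> (nat set \<Rightarrow> edge_status)) pmf" where
  "root_fireproof_law p n = cond_pmf (fire_on_rrt p n) {(E, s). fireproof_vertex E s 1}"

end

theory Submission
  imports Defs "HOL-Real_Asymp.Real_Asymp"
begin

text \<open>A recursive tree is encoded by the function sending each vertex \<open>k \<ge> 2\<close> to its parent, and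
  the edge above \<open>k\<close> by \<open>k\<close> itself; the order of the edges, the decisions (burn or not) of all
  edges and the parent function are then independent. The root burns iff some edge decided to
  burn comes before all other edges on its path to the root.

  A vertex in the subtree of \<open>t \<noteq> 1\<close> can burn without the root only if some edge of the subtree
  comes first on its path to \<open>t\<close>, but after the edge above \<open>t\<close>. Since such paths have typical
  length \<open>ln n\<close>, a first moment computation shows that the subtrees in which this happens have
  total size \<open>O(n / ln n)\<close>. If the root is fireproof, all vertices outside them lie in its
  fireproof subtree. If the root burns, then it does so, with high probability, before \<open>T n / ln n\<close> edges have
  been considered; a fireproof subtree that is not below such a \<open>t\<close> hangs from an edge that was
  considered before that time, and a first moment bound on the number of subtrees with more than
  \<open>K n / ln n\<close> vertices hanging from these edges concludes.\<close>

section \<open>Recursive trees as parent functions\<close>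

text \<open>All estimates are sums over paths of a function of their length \<open>d\<close>: by
  exchangeability an edge comes first on its path with probability at most \<open>1 / d\<close>, and
  asking the edge above the top to come still earlier costs a second such factor. Concentration of
  depths is never proved. Instead \<open>1 / d\<close> and \<open>1 / d^2\<close> are bounded by
  their values at \<open>d = ln n / 4\<close> plus \<open>n powr (1/4) * (1/2) ^ d\<close>; at the
  root, the depth generating function at \<open>1/2\<close> has mean at most
  \<open>2 * n powr (1/2)\<close>, so that short paths cost only a multiple of
  \<open>n powr (3/4)\<close>. Summing over the tops \<open>t\<close> requires weighting by subtree
  sizes; the product of the size plus one with the generating function satisfies a one-step growth
  inequality, which supplies all the moments that are used. Both conclusions are conditional, so
  each state of the root must have probability bounded away from \<open>0\<close>. This takes two
  separate arguments: convexity of the exponential for a fireproof root, and for a burnt root a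
  count of edges that are alone on their path among the first \<open>n / (4 ln n)\<close>
  ones.\<close>

definition parent_funs :: "nat \<Rightarrow> (nat \<Rightarrow> nat) set" where
  "parent_funs n = (\<Pi>\<^sub>E k\<in>{2..n}. {1..<k})"

definition parent_edge :: "(nat \<Rightarrow> nat) \<Rightarrow> nat \<Rightarrow> nat set" where
  "parent_edge f k = {f k, k}"

definition parent_tree :: "nat \<Rightarrow> (nat \<Rightarrow> nat) \<Rightarrow> nat set set" where
  "parent_tree n f = parent_edge f ` {2..n}"

lemma parent_funsD:
  assumes "f \<in> parent_funs n" "k \<in> {2..n}"
  shows "1 \<le> f k" "f k < k" "f k \<in> {1..n}"
proof -
  have "f k \<in> {1..<k}"
    using assms unfolding parent_funs_def by (rule PiE_mem)
  then show "1 \<le> f k" "f k < k" "f k \<in> {1..n}"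
    using assms(2) by auto
qed

lemma edge_in_parent_tree_iff:
  "{a, b} \<in> parent_tree n f \<longleftrightarrow> (b \<in> {2..n} \<and> a = f b) \<or> (a \<in> {2..n} \<and> b = f a)"
  unfolding parent_tree_def parent_edge_def image_iff doubleton_eq_iff by blast

lemma parent_edge_inj_on:
  assumes "f \<in> parent_funs n"
  shows "inj_on (parent_edge f) {2..n}"
proof (rule inj_onI)
  fix x y assume xy: "x \<in> {2..n}" "y \<in> {2..n}" "parent_edge f x = parent_edge f y"
  have "f x < x" "f y < y" using parent_funsD[OF assms] xy by auto
  then show "x = y" using xy(3) unfolding parent_edge_def doubleton_eq_iff by auto
qed

section \<open>Every recursive tree comes from a parent function\<close>

lemma graph_path_snoc:
  "graph_path E (xs @ [v]) \<longleftrightarrow>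
     xs = [] \<or> graph_path E xs \<and> v \<notin> set xs \<and> {last xs, v} \<in> E"
  by (cases "xs = []") (auto simp: graph_path_def successively_append_iff)

lemma graph_path_subset:
  assumes "\<forall>e\<in>E. e \<subseteq> V" "graph_path E xs" "hd xs \<in> V"
  shows "set xs \<subseteq> V"
  using assms(2,3)
proof (induction xs rule: rev_induct)
  case (snoc v xs)
  then show ?case
    using assms(1) by (cases "xs = []") (auto simp: graph_path_snoc)
qed simp

text \<open>Recursiveness is imposed on branches only. A path has distinct vertices in the finite
  set \<open>V\<close>, so prolonging it must stop; this carries the ordering condition over to
  arbitrary paths from the root.\<close>

lemma path_extends_to_branch:
  assumes "finite V" "\<forall>e\<in>E. e \<subseteq> V" "r \<in> V" "graph_path E xs" "hd xs = r"
  shows "\<exists>ys. branch E r (xs @ ys)"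
  using assms(4,5)
proof (induction "card V - length xs" arbitrary: xs rule: less_induct)
  case less
  show ?case
  proof (cases "\<exists>v. graph_path E (xs @ [v])")
    case False
    then have "branch E r (xs @ [])"
      using less.prems by (simp add: branch_def)
    then show ?thesis by blast
  next
    case True
    then obtain v where v: "graph_path E (xs @ [v])" by blast
    have ne: "xs \<noteq> []" using less.prems by (auto simp: graph_path_def)
    have hd: "hd (xs @ [v]) = r" using less.prems ne by simp
    have "set (xs @ [v]) \<subseteq> V"
      using graph_path_subset[OF assms(2) v] assms(3) hd by simp
    moreover have "distinct (xs @ [v])" using v by (simp add: graph_path_def)
    ultimately have "length (xs @ [v]) \<le> card V"
      using assms(1) by (metis card_mono distinct_card)
    then have "card V - length (xs @ [v]) < card V - length xs" by simp
    from less.hyps[OF this v hd] show ?thesis by auto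
  qed
qed

lemma recursive_tree_path_sorted:
  assumes "E \<in> recursive_trees n" "graph_path E xs" "hd xs = 1"
  shows "sorted_wrt (<) xs"
proof -
  have E: "\<forall>e\<in>E. e \<subseteq> {1..n}" "{1..n} \<noteq> {}"
    using assms(1) by (auto simp: recursive_trees_def is_tree_def)
  then have "1 \<in> {1..n}" by auto
  from path_extends_to_branch[OF _ E(1) this assms(2,3)]
  obtain ys where "branch E 1 (xs @ ys)" by auto
  then have "sorted_wrt (<) (xs @ ys)"
    using assms(1) by (simp add: recursive_trees_def)
  then show ?thesis by (simp add: sorted_wrt_append)
qed

lemma sorted_wrt_less_le_last:
  assumes "sorted_wrt (<) (xs :: nat list)" "x \<in> set xs"
  shows "x \<le> last xs"
  using assms by (induction xs rule: rev_induct) (auto simp: sorted_wrt_append)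

lemma recursive_tree_path_to:
  assumes "E \<in> recursive_trees n" "a \<in> {1..n}"
  obtains xs where "graph_path E xs" "hd xs = 1" "last xs = a" "\<And>x. x \<in> set xs \<Longrightarrow> x \<le> a"
proof -
  have "1 \<in> {1..n}" using assms(2) by auto
  then have "joined E 1 a"
    using assms by (auto simp: recursive_trees_def is_tree_def)
  then obtain xs where xs: "graph_path E xs" "hd xs = 1" "last xs = a"
    by (auto simp: joined_def)
  have "x \<le> a" if "x \<in> set xs" for x
    using recursive_tree_path_sorted[OF assms(1) xs(1,2)] that xs(3) sorted_wrt_less_le_last by blast
  with xs show ?thesis using that by blast
qed

text \<open>The neighbour is the predecessor of \<open>k\<close> on the increasing path from
  \<open>1\<close> to \<open>k\<close>.\<close>

lemma smaller_neighbour_exists: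
  assumes "E \<in> recursive_trees n" "k \<in> {2..n}"
  shows "\<exists>a. a < k \<and> {a, k} \<in> E"
proof -
  have "k \<in> {1..n}" using assms(2) by auto
  then obtain xs where xs: "graph_path E xs" "hd xs = 1" "last xs = k" "\<And>x. x \<in> set xs \<Longrightarrow> x \<le> k"
    using recursive_tree_path_to[OF assms(1)] by blast
  obtain ys where ys: "xs = ys @ [k]"
    using xs(1,3) by (metis append_butlast_last_id graph_path_def)
  have ne: "ys \<noteq> []" using ys xs(2) assms(2) by auto
  have "{last ys, k} \<in> E" "k \<notin> set ys" using xs(1) ne unfolding ys graph_path_snoc by auto
  moreover have "last ys \<le> k" using xs(4) ne unfolding ys by auto
  moreover have "last ys \<in> set ys" using ne by simp
  ultimately show ?thesis by (metis le_neq_implies_less)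
qed

text \<open>Of two smaller neighbours \<open>a\<close>, \<open>b\<close> of \<open>k\<close>, either \<open>b\<close> lies on the path from \<open>1\<close> to
  \<open>a\<close>, which closes a cycle through \<open>k\<close>, or the path from \<open>1\<close> to \<open>a\<close> continues to \<open>k\<close> and
  then down to \<open>b\<close>.\<close>

lemma smaller_neighbour_unique:
  assumes E: "E \<in> recursive_trees n" and k: "k \<in> {2..n}"
    and a: "a < k" "{a, k} \<in> E" and b: "b < k" "{b, k} \<in> E"
  shows "a = b"
proof (rule ccontr)
  assume ab: "a \<noteq> b"
  have sub: "\<forall>e\<in>E. e \<subseteq> {1..n}"
    using E by (auto simp: recursive_trees_def is_tree_def)
  then have "a \<in> {1..n}" using a by auto
  then obtain xs where xs: "graph_path E xs" "hd xs = 1" "last xs = a" "\<And>x. x \<in> set xs \<Longrightarrow> x \<le> a"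
    using recursive_tree_path_to[OF E] by blast
  have ne: "xs \<noteq> []" using xs(1) by (simp add: graph_path_def)
  have k_notin: "k \<notin> set xs" using xs(4) a(1) by force
  have path_k: "graph_path E (xs @ [k])"
    using xs(1,3) ne k_notin a(2) by (simp add: graph_path_snoc)
  show False
  proof (cases "b \<in> set xs")
    case True
    then obtain us vs where uv: "xs = us @ b # vs" by (meson split_list)
    have "vs \<noteq> []" using uv xs(3) ab by auto
    then obtain w ws where vs: "vs = w # ws" by (cases vs) auto
    have "graph_path E ((b # vs) @ [k])"
      using path_k unfolding uv graph_path_def by (auto simp: successively_append_iff)
    then have "graph_cycle E ((b # vs) @ [k])"
      using b(2) unfolding graph_cycle_def vs by (simp add: insert_commute)
    then show False using E by (auto simp: recursive_trees_def is_tree_def)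
  next
    case False
    have "graph_path E ((xs @ [k]) @ [b])"
      using path_k False b by (subst graph_path_snoc) (auto simp: insert_commute)
    moreover have "hd ((xs @ [k]) @ [b]) = 1" using xs(2) ne by simp
    ultimately have "sorted_wrt (<) ((xs @ [k]) @ [b])"
      using recursive_tree_path_sorted[OF E] by blast
    then show False using b(1) by (simp add: sorted_wrt_append)
  qed
qed

lemma recursive_tree_is_parent_tree:
  assumes E: "E \<in> recursive_trees n"
  shows "E \<in> parent_tree n ` parent_funs n"
proof -
  have sub: "\<forall>e\<in>E. e \<subseteq> {1..n} \<and> card e = 2"
    using E by (auto simp: recursive_trees_def is_tree_def)
  \<comment> \<open>The value \<open>undefined\<close> off \<open>{2..n}\<close> makes
    \<open>f\<close> extensional, as membership in \<open>parent_funs\<close> demands.\<close>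
  define f where "f = (\<lambda>k. if k \<in> {2..n} then (THE a. a < k \<and> {a, k} \<in> E) else undefined)"
  have f: "f k < k" "{f k, k} \<in> E" if "k \<in> {2..n}" for k
  proof -
    have "\<exists>!a. a < k \<and> {a, k} \<in> E"
      using smaller_neighbour_exists[OF E that] smaller_neighbour_unique[OF E that] by blast
    from theI'[OF this] show "f k < k" "{f k, k} \<in> E" using that by (auto simp: f_def)
  qed
  have "f k \<in> {1..<k}" if "k \<in> {2..n}" for k
    using f[OF that] sub by force
  then have "f \<in> parent_funs n"
    by (auto simp: parent_funs_def f_def)
  moreover have "E = parent_tree n f"
  proof (intro equalityI subsetI)
    fix e assume e: "e \<in> E"
    then obtain a b where ab: "e = {a, b}" "a \<noteq> b" using sub by (meson card_2_iff)
    define i where "i = min a b"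
    define k where "k = max a b"
    have ik: "e = {i, k}" "i < k" using ab by (auto simp: i_def k_def min_def max_def)
    have "k \<in> {2..n}" using sub e ik by force
    moreover from this have "i = f k"
      using smaller_neighbour_unique[OF E, of k i "f k"] f e ik by blast
    ultimately show "e \<in> parent_tree n f"
      by (auto simp: parent_tree_def parent_edge_def ik)
  next
    fix e assume "e \<in> parent_tree n f"
    then show "e \<in> E" using f by (auto simp: parent_tree_def parent_edge_def)
  qed
  ultimately show ?thesis by blast
qed

section \<open>Every parent function yields a recursive tree\<close>

lemma joined_refl: "joined E u u"
  unfolding joined_def graph_path_def by (intro exI[of _ "[u]"]) simp

text \<open>A \<open>graph_path\<close> may not repeat a vertex, so a path that has already met
  \<open>w\<close> is cut there rather than prolonged.\<close>

lemma joined_step: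
  assumes "joined E u v" "{v, w} \<in> E"
  shows "joined E u w"
proof -
  obtain xs where xs: "graph_path E xs" "hd xs = u" "last xs = v"
    using assms(1) by (auto simp: joined_def)
  have ne: "xs \<noteq> []" using xs(1) by (simp add: graph_path_def)
  show ?thesis
  proof (cases "w \<in> set xs")
    case True
    then obtain us vs where uv: "xs = us @ w # vs" by (meson split_list)
    then have "graph_path E (us @ [w])"
      using xs(1) by (auto simp: graph_path_def successively_append_iff)
    moreover have "hd (us @ [w]) = u" using xs(2) unfolding uv by (cases us) auto
    ultimately show ?thesis unfolding joined_def by (intro exI[of _ "us @ [w]"]) simp
  next
    case False
    then have "graph_path E (xs @ [w])" using xs assms(2) by (simp add: graph_path_snoc)
    then show ?thesis
      unfolding joined_def using xs ne by (intro exI[of _ "xs @ [w]"]) simp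
  qed
qed

lemma joined_sym:
  assumes "joined E u v"
  shows "joined E v u"
proof -
  obtain xs where xs: "graph_path E xs" "hd xs = u" "last xs = v"
    using assms by (auto simp: joined_def)
  then have "graph_path E (rev xs)" "hd (rev xs) = v" "last (rev xs) = u"
    by (auto simp: graph_path_def insert_commute hd_rev last_rev)
  then show ?thesis unfolding joined_def by blast
qed

lemma parent_tree_joined_root:
  assumes f: "f \<in> parent_funs n" and "joined (parent_tree n f) u 1" "v \<in> {1..n}"
  shows "joined (parent_tree n f) u v"
  using assms(3)
proof (induction v rule: less_induct)
  case (less v)
  show ?case
  proof (cases "v = 1")
    case False
    then have v: "v \<in> {2..n}" using less.prems by auto
    then have "joined (parent_tree n f) u (f v)"
      using less.IH parent_funsD[OF f v] by blast
    then show ?thesis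
      using v by (rule_tac joined_step[of _ _ "f v"]) (auto simp: edge_in_parent_tree_iff)
  qed (use assms(2) in simp)
qed

text \<open>The largest vertex of a cycle would have two different cyclic neighbours, both smaller
  and hence both equal to its parent.\<close>

lemma parent_tree_no_cycle:
  assumes f: "f \<in> parent_funs n"
  shows "\<not> graph_cycle (parent_tree n f) xs"
proof
  assume cyc: "graph_cycle (parent_tree n f) xs"
  then have len: "length xs \<ge> 3" and path: "graph_path (parent_tree n f) xs"
    and close: "{last xs, hd xs} \<in> parent_tree n f" by (auto simp: graph_cycle_def)
  define m where "m = Max (set xs)"
  have "xs \<noteq> []" using len by auto
  then have "m \<in> set xs" by (simp add: m_def)
  then obtain us vs where uv: "xs = us @ m # vs" by (meson split_list)
  have below: "x \<le> m" if "x \<in> set xs" for x using that by (simp add: m_def)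
  have dist: "distinct xs" and suc: "successively (\<lambda>u v. {u, v} \<in> parent_tree n f) xs"
    using path by (auto simp: graph_path_def)
  have nb: "x = f m" if "x \<in> set xs" "x \<noteq> m" "{x, m} \<in> parent_tree n f" for x
    using that below[OF that(1)] parent_funsD(2)[OF f, of x]
    unfolding edge_in_parent_tree_iff by force
  \<comment> \<open>\<open>l\<close> and \<open>r\<close> are the neighbours of \<open>m\<close> on
    the cycle; the conditionals wrap around when \<open>m\<close> is at an end of the list.\<close>
  define l where "l = (if us = [] then last vs else last us)"
  define r where "r = (if vs = [] then hd us else hd vs)"
  have ne: "us \<noteq> [] \<or> vs \<noteq> []" using len uv by auto
  have "l \<in> set xs - {m}" "r \<in> set xs - {m}"
    using ne dist by (auto simp: l_def r_def uv)
  moreover have "{l, m} \<in> parent_tree n f"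
  proof (cases "us = []")
    case True then show ?thesis using close ne by (simp add: l_def uv)
  next
    case False then show ?thesis using suc by (simp add: l_def uv successively_append_iff)
  qed
  moreover have "{r, m} \<in> parent_tree n f"
  proof (cases "vs = []")
    case True then show ?thesis using close ne by (simp add: r_def uv insert_commute)
  next
    case False then show ?thesis using suc
      by (cases vs) (auto simp: r_def uv successively_append_iff insert_commute)
  qed
  ultimately have lr: "l = r" using nb by auto
  show False
  proof (cases "us = [] \<or> vs = []")
    case True
    then show False
    proof
      assume us: "us = []"
      then have "length vs \<ge> 2" "hd vs = last vs" using len lr ne by (auto simp: l_def r_def uv)
      then show False using dist us
        by (cases vs) (auto simp: uv last_in_set split: if_splits)
    next
      assume vs: "vs = []"
      then have "length us \<ge> 2" "hd us = last us" using len lr ne by (auto simp: l_def r_def uv)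
      then show False using dist vs
        by (cases us) (auto simp: uv split: if_splits)
    qed
  next
    case False
    then have "last us = hd vs" using lr by (simp add: l_def r_def)
    moreover have "last us \<in> set us" "hd vs \<in> set vs" using False by auto
    ultimately show False using dist unfolding uv by auto
  qed
qed

text \<open>The second conjunct strengthens the induction: once the parent of the last vertex has
  been visited, the path can continue only to a child, which carries a larger label.\<close>

lemma parent_tree_path_sorted:
  assumes f: "f \<in> parent_funs n" and "graph_path (parent_tree n f) xs" "hd xs = 1"
  shows "sorted_wrt (<) xs \<and> (last xs = 1 \<or> f (last xs) \<in> set xs)"
  using assms(2,3)
proof (induction xs rule: rev_induct)
  case (snoc v xs)
  show ?case
  proof (cases "xs = []")
    case False
    then have path: "graph_path (parent_tree n f) xs" "v \<notin> set xs" "{last xs, v} \<in> parent_tree n f"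
      using snoc.prems by (auto simp: graph_path_snoc)
    have IH: "sorted_wrt (<) xs" "last xs = 1 \<or> f (last xs) \<in> set xs"
      using snoc.IH path(1) snoc.prems False by auto
    have v: "v \<in> {2..n}" "last xs = f v"
    proof -
      have "\<not> (last xs \<in> {2..n} \<and> v = f (last xs))"
        using IH(2) path(2) by auto
      then show "v \<in> {2..n}" "last xs = f v" using path(3) by (auto simp: edge_in_parent_tree_iff)
    qed
    have "x < v" if "x \<in> set xs" for x
      using sorted_wrt_less_le_last[OF IH(1) that] parent_funsD[OF f v(1)] v(2) by linarith
    moreover have "f v \<in> set xs" using v(2) False by (metis last_in_set)
    ultimately show ?thesis using IH by (auto simp: sorted_wrt_append)
  qed (use snoc.prems in simp)
qed (simp add: graph_path_def)

lemma parent_tree_is_recursive_tree: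
  assumes f: "f \<in> parent_funs n" and n: "n \<ge> 1"
  shows "parent_tree n f \<in> recursive_trees n"
proof -
  have conn: "joined (parent_tree n f) u v" if "u \<in> {1..n}" "v \<in> {1..n}" for u v
    using parent_tree_joined_root[OF f joined_sym[OF parent_tree_joined_root[OF f joined_refl that(1)]] that(2)] .
  have "e \<subseteq> {1..n} \<and> card e = 2" if "e \<in> parent_tree n f" for e
    using that parent_funsD[OF f] by (fastforce simp: parent_tree_def parent_edge_def)
  then have "is_tree {1..n} (parent_tree n f)"
    unfolding is_tree_def using n conn parent_tree_no_cycle[OF f] by auto
  then show ?thesis
    using parent_tree_path_sorted[OF f] by (auto simp: recursive_trees_def branch_def)
qed

lemma recursive_trees_eq:
  "n \<ge> 1 \<Longrightarrow> recursive_trees n = parent_tree n ` parent_funs n"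
  using recursive_tree_is_parent_tree parent_tree_is_recursive_tree by blast

lemma parent_tree_inj_on: "inj_on (parent_tree n) (parent_funs n)"
proof (rule inj_onI)
  fix f g assume fg: "f \<in> parent_funs n" "g \<in> parent_funs n" "parent_tree n f = parent_tree n g"
  have "f k = g k" if "k \<in> {2..n}" for k
  proof -
    have "{f k, k} \<in> parent_tree n g"
      using that fg(3)[symmetric] by (auto simp: parent_tree_def parent_edge_def)
    then show ?thesis
      using parent_funsD(2)[OF fg(1) that] parent_funsD(2)[OF fg(2), of "f k"]
      unfolding edge_in_parent_tree_iff by force
  qed
  then show "f = g"
    using PiE_ext[OF fg(1,2)[unfolded parent_funs_def]] by blast
qed

section \<open>The dynamics along ancestral paths\<close>

text \<open>The guard makes the recursion terminate for every function \<open>f\<close>; for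
  \<open>f\<close> in \<open>parent_funs n\<close> and \<open>x\<close> in \<open>{2..n}\<close> it
  always holds.\<close>

function anc :: "(nat \<Rightarrow> nat) \<Rightarrow> nat \<Rightarrow> nat set" where
  "anc f x = insert x (if 1 < x \<and> f x < x then anc f (f x) else {})"
  by auto
termination by (relation "inv_image less_than snd") auto

declare anc.simps [simp del]

lemma anc_self [simp]: "x \<in> anc f x"
  by (subst anc.simps) simp

lemma anc_root: "anc f (Suc 0) = {Suc 0}"
  by (subst anc.simps) simp

lemma anc_cases: "y \<in> anc f x \<Longrightarrow> y \<noteq> x \<Longrightarrow> 1 < x \<and> f x < x \<and> y \<in> anc f (f x)"
  by (subst (asm) anc.simps) (simp split: if_splits)

lemma anc_le: "y \<in> anc f x \<Longrightarrow> y \<le> x"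
proof (induction x rule: less_induct)
  case (less x)
  show ?case
    using anc_cases[OF less.prems] less.IH[of "f x"] by (cases "y = x") auto
qed

lemma finite_anc [simp]: "finite (anc f x)"
  by (rule finite_subset[of _ "{..x}"]) (auto dest: anc_le)

lemma anc_trans: "y \<in> anc f x \<Longrightarrow> z \<in> anc f y \<Longrightarrow> z \<in> anc f x"
proof (induction x rule: less_induct)
  case (less x)
  show ?case
  proof (cases "y = x")
    case False
    then have "1 < x" "f x < x" "y \<in> anc f (f x)"
      using anc_cases[OF less.prems(1)] by auto
    then have "z \<in> anc f (f x)" using less by blast
    then show ?thesis using \<open>1 < x\<close> \<open>f x < x\<close> by (subst anc.simps) simp
  qed (use less.prems in simp)
qed

lemma anc_step:
  assumes "f \<in> parent_funs n" "x \<in> {2..n}"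
  shows "anc f x = insert x (anc f (f x))"
  using parent_funsD[OF assms] assms(2) by (subst anc.simps) simp

lemma anc_range:
  assumes "f \<in> parent_funs n" "x \<in> {1..n}"
  shows "anc f x \<subseteq> {1..n}" "1 \<in> anc f x"
proof -
  have "anc f x \<subseteq> {1..n} \<and> 1 \<in> anc f x"
    using assms(2)
  proof (induction x rule: less_induct)
    case (less x)
    show ?case
    proof (cases "x = 1")
      case False
      then have x: "x \<in> {2..n}" using less.prems by auto
      then show ?thesis
        using less.IH[of "f x"] parent_funsD[OF assms(1) x] less.prems
        by (simp add: anc_step[OF assms(1) x])
    qed (use less.prems in \<open>simp add: anc_root\<close>)
  qed
  then show "anc f x \<subseteq> {1..n}" "1 \<in> anc f x" by auto
qed

lemma anc_parent:
  assumes "f \<in> parent_funs n" "x \<in> {2..n}" "t \<in> anc f x" "t < x"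
  shows "t \<in> anc f (f x)"
  using assms(3,4) by (simp add: anc_step[OF assms(1,2)])

text \<open>\<open>seg f t x\<close> indexes the edges of the path from \<open>x\<close> up to its ancestor \<open>t\<close>, an edge
  being identified with its lower extremity.\<close>

definition seg :: "(nat \<Rightarrow> nat) \<Rightarrow> nat \<Rightarrow> nat \<Rightarrow> nat set" where
  "seg f t x = {y \<in> anc f x. t < y}"

lemma finite_seg [simp]: "finite (seg f t x)"
  by (simp add: seg_def)

lemma seg_step:
  assumes "f \<in> parent_funs n" "x \<in> {2..n}" "t < x"
  shows "seg f t x = insert x (seg f t (f x))"
  using assms(3) by (auto simp: seg_def anc_step[OF assms(1,2)])

lemma seg_subset:
  assumes "f \<in> parent_funs n" "x \<in> {1..n}" "t \<ge> 1"
  shows "seg f t x \<subseteq> {2..n}"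
  using anc_range(1)[OF assms(1,2)] assms(3) by (force simp: seg_def)

lemma seg_mono:
  assumes "z \<in> anc f x"
  shows "seg f t z \<subseteq> seg f t x"
  using anc_trans[OF assms] by (auto simp: seg_def)

text \<open>This edge touches the one above \<open>t\<close>; \<open>burnt_vertex_cause\<close> uses
  it to see that a burnt edge above \<open>t\<close> would already have spread into the
  path.\<close>

lemma seg_top_child:
  assumes "f \<in> parent_funs n" "x \<in> {2..n}" "t \<in> anc f x" "t < x" "t \<ge> 1"
  shows "\<exists>c \<in> seg f t x. f c = t"
  using assms(2-4)
proof (induction x rule: less_induct)
  case (less x)
  note x = parent_funsD[OF assms(1) less.prems(1)]
  show ?case
  proof (cases "f x = t")
    case True
    then show ?thesis using less.prems(3) by (intro bexI[of _ x]) (auto simp: seg_def)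
  next
    case False
    have t: "t \<in> anc f (f x)" using anc_parent[OF assms(1)] less.prems by blast
    then have "t < f x" using anc_le[OF t] False by simp
    moreover have "f x \<in> {2..n}" using x \<open>t < f x\<close> assms(5) by auto
    ultimately obtain c where "c \<in> seg f t (f x)" "f c = t" using less.IH[OF x(2)] t by blast
    then show ?thesis using seg_step[OF assms(1) less.prems(1,3)] by auto
  qed
qed

section \<open>Dynamics with decisions drawn in advance\<close>

definition det_step ::
    "(nat \<Rightarrow> nat set) \<Rightarrow> nat set set \<Rightarrow> (nat \<Rightarrow> bool) \<Rightarrow> nat \<Rightarrow> (nat set \<Rightarrow> edge_status) \<Rightarrow> (nat set \<Rightarrow> edge_status)" where
  "det_step h E b v s =
     (if s (h v) = Burnt then s else if b v then ignite E (h v) s else s(h v := Fireproof))"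

primrec det_run ::
    "(nat \<Rightarrow> nat set) \<Rightarrow> nat set set \<Rightarrow> (nat \<Rightarrow> bool) \<Rightarrow> nat list \<Rightarrow> (nat set \<Rightarrow> edge_status) \<Rightarrow> (nat set \<Rightarrow> edge_status)" where
  "det_run h E b [] s = s"
| "det_run h E b (v # vs) s = det_run h E b vs (det_step h E b v s)"

lemma det_run_append: "det_run h E b (us @ vs) s = det_run h E b vs (det_run h E b us s)"
  by (induction us arbitrary: s) simp_all

lemma det_run_cong: "(\<And>v. v \<in> set vs \<Longrightarrow> b v = b' v) \<Longrightarrow> det_run h E b vs s = det_run h E b' vs s"
  by (induction vs arbitrary: s) (simp_all add: det_step_def)

text \<open>Decisions may be drawn for all edges beforehand, because the one belonging to a burnt
  edge is simply ignored. Distinctness lets the mark of \<open>v\<close> be split off: the rest of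
  the run does not read it.\<close>

lemma fire_run_eq_det_run:
  assumes "distinct vs"
  shows "fire_run p E (map h vs) s =
    map_pmf (\<lambda>b. det_run h E b vs s) (Pi_pmf (set vs) False (\<lambda>_. bernoulli_pmf p))"
  using assms
proof (induction vs arbitrary: s)
  case (Cons v vs)
  let ?P = "Pi_pmf (set vs) False (\<lambda>_. bernoulli_pmf p)"
  have upd: "det_run h E (b(v := c)) vs s' = det_run h E b vs s'" for b c s'
    using Cons.prems by (intro det_run_cong) auto
  have "map_pmf (\<lambda>b. det_run h E b (v # vs) s) (Pi_pmf (set (v # vs)) False (\<lambda>_. bernoulli_pmf p))
    = bind_pmf (bernoulli_pmf p) (\<lambda>c. bind_pmf ?P
        (\<lambda>b. return_pmf (det_run h E b vs
          (if s (h v) = Burnt then s else if c then ignite E (h v) s else s(h v := Fireproof)))))"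
    using Cons.prems by (simp add: Pi_pmf_insert' map_bind_pmf upd det_step_def cong: if_cong)
  also have "\<dots> = fire_run p E (map h (v # vs)) s"
  proof (cases "s (h v) = Burnt")
    case True
    then show ?thesis
      using Cons by (simp add: fire_step_def map_pmf_def bind_return_pmf)
  next
    case False
    then show ?thesis
      using Cons by (simp add: fire_step_def map_pmf_def bind_assoc_pmf bind_return_pmf)
  qed
  finally show ?case ..
qed simp

lemma det_step_Burnt: "s e = Burnt \<Longrightarrow> det_step h E b v s e = Burnt"
  by (auto simp: det_step_def ignite_def)

lemma det_run_Burnt: "s e = Burnt \<Longrightarrow> det_run h E b vs s e = Burnt"
  by (induction vs arbitrary: s) (simp_all add: det_step_Burnt)

definition fire_state :: "nat \<Rightarrow> (nat \<Rightarrow> nat) \<Rightarrow> (nat \<Rightarrow> bool) \<Rightarrow> nat list \<Rightarrow> (nat set \<Rightarrow> edge_status)" where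
  "fire_state n f b vs = det_run (parent_edge f) (parent_tree n f) b vs (\<lambda>_. Flammable)"

lemma fire_state_snoc:
  "fire_state n f b (vs @ [v]) = det_step (parent_edge f) (parent_tree n f) b v (fire_state n f b vs)"
  by (simp add: fire_state_def det_run_append)

lemma fire_state_Burnt_mono: "fire_state n f b us e = Burnt \<Longrightarrow> fire_state n f b (us @ vs) e = Burnt"
  by (simp add: fire_state_def det_run_append det_run_Burnt)

text \<open>An edge can become fireproof only at its own turn. Injectivity of
  \<open>parent_edge\<close> lets turns be recorded by lower extremities.\<close>

lemma fire_state_unprocessed:
  assumes f: "f \<in> parent_funs n" and "set vs \<subseteq> {2..n}" "y \<in> {2..n}" "y \<notin> set vs"
  shows "fire_state n f b vs (parent_edge f y) \<noteq> Fireproof"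
  using assms(2,4)
proof (induction vs rule: rev_induct)
  case (snoc v vs)
  then have "parent_edge f y \<noteq> parent_edge f v"
    using inj_onD[OF parent_edge_inj_on[OF f], of y v] assms(3) by auto
  then show ?case
    using snoc by (auto simp: fire_state_snoc det_step_def ignite_def)
qed (simp add: fire_state_def)

lemma fire_state_processed:
  "y \<in> set vs \<Longrightarrow> fire_state n f b vs (parent_edge f y) \<noteq> Flammable"
proof (induction vs rule: rev_induct)
  case (snoc v vs)
  then show ?case
    by (auto simp: fire_state_snoc det_step_def ignite_def fire_cluster.start)
qed simp

text \<open>Instant propagation as an invariant: a step that burns an edge also burns its flammable
  neighbours.\<close>

lemma fire_state_adjacent:
  assumes "y \<in> {2..n}" "z \<in> {2..n}" "parent_edge f y \<inter> parent_edge f z \<noteq> {}"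
    and "fire_state n f b vs (parent_edge f y) = Burnt"
  shows "fire_state n f b vs (parent_edge f z) \<noteq> Flammable"
  using assms(4)
proof (induction vs rule: rev_induct)
  case Nil
  then show ?case by (simp add: fire_state_def)
next
  case (snoc v vs)
  let ?s = "fire_state n f b vs" and ?E = "parent_tree n f" and ?h = "parent_edge f"
  have "?h z \<in> fire_cluster ?E ?s (?h v)" if "?h y \<in> fire_cluster ?E ?s (?h v)" "?s (?h z) = Flammable"
    by (rule fire_cluster.spread[OF that(1) _ that(2) assms(3)]) (use assms(2) in \<open>simp add: parent_tree_def\<close>)
  moreover have "?s (?h z) \<noteq> Flammable" if "?s (?h y) = Burnt"
    using snoc.IH that .
  ultimately show ?case
    using snoc.prems
    by (auto simp: fire_state_snoc det_step_def ignite_def split: if_splits)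
qed

section \<open>Order of consideration and origin of a fire\<close>

definition pos :: "'a list \<Rightarrow> 'a \<Rightarrow> nat" where
  "pos vs y = length (takeWhile (\<lambda>z. z \<noteq> y) vs)"

definition first_in :: "'a list \<Rightarrow> 'a \<Rightarrow> 'a set \<Rightarrow> bool" where
  "first_in vs x S \<longleftrightarrow> (\<forall>y\<in>S. y \<noteq> x \<longrightarrow> pos vs x < pos vs y)"

lemma length_takeWhile_neq_less: "y \<in> set us \<Longrightarrow> length (takeWhile (\<lambda>z. z \<noteq> y) us) < length us"
  by (induction us) auto

text \<open>Translates positions into membership in the prefix \<open>us\<close> processed before
  \<open>x\<close>. An absent \<open>y\<close> has the length of the list as its position and so
  counts as later than \<open>x\<close>.\<close>

lemma pos_less_iff:
  assumes "x \<notin> set us"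
  shows "pos (us @ x # ws) y < pos (us @ x # ws) x \<longleftrightarrow> y \<in> set us"
proof -
  have "takeWhile (\<lambda>z. z \<noteq> x) (us @ x # ws) = us"
    using assms by (subst takeWhile_append2) auto
  then have x: "pos (us @ x # ws) x = length us" by (simp add: pos_def)
  show ?thesis
  proof (cases "y \<in> set us")
    case True
    then have "takeWhile (\<lambda>z. z \<noteq> y) (us @ x # ws) = takeWhile (\<lambda>z. z \<noteq> y) us"
      by (intro takeWhile_append1) auto
    moreover have "length (takeWhile (\<lambda>z. z \<noteq> y) us) < length us"
      using True by (rule length_takeWhile_neq_less)
    ultimately show ?thesis using True x by (simp add: pos_def)
  next
    case False
    then have "takeWhile (\<lambda>z. z \<noteq> y) (us @ x # ws) = us @ takeWhile (\<lambda>z. z \<noteq> y) (x # ws)"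
      by (intro takeWhile_append2) auto
    then show ?thesis using False x by (simp add: pos_def)
  qed
qed

lemma pos_inj:
  assumes "pos vs x = pos vs y" "x \<in> set vs" "y \<in> set vs"
  shows "x = y"
proof -
  have "vs ! pos vs z = z" if "z \<in> set vs" for z
  proof -
    have "\<not> (vs ! pos vs z \<noteq> z)"
      unfolding pos_def using that
      by (intro nth_length_takeWhile) (rule length_takeWhile_neq_less)
    then show ?thesis by simp
  qed
  then show ?thesis using assms by metis
qed

text \<open>If \<open>ignites f b vs t x\<close> with \<open>t \<noteq> 1\<close>, the edge above \<open>t\<close> has been considered before the
  fire starts, so it stops a fire that reaches \<open>t\<close> from below.\<close>

definition ignites :: "(nat \<Rightarrow> nat) \<Rightarrow> (nat \<Rightarrow> bool) \<Rightarrow> nat list \<Rightarrow> nat \<Rightarrow> nat \<Rightarrow> bool" where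
  "ignites f b vs t x \<longleftrightarrow> t \<in> anc f x \<and> t < x \<and> b x \<and> first_in vs x (seg f t x) \<and>
     (t = 1 \<or> pos vs t < pos vs x)"

text \<open>Invariant of the spreading fire. Below \<open>t\<close> it moves along flammable paths,
  but to leave through \<open>t\<close> it would have to use a flammable edge above
  \<open>t\<close>, which \<open>top\<close> excludes.\<close>

lemma fire_cluster_below_top:
  assumes f: "f \<in> parent_funs n" and e: "e \<in> fire_cluster (parent_tree n f) s (parent_edge f x)"
    and x: "x \<in> {2..n}" and t: "t \<in> anc f x" "t < x" "t \<ge> 1"
    and flam: "\<And>y. y \<in> seg f t x \<Longrightarrow> s (parent_edge f y) = Flammable"
    and top: "t = 1 \<or> s (parent_edge f t) \<noteq> Flammable"
  shows "\<exists>z\<in>{2..n}. e = parent_edge f z \<and> t \<in> anc f z \<and> t < z \<and>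
           (\<forall>y\<in>seg f t z. s (parent_edge f y) = Flammable)"
  using e
proof induction
  case start
  then show ?case using x t flam by blast
next
  case (spread e' e'')
  then obtain z where z: "z \<in> {2..n}" "e' = parent_edge f z" "t \<in> anc f z" "t < z"
    "\<forall>y\<in>seg f t z. s (parent_edge f y) = Flammable" by blast
  obtain z' where z': "z' \<in> {2..n}" "e'' = parent_edge f z'"
    using spread.hyps(2) unfolding parent_tree_def by blast
  have fz': "s (parent_edge f z') = Flammable" using spread.hyps z' by simp
  note pz = parent_funsD[OF f z(1)] and pz' = parent_funsD[OF f z'(1)]
  have tz: "t \<in> anc f (f z)" using anc_parent[OF f z(1,3,4)] .
  have step: "t \<in> anc f z' \<and> t < z' \<and> (\<forall>y\<in>seg f t z'. s (parent_edge f y) = Flammable)"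
    if "f z' \<in> anc f z" "t \<in> anc f (f z')"
  proof -
    have "t \<in> anc f z'" using that(2) by (simp add: anc_step[OF f z'(1)])
    moreover have "t < z'" using anc_le[OF that(2)] pz' by simp
    moreover have "seg f t z' \<subseteq> insert z' (seg f t z)"
      using seg_step[OF f z'(1)] \<open>t < z'\<close> seg_mono[OF that(1)] by auto
    ultimately show ?thesis using z(5) fz' by blast
  qed
  have fz_anc: "f z \<in> anc f z" by (simp add: anc_step[OF f z(1)])
  \<comment> \<open>Two edges that meet are equal, consecutive in one of two directions, or
    siblings.\<close>
  consider "z' = z" | "f z' = z" | "z' = f z" | "f z' = f z"
    using spread.hyps(4) unfolding z z' parent_edge_def by auto
  then have "t \<in> anc f z' \<and> t < z' \<and> (\<forall>y\<in>seg f t z'. s (parent_edge f y) = Flammable)"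
  proof cases
    case 1 then show ?thesis using z by simp
  next
    case 2 then show ?thesis using step z(3) by simp
  next
    case 3
    have "t \<noteq> z'" using top fz' z'(1) by auto
    then have "t < z'" using anc_le[OF tz] 3 by simp
    then show ?thesis using z(5) tz 3 seg_mono[OF fz_anc, of t] by auto
  next
    case 4 then show ?thesis using step tz fz_anc by simp
  qed
  then show ?case using z' by blast
qed

lemma in_parent_tree: "z \<in> {2..n} \<Longrightarrow> parent_edge f z \<in> parent_tree n f"
  by (simp add: parent_tree_def)

text \<open>Look at the moment when an edge at \<open>w\<close> first burns. The edge then
  considered is \<open>x\<close>, and \<open>t\<close> is the nearest ancestor of \<open>x\<close>
  where the fire is stopped upwards, by a non-flammable edge or because \<open>t\<close> is the
  root. The last clause holds because an edge from \<open>w\<close> to a child that had not been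
  considered by then would have been flammable and would have burnt.\<close>

lemma burnt_vertex_cause:
  assumes f: "f \<in> parent_funs n" and vs: "vs \<in> permutations_of_set {2..n}" and w: "w \<in> {1..n}"
    and burnt: "\<not> fireproof_vertex (parent_tree n f) (fire_state n f b vs) w"
  shows "\<exists>t x. t \<in> anc f w \<and> x \<in> {2..n} \<and> ignites f b vs t x \<and>
    (\<forall>u\<in>{2..n}. f u = w \<longrightarrow> fire_state n f b vs (parent_edge f u) = Fireproof \<longrightarrow> pos vs u < pos vs x)"
proof -
  let ?h = "parent_edge f" and ?E = "parent_tree n f"
  have set_vs: "set vs = {2..n}" "distinct vs" using vs by (auto dest: permutations_of_setD)
  define B where "B = (\<lambda>us. \<exists>y\<in>{2..n}. w \<in> ?h y \<and> fire_state n f b us (?h y) = Burnt)"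
  have B_vs: "B vs"
  proof -
    obtain y where y: "y \<in> {2..n}" "w \<in> ?h y" "fire_state n f b vs (?h y) \<noteq> Fireproof"
      using burnt by (auto simp: fireproof_vertex_def parent_tree_def)
    moreover have "fire_state n f b vs (?h y) \<noteq> Flammable"
      using fire_state_processed y(1) set_vs(1) by blast
    ultimately show ?thesis unfolding B_def by (metis edge_status.exhaust)
  qed
  \<comment> \<open>Picks out the turn \<open>x\<close> at which \<open>B\<close> becomes
    true.\<close>
  have "B xs \<Longrightarrow> \<exists>us x ws. xs = us @ x # ws \<and> \<not> B us \<and> B (us @ [x])" for xs
  proof (induction xs rule: rev_induct)
    case Nil then show ?case by (simp add: B_def fire_state_def)
  next
    case (snoc v xs)
    then show ?case
    proof (cases "B xs")
      case True
      with snoc.IH obtain us x ws where "xs = us @ x # ws" "\<not> B us" "B (us @ [x])" by blast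
      then show ?thesis by (intro exI[of _ us] exI[of _ x] exI[of _ "ws @ [v]"]) simp
    qed blast
  qed
  from this[OF B_vs] obtain us x ws where dec: "vs = us @ x # ws" "\<not> B us" "B (us @ [x])" by blast
  let ?s = "fire_state n f b us"
  have x: "x \<in> {2..n}" "x \<notin> set us" "set us \<subseteq> {2..n}" using set_vs unfolding dec by auto
  have before: "pos vs y < pos vs x \<longleftrightarrow> y \<in> set us" for y
    unfolding dec(1) by (rule pos_less_iff[OF x(2)])
  obtain g where g: "g \<in> {2..n}" "w \<in> ?h g" "fire_state n f b (us @ [x]) (?h g) = Burnt"
    using dec(3) by (auto simp: B_def)
  have not_burnt: "?s (?h y) \<noteq> Burnt" if "y \<in> {2..n}" "w \<in> ?h y" for y
    using dec(2) that by (auto simp: B_def)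
  have st: "?s (?h x) \<noteq> Burnt" "b x" "?h g \<in> fire_cluster ?E ?s (?h x)"
    using g(3) not_burnt[OF g(1,2)]
    by (auto simp: fire_state_snoc det_step_def ignite_def split: if_splits)
  have fx: "?s (?h x) = Flammable"
    using st(1) fire_state_unprocessed[OF f x(3,1,2)] by (metis edge_status.exhaust)
  have x1: "x \<in> {1..n}" using x by auto
  \<comment> \<open>Labels decrease towards the root, so \<open>Max K\<close> is the barrier nearest
    to \<open>x\<close>.\<close>
  define K where "K = {y \<in> anc f x. y = 1 \<or> ?s (?h y) \<noteq> Flammable}"
  have finK: "finite K" by (simp add: K_def)
  have "1 \<in> K" using anc_range(2)[OF f x1] by (simp add: K_def)
  define t where "t = Max K"
  have tK: "t \<in> K" using finK \<open>1 \<in> K\<close> unfolding t_def by (intro Max_in) auto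
  then have t: "t \<in> anc f x" "t = 1 \<or> ?s (?h t) \<noteq> Flammable" by (auto simp: K_def)
  have tx: "t < x" using anc_le[OF t(1)] t(2) fx x(1) by (cases "t = x") auto
  have t1: "t \<ge> 1" using anc_range(1)[OF f x1] t(1) by auto
  have flam: "?s (?h y) = Flammable" if "y \<in> seg f t x" for y
  proof (rule ccontr)
    assume "?s (?h y) \<noteq> Flammable"
    then have "y \<in> K" using that by (simp add: K_def seg_def)
    then have "y \<le> t" using finK by (simp add: t_def)
    then show False using that by (simp add: seg_def)
  qed
  obtain z where z: "z \<in> {2..n}" "?h g = ?h z" "t \<in> anc f z" "t < z"
    using fire_cluster_below_top[OF f st(3) x(1) t(1) tx t1 flam t(2)] by blast
  have "w = z \<or> w = f z" using g(2) z(2) by (auto simp: parent_edge_def)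
  then have tw: "t \<in> anc f w" using z anc_parent[OF f z(1,3,4)] by auto
  have "first_in vs x (seg f t x)"
    unfolding first_in_def
  proof (intro ballI impI)
    fix y assume y: "y \<in> seg f t x" "y \<noteq> x"
    have y2: "y \<in> set vs" using seg_subset[OF f x1 t1] y set_vs by auto
    have "y \<notin> set us" using flam[OF y(1)] fire_state_processed by metis
    then have "\<not> pos vs y < pos vs x" using before by simp
    moreover have "pos vs y \<noteq> pos vs x" using pos_inj y2 y(2) x(1) set_vs by metis
    ultimately show "pos vs x < pos vs y" by simp
  qed
  \<comment> \<open>If the edge above \<open>t\<close> had not yet been considered, it could be
    non-flammable only by having burnt, and its fire would have taken the path edge \<open>c\<close>
    hanging from \<open>t\<close>.\<close>
  moreover have "t = 1 \<or> pos vs t < pos vs x"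
  proof (rule disjCI)
    assume "\<not> pos vs t < pos vs x"
    then have t_us: "t \<notin> set us" using before by simp
    show "t = 1"
    proof (rule ccontr)
      assume "t \<noteq> 1"
      then have t2: "t \<in> {2..n}" using t1 tx x(1) by auto
      have "?s (?h t) = Burnt"
        using fire_state_unprocessed[OF f x(3) t2 t_us] t(2) \<open>t \<noteq> 1\<close> by (metis edge_status.exhaust)
      moreover obtain c where c: "c \<in> seg f t x" "f c = t"
        using seg_top_child[OF f x(1) t(1) tx t1] by blast
      ultimately have "?s (?h c) \<noteq> Flammable"
        using fire_state_adjacent[OF t2, of c f b us] seg_subset[OF f x1 t1]
        by (auto simp: parent_edge_def)
      then show False using flam c(1) by simp
    qed
  qed
  moreover have "pos vs u < pos vs x"
    if u: "u \<in> {2..n}" "f u = w" "fire_state n f b vs (?h u) = Fireproof" for u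
  proof (rule ccontr)
    assume "\<not> pos vs u < pos vs x"
    then have u_us: "u \<notin> set us" using before by simp
    have wu: "w \<in> ?h u" using u by (simp add: parent_edge_def)
    have "?s (?h u) = Flammable"
      using fire_state_unprocessed[OF f x(3) u(1) u_us] not_burnt[OF u(1) wu] by (metis edge_status.exhaust)
    then have "?h u \<in> fire_cluster ?E ?s (?h x)"
      using g(2) wu by (intro fire_cluster.spread[OF st(3) in_parent_tree[OF u(1)]]) auto
    then have "fire_state n f b (us @ [x]) (?h u) = Burnt"
      using st by (simp add: fire_state_snoc det_step_def ignite_def)
    then have "fire_state n f b vs (?h u) = Burnt"
      using fire_state_Burnt_mono[of n f b "us @ [x]" "?h u" ws] dec by simp
    then show False using u by simp
  qed
  ultimately show ?thesis
    unfolding ignites_def using tw x(1) t(1) tx st(2) by blast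
qed

text \<open>Two adjacent edges, neither of them fireproof, are both burnt or both flammable by
  \<open>fire_state_adjacent\<close>; this propagates along the path.\<close>

lemma same_status_on_path:
  assumes f: "f \<in> parent_funs n" and x: "x \<in> {2..n}"
    and nf: "\<And>y. y \<in> seg f 1 x \<Longrightarrow> fire_state n f b us (parent_edge f y) \<noteq> Fireproof"
    and y: "y \<in> seg f 1 x"
  shows "fire_state n f b us (parent_edge f y) = fire_state n f b us (parent_edge f x)"
  using x nf y
proof (induction x rule: less_induct)
  case (less x)
  let ?s = "\<lambda>y. fire_state n f b us (parent_edge f y)"
  note px = parent_funsD[OF f less.prems(1)]
  have seg: "seg f 1 x = insert x (seg f 1 (f x))"
    using seg_step[OF f less.prems(1)] less.prems(1) by auto
  show ?case
  proof (cases "y = x")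
    case False
    then have y: "y \<in> seg f 1 (f x)" using less.prems(3) seg by auto
    then have fx: "f x \<in> {2..n}"
      using px anc_le[of y f "f x"] by (auto simp: seg_def)
    have fx_seg: "f x \<in> seg f 1 x" unfolding seg using fx by (simp add: seg_def)
    have "?s y = ?s (f x)"
      using less.IH[OF px(2) fx _ y] less.prems(2) seg by blast
    also have "\<dots> = ?s x"
    proof -
      have adj: "parent_edge f (f x) \<inter> parent_edge f x \<noteq> {}" by (auto simp: parent_edge_def)
      have "?s x \<noteq> Fireproof" using less.prems(2) seg by auto
      moreover have "?s (f x) \<noteq> Fireproof" using less.prems(2) fx_seg by auto
      moreover note fire_state_adjacent[OF fx less.prems(1) adj, of b us]
        fire_state_adjacent[OF less.prems(1) fx, of f b us] adj
      ultimately show ?thesis by (metis Int_commute edge_status.exhaust)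
    qed
    finally show ?thesis .
  qed simp
qed

text \<open>When \<open>x\<close> gets its turn, no other edge of its path to the root has been
  considered, so none is fireproof; as \<open>x\<close> is burnt after this turn, so is the whole
  path up to an edge at the root.\<close>

lemma ignited_root_burns:
  assumes f: "f \<in> parent_funs n" and vs: "vs \<in> permutations_of_set {2..n}"
    and x: "x \<in> {2..n}" "ignites f b vs 1 x"
  shows "\<not> fireproof_vertex (parent_tree n f) (fire_state n f b vs) 1"
proof -
  have set_vs: "set vs = {2..n}" "distinct vs" using vs by (auto dest: permutations_of_setD)
  have x1: "x \<in> {1..n}" using x(1) by auto
  obtain us ws where dec: "vs = us @ x # ws" using x(1) set_vs by (metis split_list)
  have x_us: "x \<notin> set us" using set_vs dec by auto
  have before: "pos vs y < pos vs x \<longleftrightarrow> y \<in> set us" for y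
    unfolding dec(1) by (rule pos_less_iff[OF x_us])
  let ?s = "\<lambda>y. fire_state n f b (us @ [x]) (parent_edge f y)"
  \<comment> \<open>Holds in both cases: either an earlier fire has reached \<open>x\<close>, or its
    own mark ignites it.\<close>
  have bx: "?s x = Burnt"
    using x(2) by (simp add: fire_state_snoc det_step_def ignites_def ignite_def fire_cluster.start)
  have "?s y \<noteq> Fireproof" if "y \<in> seg f 1 x" for y
  proof (cases "y = x")
    case False
    have "pos vs x < pos vs y" using x(2) that False by (simp add: ignites_def first_in_def)
    then have "y \<notin> set us" using before[of y] by auto
    moreover have "y \<in> {2..n}" using seg_subset[OF f x1, of 1] that by auto
    moreover have "set (us @ [x]) \<subseteq> {2..n}" using set_vs dec by auto
    ultimately show ?thesis using False by (intro fire_state_unprocessed[OF f]) auto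
  qed (use bx in simp)
  from same_status_on_path[OF f x(1) this] bx
  have all: "?s y = Burnt" if "y \<in> seg f 1 x" for y using that by simp
  obtain c where c: "c \<in> seg f 1 x" "f c = 1"
    using seg_top_child[OF f x(1) anc_range(2)[OF f x1]] x(1) by auto
  have "fire_state n f b vs (parent_edge f c) = Burnt"
    using fire_state_Burnt_mono[OF all[OF c(1)], of ws] dec by simp
  moreover have "parent_edge f c \<in> parent_tree n f"
    using seg_subset[OF f x1, of 1] c(1) by (auto intro: in_parent_tree)
  ultimately show ?thesis
    using c(2) unfolding fireproof_vertex_def by (auto simp: parent_edge_def intro!: bexI[of _ "parent_edge f c"])
qed

text \<open>Eliminates the dynamics: the state of the root depends only on order, marks and
  ancestral paths.\<close>

lemma root_burns_iff:
  assumes "f \<in> parent_funs n" "vs \<in> permutations_of_set {2..n}" "n \<ge> 1"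
  shows "\<not> fireproof_vertex (parent_tree n f) (fire_state n f b vs) 1 \<longleftrightarrow>
    (\<exists>x\<in>{2..n}. ignites f b vs 1 x)"
proof
  assume "\<not> fireproof_vertex (parent_tree n f) (fire_state n f b vs) 1"
  then obtain t x where "t \<in> anc f 1" "x \<in> {2..n}" "ignites f b vs t x"
    using burnt_vertex_cause[OF assms(1,2), of 1 b] assms(3) by auto
  then show "\<exists>x\<in>{2..n}. ignites f b vs 1 x" by (auto simp: anc_root)
qed (use ignited_root_burns[OF assms(1,2)] in blast)

section \<open>Sizes of the fireproof subtrees\<close>

definition subtree :: "nat \<Rightarrow> (nat \<Rightarrow> nat) \<Rightarrow> nat \<Rightarrow> nat set" where
  "subtree n f t = {v \<in> {1..n}. t \<in> anc f v}"

lemma finite_subtree [simp]: "finite (subtree n f t)"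
  by (simp add: subtree_def)

lemma subtree_mono: "t \<in> anc f u \<Longrightarrow> subtree n f u \<subseteq> subtree n f t"
  by (auto simp: subtree_def intro: anc_trans)

lemma joined_invariant:
  assumes "joined E u v" "P u" "\<And>x y. P x \<Longrightarrow> {x, y} \<in> E \<Longrightarrow> P y"
  shows "P v"
proof -
  obtain xs where "graph_path E xs" "hd xs = u" "last xs = v"
    using assms(1) by (auto simp: joined_def)
  then show ?thesis
  proof (induction xs arbitrary: v rule: rev_induct)
    case (snoc w xs)
    show ?case
    proof (cases "xs = []")
      case False
      then have "graph_path E xs" "{last xs, w} \<in> E" using snoc.prems by (auto simp: graph_path_snoc)
      then show ?thesis using snoc False assms(3) by auto
    qed (use snoc.prems assms(2) in auto)
  qed (simp add: graph_path_def)
qed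

lemma final_forest_fireproof_step:
  assumes "fireproof_vertex E s x" "{x, y} \<in> final_forest E s"
  shows "fireproof_vertex E s y"
  using assms by (auto simp: final_forest_def fireproof_vertex_def)

lemma finite_components [simp]: "finite V \<Longrightarrow> finite (components V E)"
  by (simp add: components_def)

lemma largest_fireproof_ge:
  "C \<in> fireproof_subtrees n E s \<Longrightarrow> card C \<le> largest_fireproof n E s"
  unfolding largest_fireproof_def fireproof_subtrees_def by (intro Max_ge) auto

lemma largest_fireproof_cases:
  "largest_fireproof n E s = 0 \<or> (\<exists>C\<in>fireproof_subtrees n E s. largest_fireproof n E s = card C)"
proof -
  have "largest_fireproof n E s \<in> insert 0 (card ` fireproof_subtrees n E s)"
    unfolding largest_fireproof_def fireproof_subtrees_def by (intro Max_in) auto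
  then show ?thesis by auto
qed

lemma largest_fireproof_le: "largest_fireproof n E s \<le> n"
proof -
  have "card C \<le> n" if "C \<in> fireproof_subtrees n E s" for C
  proof -
    have "C \<subseteq> {1..n}" using that by (auto simp: fireproof_subtrees_def components_def)
    then show ?thesis using card_mono[of "{1..n}" C] by simp
  qed
  then show ?thesis using largest_fireproof_cases[of n E s] by auto
qed

lemma parent_edge_in_final_forest:
  assumes "x \<in> {2..n}" "fireproof_vertex (parent_tree n f) s x" "fireproof_vertex (parent_tree n f) s (f x)"
  shows "{f x, x} \<in> final_forest (parent_tree n f) s"
  using assms by (auto simp: final_forest_def edge_in_parent_tree_iff)

text \<open>The vertices outside the listed subtrees form a set closed under taking parents, and by
  \<open>burnt_vertex_cause\<close> all of them are fireproof; so each is joined to the root inside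
  the final forest. Overlapping subtrees are counted repeatedly, which is harmless for an upper
  bound.\<close>

lemma largest_fireproof_root_fireproof:
  assumes f: "f \<in> parent_funs n" and vs: "vs \<in> permutations_of_set {2..n}" and n: "n \<ge> 1"
    and root: "fireproof_vertex (parent_tree n f) (fire_state n f b vs) 1"
  shows "n \<le> largest_fireproof n (parent_tree n f) (fire_state n f b vs) +
    (\<Sum>t | t \<in> {2..n} \<and> (\<exists>x\<in>{2..n}. ignites f b vs t x). card (subtree n f t))"
proof -
  let ?E = "parent_tree n f" and ?s = "fire_state n f b vs"
  define F where "F = final_forest ?E ?s"
  define T where "T = {t. t \<in> {2..n} \<and> (\<exists>x\<in>{2..n}. ignites f b vs t x)}"
  define C where "C = {v \<in> {1..n}. joined F 1 v}"
  have "fireproof_vertex ?E ?s v" if "joined F 1 v" for v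
    using joined_invariant[OF that] root final_forest_fireproof_step[of ?E ?s] unfolding F_def by blast
  then have C: "C \<in> fireproof_subtrees n ?E ?s"
    using n by (auto simp: fireproof_subtrees_def components_def C_def F_def)
  have fp: "fireproof_vertex ?E ?s v" if v: "v \<in> {1..n}" "v \<notin> (\<Union>t\<in>T. subtree n f t)" for v
  proof (rule ccontr)
    assume "\<not> fireproof_vertex ?E ?s v"
    then obtain t x where tx: "t \<in> anc f v" "x \<in> {2..n}" "ignites f b vs t x"
      using burnt_vertex_cause[OF f vs v(1)] by blast
    have "t \<noteq> 1" using root_burns_iff[OF f vs n] root tx by blast
    moreover have "t \<in> {1..n}" using anc_range(1)[OF f v(1)] tx(1) by blast
    ultimately have "t \<in> T" using tx by (auto simp: T_def)
    then show False using v tx(1) by (auto simp: subtree_def)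
  qed
  have "joined F 1 v" if "v \<in> {1..n}" "v \<notin> (\<Union>t\<in>T. subtree n f t)" for v
    using that
  proof (induction v rule: less_induct)
    case (less v)
    show ?case
    proof (cases "v = 1")
      case False
      then have v: "v \<in> {2..n}" using less.prems by auto
      note pv = parent_funsD[OF f v]
      have fv: "f v \<notin> (\<Union>t\<in>T. subtree n f t)"
        using less.prems by (auto simp: subtree_def anc_step[OF f v])
      then have "joined F 1 (f v)" using less.IH pv by blast
      moreover have "{f v, v} \<in> F"
        unfolding F_def using parent_edge_in_final_forest[OF v] fp less.prems fv pv by blast
      ultimately show ?thesis by (rule joined_step)
    qed (simp add: joined_refl)
  qed
  then have "{1..n} \<subseteq> C \<union> (\<Union>t\<in>T. subtree n f t)" by (auto simp: C_def)
  moreover have finT: "finite T" by (simp add: T_def)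
  ultimately have "n \<le> card (C \<union> (\<Union>t\<in>T. subtree n f t))"
    using card_mono[of "C \<union> (\<Union>t\<in>T. subtree n f t)" "{1..n}"] by (simp add: C_def)
  also have "\<dots> \<le> card C + card (\<Union>t\<in>T. subtree n f t)" by (rule card_Un_le)
  also have "card (\<Union>t\<in>T. subtree n f t) \<le> (\<Sum>t\<in>T. card (subtree n f t))"
    using finT by (rule card_UN_le)
  finally show ?thesis using largest_fireproof_ge[OF C] by (simp add: T_def)
qed

text \<open>Take for \<open>u\<close> the top vertex of \<open>C\<close>, which has the least label.
  Its parent is burnt, otherwise it would belong to \<open>C\<close>, while the edge between them is
  fireproof because \<open>u\<close> is. Hence the last clause of \<open>burnt_vertex_cause\<close>,
  applied to the parent, puts this edge before \<open>x\<close>.\<close>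

lemma fireproof_subtree_root_burnt:
  assumes f: "f \<in> parent_funs n" and vs: "vs \<in> permutations_of_set {2..n}"
    and root: "\<not> fireproof_vertex (parent_tree n f) (fire_state n f b vs) 1"
    and C: "C \<in> fireproof_subtrees n (parent_tree n f) (fire_state n f b vs)"
  shows "\<exists>u\<in>{2..n}. \<exists>t x. C \<subseteq> subtree n f u \<and> t \<in> anc f u \<and> x \<in> {2..n} \<and>
    ignites f b vs t x \<and> pos vs u < pos vs x"
proof -
  let ?E = "parent_tree n f" and ?s = "fire_state n f b vs"
  define F where "F = final_forest ?E ?s"
  obtain r where r: "r \<in> {1..n}" "C = {v \<in> {1..n}. joined F r v}"
    using C by (auto simp: fireproof_subtrees_def components_def F_def)
  have fpC: "\<And>v. v \<in> C \<Longrightarrow> fireproof_vertex ?E ?s v"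
    using C by (auto simp: fireproof_subtrees_def)
  have "finite C" "C \<noteq> {}" using r joined_refl by auto
  define u where "u = Min C"
  have u: "u \<in> C" using \<open>finite C\<close> \<open>C \<noteq> {}\<close> by (simp add: u_def)
  have u_le: "u \<le> v" if "v \<in> C" for v using that \<open>finite C\<close> by (simp add: u_def)
  have Fsub: "F \<subseteq> ?E" by (auto simp: F_def final_forest_def)
  have u2: "u \<in> {2..n}"
  proof -
    have "u \<noteq> 1" using fpC[OF u] root by auto
    then show ?thesis using u r by auto
  qed
  note pu = parent_funsD[OF f u2]
  have step: "y \<in> C" if "x \<in> C" "{x, y} \<in> F" for x y
  proof -
    have "{x, y} \<in> ?E" using that Fsub by blast
    then have "y \<in> {2..n} \<or> x \<in> {2..n} \<and> y = f x" unfolding edge_in_parent_tree_iff by blast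
    then have "y \<in> {1..n}" using parent_funsD(3)[OF f, of x] by auto
    then show ?thesis using that r(2) joined_step by blast
  qed
  have "v \<in> subtree n f u" if "v \<in> C" for v
  proof -
    have ru: "joined F r u" and rv: "joined F r v" using u that r by auto
    have uv: "joined F u v"
      by (rule joined_invariant[OF rv, of "joined F u"]) (use joined_sym[OF ru] joined_step in blast)+
    have "v \<in> C \<and> u \<in> anc f v"
    proof (rule joined_invariant)
      show "joined F u v" by (rule uv)
      show "u \<in> C \<and> u \<in> anc f u" using u by simp
      fix x y assume x: "x \<in> C \<and> u \<in> anc f x" and xy: "{x, y} \<in> F"
      then have y: "y \<in> C" using step by blast
      moreover have "u \<in> anc f y"
      proof -
        have "(y \<in> {2..n} \<and> x = f y) \<or> (x \<in> {2..n} \<and> y = f x)"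
          using xy Fsub unfolding edge_in_parent_tree_iff[symmetric] by blast
        then show ?thesis
        proof
          assume "y \<in> {2..n} \<and> x = f y"
          then show ?thesis using x by (simp add: anc_step[OF f])
        next
          assume a: "x \<in> {2..n} \<and> y = f x"
          then have "u < x" using u_le[OF y] parent_funsD(2)[OF f, of x] by auto
          then show ?thesis using a x anc_parent[OF f, of x u] by auto
        qed
      qed
      ultimately show "y \<in> C \<and> u \<in> anc f y" by blast
    qed
    then show ?thesis using r(2) by (auto simp: subtree_def)
  qed
  then have sub: "C \<subseteq> subtree n f u" by blast
  have "\<not> fireproof_vertex ?E ?s (f u)"
  proof
    assume "fireproof_vertex ?E ?s (f u)"
    then have "{u, f u} \<in> F"
      using parent_edge_in_final_forest[OF u2 fpC[OF u]] by (simp add: F_def insert_commute)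
    then have "f u \<in> C" using step u by blast
    then show False using u_le pu by fastforce
  qed
  then obtain t x where tx: "t \<in> anc f (f u)" "x \<in> {2..n}" "ignites f b vs t x"
    "\<forall>v\<in>{2..n}. f v = f u \<longrightarrow> ?s (parent_edge f v) = Fireproof \<longrightarrow> pos vs v < pos vs x"
    using burnt_vertex_cause[OF f vs pu(3)] by blast
  have "?s (parent_edge f u) = Fireproof"
    using fpC[OF u] in_parent_tree[OF u2, of f] by (auto simp: fireproof_vertex_def parent_edge_def)
  then have "pos vs u < pos vs x" using tx(4) u2 by blast
  moreover have "t \<in> anc f u" using tx(1) by (simp add: anc_step[OF f u2])
  ultimately show ?thesis using sub u2 tx by blast
qed

text \<open>\<open>M\<close> separates early from late. For \<open>t = 1\<close>, a late
  \<open>x\<close> gives the second case and an early \<open>x\<close> forces \<open>u\<close> to be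
  earlier still; for other \<open>t\<close>, the subtree of \<open>t\<close> contains that of
  \<open>u\<close>.\<close>

lemma largest_fireproof_root_burnt:
  assumes f: "f \<in> parent_funs n" and vs: "vs \<in> permutations_of_set {2..n}"
    and root: "\<not> fireproof_vertex (parent_tree n f) (fire_state n f b vs) 1"
    and y: "y \<ge> 0" "real (largest_fireproof n (parent_tree n f) (fire_state n f b vs)) > y"
  shows "(\<exists>u\<in>{2..n}. real (card (subtree n f u)) > y \<and> pos vs u < M) \<or>
    (\<exists>x\<in>{2..n}. ignites f b vs 1 x \<and> M \<le> pos vs x) \<or>
    (\<exists>t\<in>{2..n}. (\<exists>x\<in>{2..n}. ignites f b vs t x) \<and> real (card (subtree n f t)) > y)"
proof -
  let ?E = "parent_tree n f" and ?s = "fire_state n f b vs"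
  obtain C where C: "C \<in> fireproof_subtrees n ?E ?s" "real (card C) > y"
    using largest_fireproof_cases[of n ?E ?s] y by auto
  obtain u t x where u: "u \<in> {2..n}" "C \<subseteq> subtree n f u" "t \<in> anc f u" "x \<in> {2..n}"
    "ignites f b vs t x" "pos vs u < pos vs x"
    using fireproof_subtree_root_burnt[OF f vs root C(1)] by blast
  have cu: "real (card (subtree n f u)) > y"
    using C(2) card_mono[OF finite_subtree u(2)] by linarith
  show ?thesis
  proof (cases "t = 1")
    case True
    then show ?thesis
      using u cu by (metis less_le_trans not_le_imp_less order_less_trans)
  next
    case False
    have "t \<in> {1..n}" using anc_range(1)[OF f, of u] u by auto
    then have "t \<in> {2..n}" using False by auto
    moreover have "real (card (subtree n f t)) > y"
      using cu card_mono[OF finite_subtree subtree_mono[OF u(3)]] by (meson less_le_trans of_nat_le_iff)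
    ultimately show ?thesis using u by blast
  qed
qed

section \<open>Uniform random permutations\<close>

lemma prob_eq_expectation:
  "measure_pmf.prob M {\<omega>. P \<omega>} = measure_pmf.expectation M (\<lambda>\<omega>. of_bool (P \<omega>))"
proof -
  have "measure_pmf.prob M {\<omega>. P \<omega>} = measure_pmf.expectation M (indicator {\<omega>. P \<omega>})" by simp
  also have "indicator {\<omega>. P \<omega>} = (\<lambda>\<omega>. of_bool (P \<omega>) :: real)" by (auto simp: indicator_def)
  finally show ?thesis .
qed

lemma expectation_mono:
  fixes g h :: "'a \<Rightarrow> real"
  assumes "finite (set_pmf M)" "\<And>\<omega>. \<omega> \<in> set_pmf M \<Longrightarrow> g \<omega> \<le> h \<omega>"
  shows "measure_pmf.expectation M g \<le> measure_pmf.expectation M h"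
  using assms by (intro integral_mono_AE integrable_measure_pmf_finite) (auto simp: AE_measure_pmf_iff)

lemma expectation_sum:
  fixes g :: "'b \<Rightarrow> 'a \<Rightarrow> real"
  assumes "finite (set_pmf M)"
  shows "measure_pmf.expectation M (\<lambda>\<omega>. \<Sum>i\<in>I. g i \<omega>) = (\<Sum>i\<in>I. measure_pmf.expectation M (g i))"
  by (intro Bochner_Integration.integral_sum integrable_measure_pmf_finite assms)

text \<open>Double counting: the sum is the expected number of \<open>y\<close> in \<open>B\<close>
  with \<open>Q y\<close>, so a bound on this number for each outcome suffices.\<close>

lemma sum_prob_le:
  assumes fin: "finite (set_pmf M)" and B: "finite B"
    and card: "\<And>\<omega>. \<omega> \<in> set_pmf M \<Longrightarrow> real (card {y\<in>B. Q y \<omega>}) \<le> c * of_bool (R \<omega>)"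
  shows "(\<Sum>y\<in>B. measure_pmf.prob M {\<omega>. Q y \<omega>}) \<le> c * measure_pmf.prob M {\<omega>. R \<omega>}"
proof -
  have "(\<Sum>y\<in>B. measure_pmf.prob M {\<omega>. Q y \<omega>})
      = measure_pmf.expectation M (\<lambda>\<omega>. \<Sum>y\<in>B. of_bool (Q y \<omega>))"
    unfolding prob_eq_expectation by (rule expectation_sum[OF fin, symmetric])
  also have "\<dots> = measure_pmf.expectation M (\<lambda>\<omega>. real (card {y\<in>B. Q y \<omega>}))"
    using B by (simp add: sum_of_bool_eq Int_def)
  also have "\<dots> \<le> measure_pmf.expectation M (\<lambda>\<omega>. c * of_bool (R \<omega>))"
    by (intro expectation_mono fin card)
  also have "\<dots> = c * measure_pmf.prob M {\<omega>. R \<omega>}" unfolding prob_eq_expectation by simp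
  finally show ?thesis .
qed

abbreviation random_perm :: "'a set \<Rightarrow> 'a list pmf" where
  "random_perm A \<equiv> pmf_of_set (permutations_of_set A)"

context
  fixes A :: "'a set"
  assumes A: "finite A"
begin

lemma set_random_perm: "set_pmf (random_perm A) = permutations_of_set A"
  using A by (simp add: set_pmf_of_set)

lemma finite_set_random_perm: "finite (set_pmf (random_perm A))"
  using A by (simp add: set_random_perm)

lemma random_perm_transpose:
  assumes "x \<in> A" "y \<in> A"
  shows "measure_pmf.prob (random_perm A) {vs. Q vs} =
    measure_pmf.prob (random_perm A) {vs. Q (map (Transposition.transpose x y) vs)}"
proof -
  let ?t = "Transposition.transpose x y"
  have inj: "inj ?t" by (rule inj_transpose)
  have im: "?t ` A = A" using assms by (simp add: transpose_image_eq)
  have "map_pmf (map ?t) (random_perm A) = pmf_of_set (map ?t ` permutations_of_set A)"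
    using A inj by (intro map_pmf_of_set_inj) (auto intro: inj_on_subset[OF inj_mapI])
  also have "map ?t ` permutations_of_set A = permutations_of_set (?t ` A)"
    using inj_on_subset[OF inj] by (subst permutations_of_set_image_inj) auto
  finally have "random_perm A = map_pmf (map ?t) (random_perm A)" by (simp add: im)
  then have "measure_pmf.prob (random_perm A) {vs. Q vs} =
    measure_pmf.prob (map_pmf (map ?t) (random_perm A)) {vs. Q vs}" by simp
  then show ?thesis by (simp add: vimage_def)
qed

lemma pos_map_transpose:
  "pos (map (Transposition.transpose x y) vs) z = pos vs (Transposition.transpose x y z)"
proof -
  have "(\<lambda>w. w \<noteq> z) \<circ> Transposition.transpose x y = (\<lambda>w. w \<noteq> Transposition.transpose x y z)"
    by (auto simp: fun_eq_iff)
  then show ?thesis by (simp add: pos_def takeWhile_map)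
qed

text \<open>Exchangeability makes all summands equal. Together with \<open>sum_prob_le\<close>,
  counting the admissible \<open>y\<close> in a fixed permutation then bounds a single probability;
  the estimates on positions below are all obtained this way, directly or through
  \<open>prob_first_in_and\<close>.\<close>

lemma random_perm_symmetric:
  assumes B: "B \<subseteq> A" "x \<in> B"
    and sym: "\<And>y vs. y \<in> B \<Longrightarrow> Q y vs = Q x (map (Transposition.transpose x y) vs)"
  shows "(\<Sum>y\<in>B. measure_pmf.prob (random_perm A) {vs. Q y vs}) =
    real (card B) * measure_pmf.prob (random_perm A) {vs. Q x vs}"
proof -
  have "measure_pmf.prob (random_perm A) {vs. Q y vs} = measure_pmf.prob (random_perm A) {vs. Q x vs}"
    if "y \<in> B" for y
  proof -
    have "x \<in> A" "y \<in> A" using B that by auto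
    from random_perm_transpose[OF this, of "Q x"] show ?thesis by (simp add: sym[OF that])
  qed
  then show ?thesis by simp
qed

lemma pos_image:
  assumes "vs \<in> permutations_of_set A"
  shows "pos vs ` A = {..<card A}" "inj_on (pos vs) A"
proof -
  have vs: "set vs = A" "distinct vs" using assms by (auto dest: permutations_of_setD)
  show inj: "inj_on (pos vs) A" using vs by (auto intro!: inj_onI dest: pos_inj)
  have len: "length vs = card A" using vs distinct_card by fastforce
  have "pos vs ` A \<subseteq> {..<card A}"
    using length_takeWhile_neq_less vs(1) len by (fastforce simp: pos_def)
  then show "pos vs ` A = {..<card A}"
    using card_image[OF inj] by (intro card_subset_eq) auto
qed

lemma card_pos_less:
  assumes "vs \<in> permutations_of_set A" "M \<le> card A"
  shows "card {y \<in> A. pos vs y < M} = M"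
proof -
  have "pos vs ` {y \<in> A. pos vs y < M} = pos vs ` A \<inter> {..<M}" by auto
  also have "\<dots> = {..<M}" using assms by (auto simp: pos_image)
  finally have "card (pos vs ` {y \<in> A. pos vs y < M}) = M" by simp
  then show ?thesis
    using card_image[OF inj_on_subset[OF pos_image(2)[OF assms(1)]], of "{y \<in> A. pos vs y < M}"] by auto
qed

lemma first_in_map_transpose:
  assumes "x \<in> S" "y \<in> S"
  shows "first_in (map (Transposition.transpose x y) vs) z S =
    first_in vs (Transposition.transpose x y z) S"
proof -
  let ?t = "Transposition.transpose x y"
  have "(\<forall>w\<in>S. w \<noteq> z \<longrightarrow> pos vs (?t z) < pos vs (?t w)) \<longleftrightarrow>
        (\<forall>w\<in>?t ` S. w \<noteq> ?t z \<longrightarrow> pos vs (?t z) < pos vs w)"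
    by (auto simp: inj_eq[OF inj_transpose])
  also have "?t ` S = S" using assms by (simp add: transpose_image_eq)
  finally show ?thesis by (simp add: first_in_def pos_map_transpose)
qed

lemma first_in_unique: "first_in vs x S \<Longrightarrow> first_in vs y S \<Longrightarrow> x \<in> S \<Longrightarrow> y \<in> S \<Longrightarrow> x = y"
  unfolding first_in_def by (metis order_less_asym)

lemma card_first_in_le: "finite S \<Longrightarrow> card {y\<in>S. first_in vs y S} \<le> 1"
  by (subst One_nat_def, subst card_le_Suc0_iff_eq) (auto intro: first_in_unique)

lemma card_first_in_le_of_bool:
  assumes "finite S"
  shows "real (card {y\<in>S. first_in vs y S \<and> R}) \<le> 1 * of_bool R"
  using card_first_in_le[OF assms, of vs] by (cases R) auto

text \<open>\<open>R\<close> does not see exchanges of \<open>x\<close> with elements of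
  \<open>S\<close>, so together with \<open>R\<close> each of them is equally likely to be first,
  and only one can be.\<close>

lemma prob_first_in_and:
  assumes "S \<subseteq> A" "x \<in> S"
    and R: "\<And>y vs. y \<in> S \<Longrightarrow> R (map (Transposition.transpose x y) vs) = R vs"
  shows "measure_pmf.prob (random_perm A) {vs. first_in vs x S \<and> R vs} \<le>
    measure_pmf.prob (random_perm A) {vs. R vs} / real (card S)"
proof -
  have finS: "finite S" using assms(1) A finite_subset by blast
  then have pS: "real (card S) > 0" using assms(2) by (auto simp: card_gt_0_iff)
  have "real (card S) * measure_pmf.prob (random_perm A) {vs. first_in vs x S \<and> R vs}
     = (\<Sum>y\<in>S. measure_pmf.prob (random_perm A) {vs. first_in vs y S \<and> R vs})"
    using assms by (intro random_perm_symmetric[symmetric]) (auto simp: first_in_map_transpose)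
  also have "\<dots> \<le> 1 * measure_pmf.prob (random_perm A) {vs. R vs}"
    using finS by (intro sum_prob_le finite_set_random_perm card_first_in_le_of_bool)
  finally show ?thesis
    using pS by (simp add: pos_le_divide_eq mult.commute)
qed

lemma prob_first_in:
  assumes "S \<subseteq> A" "x \<in> S"
  shows "measure_pmf.prob (random_perm A) {vs. first_in vs x S} \<le> 1 / real (card S)"
  using prob_first_in_and[OF assms, of "\<lambda>_. True"] by simp

text \<open>Two factors: \<open>t\<close> must be first in \<open>insert t S\<close>, of probability
  at most \<open>1 / (card S + 1)\<close>, and since exchanges within \<open>S\<close> preserve this
  event, requiring \<open>x\<close> to be first in \<open>S\<close> divides by \<open>card S\<close>
  again.\<close>

lemma prob_first_second:
  assumes "S \<subseteq> A" "x \<in> S" "t \<in> A" "t \<notin> S"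
  shows "measure_pmf.prob (random_perm A) {vs. first_in vs x S \<and> pos vs t < pos vs x} \<le>
    1 / (real (card S))\<^sup>2"
proof -
  have finS: "finite S" using assms(1) A finite_subset by blast
  then have pS: "card S > 0" using assms(2) by (auto simp: card_gt_0_iff)
  let ?R = "\<lambda>vs. first_in vs t (insert t S)"
  have "measure_pmf.prob (random_perm A) {vs. first_in vs x S \<and> pos vs t < pos vs x}
      \<le> measure_pmf.prob (random_perm A) {vs. first_in vs x S \<and> ?R vs}"
  proof (intro measure_pmf.finite_measure_mono subsetI)
    fix vs assume "vs \<in> {vs. first_in vs x S \<and> pos vs t < pos vs x}"
    then have *: "first_in vs x S" "pos vs t < pos vs x" by auto
    have "pos vs t < pos vs y" if "y \<in> S" for y
      using * that by (cases "y = x") (auto simp: first_in_def)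
    then show "vs \<in> {vs. first_in vs x S \<and> ?R vs}" using * by (auto simp: first_in_def)
  qed simp
  also have "\<dots> \<le> measure_pmf.prob (random_perm A) {vs. ?R vs} / real (card S)"
    using assms(4) by (intro prob_first_in_and assms(1,2), subst first_in_map_transpose)
      (use assms(2) in \<open>auto simp: transpose_eq_iff intro!: arg_cong2[of _ _ _ _ "\<lambda>u v. first_in _ u v"]\<close>)
  also have "\<dots> \<le> (1 / real (card S)) / real (card S)"
  proof (intro divide_right_mono)
    have "measure_pmf.prob (random_perm A) {vs. ?R vs} \<le> 1 / real (card (insert t S))"
      using assms by (intro prob_first_in) auto
    also have "\<dots> \<le> 1 / real (card S)" using finS assms(4) pS by (simp add: frac_le)
    finally show "measure_pmf.prob (random_perm A) {vs. ?R vs} \<le> 1 / real (card S)" .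
  qed simp
  finally show ?thesis by (simp add: power2_eq_square)
qed

text \<open>\<open>sum_prob_le\<close> is one-sided; equality results from applying it both to the
  event and to its complement.\<close>

lemma prob_pos_less:
  assumes "x \<in> A" "M \<le> card A"
  shows "measure_pmf.prob (random_perm A) {vs. pos vs x < M} = real M / real (card A)"
proof -
  have N: "card A > 0" using assms(1) A by (auto simp: card_gt_0_iff)
  have sum: "(\<Sum>y\<in>A. measure_pmf.prob (random_perm A) {vs. pos vs y < M}) =
      real (card A) * measure_pmf.prob (random_perm A) {vs. pos vs x < M}"
    using assms(1) by (intro random_perm_symmetric) (auto simp: pos_map_transpose)
  have sum': "(\<Sum>y\<in>A. measure_pmf.prob (random_perm A) {vs. \<not> pos vs y < M}) =
      real (card A) * measure_pmf.prob (random_perm A) {vs. \<not> pos vs x < M}"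
    using assms(1) by (intro random_perm_symmetric) (auto simp: pos_map_transpose)
  have c: "card {y \<in> A. pos vs y < M} = M" if "vs \<in> set_pmf (random_perm A)" for vs
    using card_pos_less that assms(2) by (simp add: set_random_perm)
  have c': "card {y \<in> A. \<not> pos vs y < M} = card A - M" if "vs \<in> set_pmf (random_perm A)" for vs
  proof -
    have "{y \<in> A. \<not> pos vs y < M} = A - {y \<in> A. pos vs y < M}" by auto
    then show ?thesis using c[OF that] A by (simp add: card_Diff_subset)
  qed
  have "(\<Sum>y\<in>A. measure_pmf.prob (random_perm A) {vs. pos vs y < M}) \<le>
      real M * measure_pmf.prob (random_perm A) {vs. True}"
    using c by (intro sum_prob_le finite_set_random_perm A) simp
  then have up: "real (card A) * measure_pmf.prob (random_perm A) {vs. pos vs x < M} \<le> M"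
    using sum by simp
  have "(\<Sum>y\<in>A. measure_pmf.prob (random_perm A) {vs. \<not> pos vs y < M}) \<le>
      real (card A - M) * measure_pmf.prob (random_perm A) {vs. True}"
    using c' by (intro sum_prob_le finite_set_random_perm A) simp
  then have "real (card A) * measure_pmf.prob (random_perm A) {vs. \<not> pos vs x < M} \<le> card A - M"
    using sum' by simp
  moreover have "measure_pmf.prob (random_perm A) {vs. \<not> pos vs x < M} =
      1 - measure_pmf.prob (random_perm A) {vs. pos vs x < M}"
    using measure_pmf.prob_compl[of "{vs. pos vs x < M}" "random_perm A"]
    by (simp add: Compl_eq_Diff_UNIV[symmetric] Collect_neg_eq[symmetric])
  ultimately have "real (card A) * measure_pmf.prob (random_perm A) {vs. pos vs x < M} \<ge> M"
    using assms(2) by (simp add: algebra_simps of_nat_diff)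
  with up N show ?thesis by (simp add: field_simps)
qed

lemma transpose_fixes: "z \<noteq> x \<Longrightarrow> z \<noteq> y \<Longrightarrow> Transposition.transpose x y z = z"
  by (simp add: Transposition.transpose_def)

text \<open>Once \<open>x\<close> is among the first \<open>M\<close>, there are
  \<open>M - 1\<close> such places left for \<open>card A - 1\<close> elements, and
  \<open>(M - 1) / (card A - 1)\<close> is at most \<open>M / card A\<close>.\<close>

lemma prob_pos_less_two:
  assumes "x \<in> A" "y \<in> A" "x \<noteq> y" "M \<le> card A"
  shows "measure_pmf.prob (random_perm A) {vs. pos vs x < M \<and> pos vs y < M} \<le> (real M / real (card A))\<^sup>2"
proof (cases "M = 0")
  case False
  let ?P = "measure_pmf.prob (random_perm A)"
  have "card {x, y} \<le> card A" using assms A by (intro card_mono) auto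
  then have N: "card A \<ge> 2" using assms by simp
  have "real (card (A - {x})) * ?P {vs. pos vs x < M \<and> pos vs y < M} =
      (\<Sum>z\<in>A - {x}. ?P {vs. pos vs x < M \<and> pos vs z < M})"
    using assms
    by (intro random_perm_symmetric[symmetric]) (auto simp: pos_map_transpose transpose_fixes)
  also have "\<dots> \<le> real (M - 1) * ?P {vs. pos vs x < M}"
  proof (intro sum_prob_le finite_set_random_perm)
    fix vs assume vs: "vs \<in> set_pmf (random_perm A)"
    have "card ({z \<in> A. pos vs z < M} - {x}) = M - 1" if "pos vs x < M"
      using that assms vs by (subst card_Diff_singleton) (auto simp: card_pos_less set_random_perm)
    moreover have "{z \<in> A - {x}. pos vs x < M \<and> pos vs z < M} \<subseteq> {z \<in> A. pos vs z < M} - {x}" by auto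
    ultimately have "card {z \<in> A - {x}. pos vs x < M \<and> pos vs z < M} \<le> M - 1" if "pos vs x < M"
      using that A by (metis (no_types, lifting) card_mono finite_Diff finite_subset mem_Collect_eq subsetI)
    then show "real (card {z \<in> A - {x}. pos vs x < M \<and> pos vs z < M}) \<le> real (M - 1) * of_bool (pos vs x < M)"
      by (cases "pos vs x < M") auto
  qed (use A in simp)
  finally have *: "(real (card A) - 1) * ?P {vs. pos vs x < M \<and> pos vs y < M} \<le>
      (real M - 1) * (real M / real (card A))"
    using assms N False A by (simp add: prob_pos_less of_nat_diff)
  have "?P {vs. pos vs x < M \<and> pos vs y < M} \<le> (real M - 1) / (real (card A) - 1) * (real M / real (card A))"
    using * N by (simp add: field_simps)
  also have "\<dots> \<le> (real M / real (card A)) * (real M / real (card A))"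
    using assms(4) N by (intro mult_right_mono) (auto simp: field_simps)
  finally show ?thesis by (simp add: power2_eq_square)
qed simp

text \<open>Drawing without replacement, with \<open>N = card A\<close>: given that all of
  \<open>S\<close> is late, a further element is late with conditional probability at most
  \<open>(N - M - card S) / (N - card S)\<close>, which is at most \<open>1 - M / N\<close>.\<close>

lemma prob_all_pos_ge:
  assumes "S \<subseteq> A" "M \<le> card A"
  shows "measure_pmf.prob (random_perm A) {vs. \<forall>y\<in>S. M \<le> pos vs y} \<le> (1 - real M / real (card A)) ^ card S"
proof -
  let ?P = "measure_pmf.prob (random_perm A)"
  have "finite S" using assms(1) A finite_subset by blast
  then show ?thesis using assms(1)
  proof (induction S)
    case (insert x S)
    have S: "S \<subseteq> A" "x \<in> A - S" "card S < card A"
    proof -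
      show "S \<subseteq> A" "x \<in> A - S" using insert by auto
      then have "S \<subset> A" by auto
      then show "card S < card A" using A psubset_card_mono by blast
    qed
    let ?R = "\<lambda>vs. \<forall>y\<in>S. M \<le> pos vs y"
    have inv: "(\<forall>y\<in>S. M \<le> pos vs (Transposition.transpose x z y)) = ?R vs" if "z \<notin> S" for z vs
      using that insert.hyps by (metis transpose_fixes)
    have "real (card (A - S)) * ?P {vs. M \<le> pos vs x \<and> ?R vs} = (\<Sum>z\<in>A - S. ?P {vs. M \<le> pos vs z \<and> ?R vs})"
      using S by (intro random_perm_symmetric[symmetric]) (auto simp: pos_map_transpose inv)
    also have "\<dots> \<le> real (card A - M - card S) * ?P {vs. ?R vs}"
    proof (intro sum_prob_le finite_set_random_perm)
      fix vs assume vs: "vs \<in> set_pmf (random_perm A)"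
      have "card {z \<in> A - S. M \<le> pos vs z} = card A - M - card S" if "?R vs"
      proof -
        have "{z \<in> A - S. M \<le> pos vs z} = A - {z \<in> A. pos vs z < M} - S" by auto
        moreover have "S \<subseteq> A - {z \<in> A. pos vs z < M}" using that S by auto
        ultimately show ?thesis
          using A insert.hyps(1) vs assms(2) by (simp add: card_Diff_subset card_pos_less set_random_perm)
      qed
      then show "real (card {z \<in> A - S. M \<le> pos vs z \<and> ?R vs}) \<le> real (card A - M - card S) * of_bool (?R vs)"
      proof (cases "?R vs")
        case False
        then have empty: "{z \<in> A - S. M \<le> pos vs z \<and> ?R vs} = {}" by blast
        show ?thesis unfolding empty by simp
      qed simp
    qed (use A in simp)
    finally have *: "(real (card A) - real (card S)) * ?P {vs. M \<le> pos vs x \<and> ?R vs} \<le>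
        real (card A - M - card S) * ?P {vs. ?R vs}"
      using S insert.hyps(1) A by (simp add: card_Diff_subset of_nat_diff)
    have pos: "real (card A) - real (card S) > 0" using S by simp
    have "?P {vs. M \<le> pos vs x \<and> ?R vs} \<le> real (card A - M - card S) / (real (card A) - real (card S)) * ?P {vs. ?R vs}"
      using * pos by (simp add: field_simps)
    also have "\<dots> \<le> (1 - real M / real (card A)) * ?P {vs. ?R vs}"
    proof (intro mult_right_mono)
      show "real (card A - M - card S) / (real (card A) - real (card S)) \<le> 1 - real M / real (card A)"
      \<comment> \<open>For \<open>card S\<close> above \<open>card A - M\<close> the truncated
        subtraction yields \<open>0\<close>, in accordance with the lack of late places.\<close>
      proof (cases "card S \<le> card A - M")
        case True
        have "real (card A - M - card S) = real (card A) - real M - real (card S)"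
          using True assms(2) by (simp add: of_nat_diff)
        moreover have "(real (card A) - real M - real (card S)) * real (card A) \<le>
            (real (card A) - real M) * (real (card A) - real (card S))"
          by (simp add: algebra_simps)
        ultimately show ?thesis using pos by (simp add: field_simps)
      next
        case False
        then show ?thesis using assms(2) by (simp add: divide_le_eq)
      qed
    qed simp
    also have "\<dots> \<le> (1 - real M / real (card A)) * (1 - real M / real (card A)) ^ card S"
      using insert.IH S(1) assms(2) by (intro mult_left_mono) (auto simp: divide_le_eq)
    finally show ?case using insert.hyps by simp
  qed simp
qed

text \<open>If the first element of \<open>S\<close> is late, all of \<open>S\<close> is late; that
  event is symmetric in \<open>S\<close>, so the two factors multiply.\<close>

lemma prob_first_in_late:
  assumes "S \<subseteq> A" "x \<in> S" "M \<le> card A"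
  shows "measure_pmf.prob (random_perm A) {vs. first_in vs x S \<and> M \<le> pos vs x} \<le>
    (1 - real M / real (card A)) ^ card S / real (card S)"
proof -
  let ?R = "\<lambda>vs. \<forall>y\<in>S. M \<le> pos vs y"
  have "measure_pmf.prob (random_perm A) {vs. first_in vs x S \<and> M \<le> pos vs x}
      \<le> measure_pmf.prob (random_perm A) {vs. first_in vs x S \<and> ?R vs}"
    by (intro measure_pmf.finite_measure_mono) (force simp: first_in_def)+
  also have "\<dots> \<le> measure_pmf.prob (random_perm A) {vs. ?R vs} / real (card S)"
  proof (intro prob_first_in_and assms(1,2))
    fix y vs assume "y \<in> S"
    then have "Transposition.transpose x y ` S = S" using assms(2) by (simp add: transpose_image_eq)
    then show "?R (map (Transposition.transpose x y) vs) = ?R vs"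
      unfolding pos_map_transpose by (metis (no_types, lifting) image_iff imageI)
  qed
  also have "\<dots> \<le> (1 - real M / real (card A)) ^ card S / real (card S)"
    using prob_all_pos_ge[OF assms(1,3)] by (intro divide_right_mono) auto
  finally show ?thesis .
qed

end

section \<open>Moments of subtree sizes\<close>

text \<open>Bernoulli's inequality for a real exponent. Concavity of \<open>ln\<close> is applied at
  \<open>1 + x\<close>, the mean of \<open>1\<close> and \<open>1 + (1 + s) * x\<close> in which the
  latter has weight \<open>1 / (1 + s)\<close>.\<close>

lemma powr_ge_one_plus:
  fixes x s :: real
  assumes "0 \<le> x" "0 \<le> s"
  shows "1 + (1 + s) * x \<le> (1 + x) powr (1 + s)"
proof -
  define l where "l = 1 / (1 + s)"
  have l: "0 \<le> l" "l \<le> 1" "l * (1 + s) = 1" using assms by (auto simp: l_def)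
  have pos: "1 + (1 + s) * x > 0" using assms by (simp add: add_pos_nonneg)
  have "(1 - l) * ln 1 + l * ln (1 + (1 + s) * x) \<le> ln ((1 - l) * 1 + l * (1 + (1 + s) * x))"
    using concave_onD[OF ln_concave l(1,2), of 1 "1 + (1 + s) * x"] pos by simp
  also have "(1 - l) * 1 + l * (1 + (1 + s) * x) = 1 + (l * (1 + s)) * x" by (simp add: algebra_simps)
  finally have "l * ln (1 + (1 + s) * x) \<le> ln (1 + x)" using l(3) by simp
  then have "(1 + s) * (l * ln (1 + (1 + s) * x)) \<le> (1 + s) * ln (1 + x)"
    using assms by (intro mult_left_mono) auto
  also have "(1 + s) * (l * ln (1 + (1 + s) * x)) = (l * (1 + s)) * ln (1 + (1 + s) * x)" by simp
  finally have "ln (1 + (1 + s) * x) \<le> (1 + s) * ln (1 + x)" using l(3) by simp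
  then have "exp (ln (1 + (1 + s) * x)) \<le> exp ((1 + s) * ln (1 + x))" by simp
  then show ?thesis using pos assms(1) by (simp add: powr_def)
qed

abbreviation random_parents :: "nat \<Rightarrow> (nat \<Rightarrow> nat) pmf" where
  "random_parents n \<equiv> pmf_of_set (parent_funs n)"

lemma finite_parent_funs [simp]: "finite (parent_funs n)"
  unfolding parent_funs_def by (intro finite_PiE) auto

lemma parent_funs_nonempty [simp]: "parent_funs n \<noteq> {}"
  unfolding parent_funs_def by (auto simp: PiE_eq_empty_iff)

lemma set_random_parents [simp]: "set_pmf (random_parents n) = parent_funs n"
  by (simp add: set_pmf_of_set)

lemma integrable_random_parents [simp]:
  "integrable (measure_pmf (random_parents n)) (G :: _ \<Rightarrow> real)"
  by (intro integrable_measure_pmf_finite) simp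

text \<open>The growth description of the recursive tree: the new vertex picks a uniform parent,
  independently of the tree so far. It drives the induction on \<open>n\<close> in
  \<open>expectation_path_sum\<close>.\<close>

lemma random_parents_Suc:
  assumes "n \<ge> 1"
  shows "measure_pmf.expectation (random_parents (Suc n)) G =
    measure_pmf.expectation (random_parents n) (\<lambda>f. (\<Sum>k=1..n. G (f(Suc n := k))) / real n :: real)"
proof -
  have ins: "{2..Suc n} = insert (Suc n) {2..n}" "Suc n \<notin> {2..n}" "{1..<Suc n} = {1..n}" using assms by auto
  let ?h = "\<lambda>(y, g). g(Suc n := y)"
  have PF: "parent_funs (Suc n) = ?h ` ({1..n} \<times> parent_funs n)"
    unfolding parent_funs_def ins(1) PiE_insert_eq using ins(3) by simp
  have inj: "inj_on ?h ({1..n} \<times> parent_funs n)"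
    unfolding parent_funs_def
    using inj_combinator[OF ins(2), of "\<lambda>k. {1..<k}"] ins(3) by simp
  have "sum G (parent_funs (Suc n)) = (\<Sum>(k, f)\<in>{1..n} \<times> parent_funs n. G (f(Suc n := k)))"
    unfolding PF by (subst sum.reindex[OF inj]) (simp add: o_def case_prod_beta)
  also have "\<dots> = (\<Sum>f\<in>parent_funs n. \<Sum>k=1..n. G (f(Suc n := k)))"
    by (subst sum.swap) (simp add: sum.cartesian_product)
  finally have sum: "sum G (parent_funs (Suc n)) = (\<Sum>f\<in>parent_funs n. \<Sum>k=1..n. G (f(Suc n := k)))" .
  have card: "card (parent_funs (Suc n)) = n * card (parent_funs n)"
    unfolding PF by (subst card_image[OF inj]) (simp add: card_cartesian_product)
  show ?thesis
    unfolding integral_pmf_of_set[OF parent_funs_nonempty finite_parent_funs] sum card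
    by (simp add: sum_divide_distrib[symmetric] mult.commute)
qed

text \<open>This is the depth generating function of the subtree of \<open>u\<close>; small
  \<open>s\<close> singles out the vertices close to \<open>u\<close>.\<close>

definition path_sum :: "real \<Rightarrow> nat \<Rightarrow> (nat \<Rightarrow> nat) \<Rightarrow> nat \<Rightarrow> real" where
  "path_sum s n f u = (\<Sum>w\<in>subtree n f u. s ^ card (seg f u w))"

lemma path_sum_nonneg: "0 \<le> s \<Longrightarrow> 0 \<le> path_sum s n f u"
  unfolding path_sum_def by (intro sum_nonneg) simp

lemma path_sum_one: "path_sum 1 n f u = real (card (subtree n f u))"
  by (simp add: path_sum_def)

context
  fixes n k :: nat and f :: "nat \<Rightarrow> nat"
  assumes f: "f \<in> parent_funs n" and k: "k \<in> {1..n}"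
begin

lemma parent_funs_upd: "f(Suc n := k) \<in> parent_funs (Suc n)"
  using f k unfolding parent_funs_def by (auto simp: PiE_iff extensional_def)

lemma anc_upd: "x \<in> {1..n} \<Longrightarrow> anc (f(Suc n := k)) x = anc f x"
proof (induction x rule: less_induct)
  case (less x)
  show ?case
  proof (cases "x = 1")
    case False
    then have x: "x \<in> {2..n}" "x \<in> {2..Suc n}" "x \<noteq> Suc n" using less.prems by auto
    have "anc (f(Suc n := k)) x = insert x (anc (f(Suc n := k)) ((f(Suc n := k)) x))"
      by (rule anc_step[OF parent_funs_upd x(2)])
    also have "(f(Suc n := k)) x = f x" using x(3) by simp
    also have "anc (f(Suc n := k)) (f x) = anc f (f x)"
      by (rule less.IH[OF parent_funsD(2,3)[OF f x(1)]])
    also have "insert x (anc f (f x)) = anc f x" by (rule anc_step[OF f x(1), symmetric])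
    finally show ?thesis .
  qed (simp add: anc_root)
qed

lemma anc_upd_new: "anc (f(Suc n := k)) (Suc n) = insert (Suc n) (anc f k)"
  using k anc_step[OF parent_funs_upd, of "Suc n"] anc_upd[OF k] by simp

lemma subtree_upd:
  assumes "u \<in> {1..n}"
  shows "subtree (Suc n) (f(Suc n := k)) u =
    (if k \<in> subtree n f u then insert (Suc n) (subtree n f u) else subtree n f u)"
proof -
  have "v \<in> subtree (Suc n) (f(Suc n := k)) u \<longleftrightarrow> v \<in> subtree n f u \<or> v = Suc n \<and> u \<in> anc f k" for v
    using assms anc_upd[of v] anc_upd_new by (cases "v = Suc n") (auto simp: subtree_def)
  then show ?thesis using k by (auto simp: subtree_def)
qed

lemma card_subtree_upd:
  assumes "u \<in> {1..n}"
  shows "card (subtree (Suc n) (f(Suc n := k)) u) = card (subtree n f u) + of_bool (k \<in> subtree n f u)"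
  using subtree_upd[OF assms] by (simp add: subtree_def card_insert_if)

lemma path_sum_upd:
  assumes "u \<in> {1..n}"
  shows "path_sum s (Suc n) (f(Suc n := k)) u =
    path_sum s n f u + of_bool (k \<in> subtree n f u) * (s * s ^ card (seg f u k))"
proof -
  have old: "(\<Sum>w\<in>subtree n f u. s ^ card (seg (f(Suc n := k)) u w)) = path_sum s n f u"
    unfolding path_sum_def by (intro sum.cong) (auto simp: subtree_def seg_def anc_upd)
  have "seg (f(Suc n := k)) u (Suc n) = insert (Suc n) (seg f u k)"
    using assms by (auto simp: seg_def anc_upd_new)
  moreover have "Suc n \<notin> seg f u k" using k by (auto simp: seg_def dest: anc_le)
  ultimately have "card (seg (f(Suc n := k)) u (Suc n)) = Suc (card (seg f u k))" by simp
  moreover have "Suc n \<notin> subtree n f u" by (simp add: subtree_def)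
  ultimately show ?thesis
    unfolding path_sum_def[of s "Suc n"] subtree_upd[OF assms]
    by (simp add: old)
qed

end

text \<open>Write \<open>N\<close> for the size and \<open>Z\<close> for the path sum. A new vertex
  below \<open>k\<close> adds \<open>s * s ^ d\<close> with \<open>d\<close> the depth of
  \<open>k\<close>, so the total gain is \<open>N * Z + (N + 2) * s * Z\<close>, which falls short
  of \<open>(1 + s) * (N + 1) * Z\<close> by \<open>(1 - s) * Z\<close>. The weight
  \<open>N + 1\<close> is what closes the recursion: with \<open>N\<close> alone, an excess
  \<open>s * Z\<close> would remain.\<close>

lemma sum_path_sum_upd:
  assumes f: "f \<in> parent_funs n" and u: "u \<in> {1..n}" and s: "0 \<le> s" "s \<le> 1"
  shows "(\<Sum>k=1..n. (real (card (subtree (Suc n) (f(Suc n := k)) u)) + 1) * path_sum s (Suc n) (f(Suc n := k)) u)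
    \<le> (real n + 1 + s) * ((real (card (subtree n f u)) + 1) * path_sum s n f u)"
proof -
  let ?N = "real (card (subtree n f u))" and ?Z = "path_sum s n f u" and ?T = "subtree n f u"
  have "(\<Sum>k=1..n. (real (card (subtree (Suc n) (f(Suc n := k)) u)) + 1) * path_sum s (Suc n) (f(Suc n := k)) u)
     = (\<Sum>k=1..n. (?N + 1) * ?Z + of_bool (k \<in> ?T) * (?Z + (?N + 2) * s * s ^ card (seg f u k)))"
    by (intro sum.cong refl)
      (auto simp: card_subtree_upd[OF f _ u] path_sum_upd[OF f _ u] algebra_simps)
  also have "\<dots> = real n * ((?N + 1) * ?Z) + (\<Sum>k\<in>{1..n}. if k \<in> ?T then ?Z + (?N + 2) * s * s ^ card (seg f u k) else 0)"
    by (simp add: sum.distrib of_bool_def if_distrib[of "\<lambda>x. x * _"] cong: if_cong)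
  also have "(\<Sum>k\<in>{1..n}. if k \<in> ?T then ?Z + (?N + 2) * s * s ^ card (seg f u k) else 0)
    = (\<Sum>k\<in>?T. ?Z + (?N + 2) * s * s ^ card (seg f u k))"
    by (subst sum.inter_restrict[symmetric]) (auto simp: subtree_def intro!: sum.cong)
  also have "\<dots> = ?N * ?Z + (?N + 2) * s * ?Z"
    by (simp add: sum.distrib path_sum_def sum_distrib_left)
  finally have eq: "(\<Sum>k=1..n. (real (card (subtree (Suc n) (f(Suc n := k)) u)) + 1) * path_sum s (Suc n) (f(Suc n := k)) u)
    = real n * ((?N + 1) * ?Z) + (?N * ?Z + (?N + 2) * s * ?Z)" .
  have "?N * ?Z + (?N + 2) * s * ?Z \<le> (1 + s) * ((?N + 1) * ?Z)"
  proof -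
    have "?N * ?Z + (?N + 2) * s * ?Z = (1 + s) * ((?N + 1) * ?Z) - (1 - s) * ?Z"
      by (simp add: algebra_simps)
    then show ?thesis using s path_sum_nonneg[of s n f u] by simp
  qed
  then show ?thesis unfolding eq by (simp add: distrib_right)
qed

text \<open>Each new vertex multiplies the mean by at most \<open>1 + (1 + s) / n\<close>, hence by
  at most \<open>((n + 1) / n) powr (1 + s)\<close>, and these factors telescope. The
  \<open>2\<close> is the value at \<open>n = u\<close>, where the subtree is
  \<open>{u}\<close>.\<close>

lemma expectation_path_sum:
  assumes "1 \<le> u" "u \<le> n" "0 \<le> s" "s \<le> 1"
  shows "measure_pmf.expectation (random_parents n) (\<lambda>f. (real (card (subtree n f u)) + 1) * path_sum s n f u)
    \<le> 2 * (real n / real u) powr (1 + s)"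
  using assms(2)
proof (induction n rule: dec_induct)
  case base
  have "(real (card (subtree u f u)) + 1) * path_sum s u f u = 2" for f
  proof -
    have "subtree u f u = {u}" using assms(1) by (auto simp: subtree_def dest: anc_le)
    moreover have "seg f u u = {}" by (auto simp: seg_def dest: anc_le)
    ultimately show ?thesis by (simp add: path_sum_def)
  qed
  then show ?case using assms(1) by simp
next
  case (step n)
  let ?G = "\<lambda>n f. (real (card (subtree n f u)) + 1) * path_sum s n f u"
  have n: "n \<ge> 1" using step assms by simp
  have "measure_pmf.expectation (random_parents (Suc n)) (?G (Suc n))
    = measure_pmf.expectation (random_parents n) (\<lambda>f. (\<Sum>k=1..n. ?G (Suc n) (f(Suc n := k))) / real n)"
    by (rule random_parents_Suc[OF n])
  also have "\<dots> \<le> measure_pmf.expectation (random_parents n) (\<lambda>f. (1 + (1 + s) * (1 / real n)) * ?G n f)"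
  proof (intro integral_mono_AE integrable_random_parents)
    have "(\<Sum>k=1..n. ?G (Suc n) (f(Suc n := k))) / real n \<le> (1 + (1 + s) * (1 / real n)) * ?G n f"
      if "f \<in> parent_funs n" for f
    proof -
      have "(\<Sum>k=1..n. ?G (Suc n) (f(Suc n := k))) / real n \<le> (real n + 1 + s) * ?G n f / real n"
        using that step assms by (intro divide_right_mono sum_path_sum_upd) auto
      also have "\<dots> = (1 + (1 + s) * (1 / real n)) * ?G n f" using n by (simp add: field_simps)
      finally show ?thesis .
    qed
    then show "AE f in measure_pmf (random_parents n). (\<Sum>k=1..n. ?G (Suc n) (f(Suc n := k))) / real n
        \<le> (1 + (1 + s) * (1 / real n)) * ?G n f"
      by (simp add: AE_measure_pmf_iff)
  qed
  also have "\<dots> = (1 + (1 + s) * (1 / real n)) * measure_pmf.expectation (random_parents n) (?G n)"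
    by (rule integral_mult_right_zero)
  also have "\<dots> \<le> (1 + 1 / real n) powr (1 + s) * (2 * (real n / real u) powr (1 + s))"
    using step assms
    by (intro mult_mono powr_ge_one_plus Bochner_Integration.integral_nonneg mult_nonneg_nonneg path_sum_nonneg) auto
  also have "\<dots> = 2 * ((1 + 1 / real n) * (real n / real u)) powr (1 + s)"
    by (subst powr_mult) auto
  also have "(1 + 1 / real n) * (real n / real u) = real (Suc n) / real u"
  proof -
    have "(1 + 1 / real n) * real n = real (Suc n)" using n by (simp add: distrib_right)
    then show ?thesis by (metis times_divide_eq_right)
  qed
  finally show ?case .
qed

section \<open>The coupling\<close>

lemma expectation_pair_pmf:
  fixes h :: "'a \<times> 'b \<Rightarrow> real"
  assumes "finite (set_pmf A)" "finite (set_pmf B)"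
  shows "measure_pmf.expectation (pair_pmf A B) h =
    measure_pmf.expectation A (\<lambda>a. measure_pmf.expectation B (\<lambda>b. h (a, b)))"
proof -
  have "pair_pmf A B = bind_pmf A (\<lambda>a. map_pmf (Pair a) B)"
    by (simp add: pair_pmf_def map_pmf_def)
  then have "measure_pmf.expectation (pair_pmf A B) h =
      (\<Sum>a\<in>set_pmf A. pmf A a *\<^sub>R measure_pmf.expectation (map_pmf (Pair a) B) h)"
    using assms by (simp, subst pmf_expectation_bind[where A = "set_pmf A"]) auto
  also have "\<dots> = measure_pmf.expectation A (\<lambda>a. measure_pmf.expectation B (\<lambda>b. h (a, b)))"
    using assms by (subst integral_measure_pmf[of "set_pmf A" A "\<lambda>a. measure_pmf.expectation B (\<lambda>b. h (a, b))"]) auto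
  finally show ?thesis .
qed

lemma prob_union_le:
  assumes "finite (set_pmf M)" "finite B"
  shows "measure_pmf.prob M {\<omega>. \<exists>y\<in>B. Q y \<omega>} \<le> (\<Sum>y\<in>B. measure_pmf.prob M {\<omega>. Q y \<omega>})"
  unfolding prob_eq_expectation expectation_sum[OF assms(1), symmetric]
proof (rule expectation_mono[OF assms(1)])
  fix \<omega>
  show "of_bool (\<exists>y\<in>B. Q y \<omega>) \<le> (\<Sum>y\<in>B. of_bool (Q y \<omega>) :: real)"
  proof (cases "\<exists>y\<in>B. Q y \<omega>")
    case True
    then obtain y where "y \<in> B" "Q y \<omega>" by blast
    then have "(1::real) = of_bool (Q y \<omega>)" by simp
    also have "\<dots> \<le> (\<Sum>y\<in>B. of_bool (Q y \<omega>))"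
      using \<open>y \<in> B\<close> assms(2) by (intro member_le_sum) auto
    finally show ?thesis using True by simp
  qed (simp add: sum_nonneg)
qed

lemma markov_pmf:
  fixes g :: "'a \<Rightarrow> real"
  assumes "finite (set_pmf M)" "\<And>\<omega>. 0 \<le> g \<omega>" "y > 0"
  shows "measure_pmf.prob M {\<omega>. y \<le> g \<omega>} \<le> measure_pmf.expectation M g / y"
proof -
  have "measure_pmf.prob M {\<omega>. y \<le> g \<omega>} \<le> measure_pmf.expectation M (\<lambda>\<omega>. g \<omega> / y)"
    unfolding prob_eq_expectation
    using assms by (intro expectation_mono) (auto simp: of_bool_def)
  then show ?thesis by simp
qed

definition marks :: "real \<Rightarrow> nat \<Rightarrow> (nat \<Rightarrow> bool) pmf" where
  "marks p n = Pi_pmf {2..n} False (\<lambda>_. bernoulli_pmf p)"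

definition decisions :: "real \<Rightarrow> nat \<Rightarrow> (nat list \<times> (nat \<Rightarrow> bool)) pmf" where
  "decisions p n = pair_pmf (random_perm {2..n}) (marks p n)"

definition coupling :: "real \<Rightarrow> nat \<Rightarrow> ((nat \<Rightarrow> nat) \<times> nat list \<times> (nat \<Rightarrow> bool)) pmf" where
  "coupling p n = pair_pmf (random_parents n) (decisions p n)"

lemma finite_set_marks [simp]: "finite (set_pmf (marks p n))"
  unfolding marks_def by (rule finite_subset[OF set_Pi_pmf_subset']) (auto intro!: finite_PiE_dflt)

lemma set_random_perm_interval [simp]:
  "set_pmf (random_perm {2..n::nat}) = permutations_of_set {2..n}"
  by (rule set_random_perm) simp

lemma finite_set_decisions [simp]: "finite (set_pmf (decisions p n))"
  by (simp add: decisions_def)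

lemma finite_set_coupling [simp]: "finite (set_pmf (coupling p n))"
  by (simp add: coupling_def)

lemma set_coupling: "(f, vs, b) \<in> set_pmf (coupling p n) \<Longrightarrow> f \<in> parent_funs n \<and> vs \<in> permutations_of_set {2..n}"
  by (auto simp: coupling_def decisions_def)

lemma expectation_coupling:
  "measure_pmf.expectation (coupling p n) h =
    measure_pmf.expectation (random_parents n) (\<lambda>f. measure_pmf.expectation (decisions p n) (\<lambda>d. h (f, d) :: real))"
  unfolding coupling_def by (rule expectation_pair_pmf) auto

lemma expectation_decisions:
  "measure_pmf.expectation (decisions p n) h =
    measure_pmf.expectation (random_perm {2..n}) (\<lambda>vs. measure_pmf.expectation (marks p n) (\<lambda>b. h (vs, b) :: real))"
  unfolding decisions_def by (rule expectation_pair_pmf) auto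

lemma prob_coupling:
  "measure_pmf.prob (coupling p n) {(f, vs, b). P f vs b} =
    measure_pmf.expectation (random_parents n) (\<lambda>f. measure_pmf.prob (decisions p n) {(vs, b). P f vs b})"
  using prob_eq_expectation[of "coupling p n" "\<lambda>(f, vs, b). P f vs b"]
    prob_eq_expectation[of "decisions p n" "\<lambda>(vs, b). P _ vs b"]
  by (simp add: expectation_coupling)

lemma prob_decisions:
  "measure_pmf.prob (decisions p n) {(vs, b). P vs b} =
    measure_pmf.expectation (random_perm {2..n}) (\<lambda>vs. measure_pmf.prob (marks p n) {b. P vs b})"
  using prob_eq_expectation[of "decisions p n" "\<lambda>(vs, b). P vs b"]
    prob_eq_expectation[of "marks p n" "\<lambda>b. P _ b"]
  by (simp add: expectation_decisions)

lemma fire_dynamics_parent_tree: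
  assumes "f \<in> parent_funs n"
  shows "fire_dynamics p (parent_tree n f) = map_pmf (\<lambda>(vs, b). fire_state n f b vs) (decisions p n)"
proof -
  let ?h = "parent_edge f"
  have "permutations_of_set (parent_tree n f) = map ?h ` permutations_of_set {2..n}"
    unfolding parent_tree_def by (rule permutations_of_set_image_inj[OF parent_edge_inj_on[OF assms]])
  moreover have "inj_on (map ?h) (permutations_of_set {2..n})"
    using parent_edge_inj_on[OF assms] by (intro inj_on_mapI) (auto dest: permutations_of_setD intro: inj_on_subset)
  ultimately have "pmf_of_set (permutations_of_set (parent_tree n f)) = map_pmf (map ?h) (random_perm {2..n})"
    by (simp add: map_pmf_of_set_inj)
  then have "fire_dynamics p (parent_tree n f) =
      bind_pmf (random_perm {2..n}) (\<lambda>vs. fire_run p (parent_tree n f) (map ?h vs) (\<lambda>_. Flammable))"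
    by (simp add: fire_dynamics_def bind_map_pmf)
  also have "\<dots> = bind_pmf (random_perm {2..n}) (\<lambda>vs. map_pmf (\<lambda>b. fire_state n f b vs) (marks p n))"
  proof (intro bind_pmf_cong refl)
    fix vs assume "vs \<in> set_pmf (random_perm {2..n})"
    then have "set vs = {2..n}" "distinct vs" by (auto dest: permutations_of_setD)
    then show "fire_run p (parent_tree n f) (map ?h vs) (\<lambda>_. Flammable) = map_pmf (\<lambda>b. fire_state n f b vs) (marks p n)"
      by (simp add: fire_run_eq_det_run fire_state_def marks_def)
  qed
  also have "\<dots> = map_pmf (\<lambda>(vs, b). fire_state n f b vs) (decisions p n)"
    by (simp add: decisions_def pair_pmf_def map_pmf_def bind_assoc_pmf bind_return_pmf)
  finally show ?thesis .
qed

lemma fire_on_rrt_eq: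
  assumes "n \<ge> 1"
  shows "fire_on_rrt p n = map_pmf (\<lambda>(f, vs, b). (parent_tree n f, fire_state n f b vs)) (coupling p n)"
proof -
  have "pmf_of_set (recursive_trees n) = map_pmf (parent_tree n) (random_parents n)"
    unfolding recursive_trees_eq[OF assms] by (simp add: map_pmf_of_set_inj parent_tree_inj_on)
  then have "fire_on_rrt p n = bind_pmf (random_parents n)
      (\<lambda>f. map_pmf (Pair (parent_tree n f)) (fire_dynamics p (parent_tree n f)))"
    by (simp add: fire_on_rrt_def bind_map_pmf)
  also have "\<dots> = bind_pmf (random_parents n)
      (\<lambda>f. map_pmf (\<lambda>(vs, b). (parent_tree n f, fire_state n f b vs)) (decisions p n))"
    by (intro bind_pmf_cong refl) (auto simp: fire_dynamics_parent_tree pmf.map_comp o_def case_prod_unfold)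
  also have "\<dots> = map_pmf (\<lambda>(f, vs, b). (parent_tree n f, fire_state n f b vs)) (coupling p n)"
    by (simp add: coupling_def pair_pmf_def map_bind_pmf map_pmf_def bind_assoc_pmf bind_return_pmf case_prod_beta)
  finally show ?thesis .
qed

lemma prob_mark:
  assumes "0 \<le> p" "p \<le> 1" "x \<in> {2..n}"
  shows "measure_pmf.prob (marks p n) {b. b x} = p"
proof -
  have "measure_pmf.prob (marks p n) {b. b x} = measure_pmf.prob (map_pmf (\<lambda>b. b x) (marks p n)) {True}"
    by (simp add: vimage_def)
  also have "map_pmf (\<lambda>b. b x) (marks p n) = bernoulli_pmf p"
    unfolding marks_def using assms(3) by (subst Pi_pmf_component) auto
  finally show ?thesis using assms by (simp add: measure_pmf_single)
qed

lemma prob_no_mark: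
  assumes "0 \<le> p" "p \<le> 1" "S \<subseteq> {2..n}"
  shows "measure_pmf.prob (marks p n) {b. \<forall>x\<in>S. \<not> b x} = (1 - p) ^ card S"
proof -
  have "{b. \<forall>x\<in>S. \<not> b x} = Pi {2..n} (\<lambda>x. if x \<in> S then {False} else UNIV)"
    using assms(3) by (auto simp: Pi_def split: if_splits)
  then have "measure_pmf.prob (marks p n) {b. \<forall>x\<in>S. \<not> b x} =
      (\<Prod>x\<in>{2..n}. measure_pmf.prob (bernoulli_pmf p) (if x \<in> S then {False} else UNIV))"
    unfolding marks_def by (simp add: measure_Pi_pmf_Pi)
  also have "\<dots> = (\<Prod>x\<in>{2..n}. if x \<in> S then 1 - p else 1)"
    using assms by (intro prod.cong) (auto simp: measure_pmf_single)
  also have "\<dots> = (\<Prod>x\<in>{2..n} \<inter> S. 1 - p)"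
    by (subst prod.inter_restrict) auto
  also have "{2..n} \<inter> S = S" using assms(3) by blast
  finally show ?thesis by simp
qed

lemma prob_mark_and:
  assumes "0 \<le> p" "p \<le> 1" "x \<in> {2..n}"
  shows "measure_pmf.prob (decisions p n) {(vs, b). b x \<and> Q vs} =
    p * measure_pmf.prob (random_perm {2..n}) {vs. Q vs}"
proof -
  have "measure_pmf.prob (marks p n) {b. b x \<and> Q vs} = p * of_bool (Q vs)" for vs
    using prob_mark[OF assms] by (cases "Q vs") auto
  then show ?thesis
    unfolding prob_decisions prob_eq_expectation[of "random_perm {2..n}"] by simp
qed

section \<open>Estimates for a fixed size\<close>

lemma harmonic_le_ln: "n \<ge> 1 \<Longrightarrow> (\<Sum>t=2..n. 1 / real t) \<le> ln (real n)"
proof (induction n rule: dec_induct)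
  case (step n)
  then have n: "real n > 0" by simp
  have "1 / real (Suc n) \<le> - ln (1 - 1 / real (Suc n))"
    using n by (intro order.trans[OF _ le_imp_neg_le[OF ln_le_minus_one]]) auto
  also have "1 - 1 / real (Suc n) = real n / real (Suc n)" by (simp add: field_simps)
  also have "- ln (real n / real (Suc n)) = ln (real (Suc n)) - ln (real n)"
    using n by (simp add: ln_div)
  finally show ?case using step by simp
qed simp

lemma sum_inverse_squares_le:
  assumes "m \<ge> 1"
  shows "(\<Sum>t=Suc m..n. 1 / (real t)\<^sup>2) \<le> 1 / real m"
proof (cases "m \<le> n")
  case True
  \<comment> \<open>The subtracted \<open>1 / real n\<close> makes the induction telescope.\<close>
  then have "(\<Sum>t=Suc m..n. 1 / (real t)\<^sup>2) \<le> 1 / real m - 1 / real n"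
  proof (induction n rule: dec_induct)
    case (step n)
    have n: "real n > 0" using step assms by simp
    have "1 / (real (Suc n))\<^sup>2 \<le> 1 / (real n * real (Suc n))"
      unfolding power2_eq_square using n by (intro divide_left_mono mult_right_mono) auto
    also have "\<dots> = 1 / real n - 1 / real (Suc n)" using n by (simp add: field_simps)
    finally have "1 / (real (Suc n))\<^sup>2 \<le> 1 / real n - 1 / real (Suc n)" .
    then show ?case using step by simp
  qed simp
  also have "\<dots> \<le> 1 / real m" by simp
  finally show ?thesis .
qed simp

lemma one_le_powr_half_power:
  assumes "n \<ge> 2" "real d < ln (real n) / 4"
  shows "1 \<le> real n powr (1/4) * (1/2) ^ d"
proof -
  have "(2::real) ^ d \<le> exp 1 ^ d" using exp_ge_add_one_self[of 1] by (intro power_mono) auto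
  also have "\<dots> = exp (real d)" by (simp add: exp_of_nat_mult[symmetric])
  also have "\<dots> \<le> exp (ln (real n) / 4)" using assms(2) by simp
  also have "\<dots> = real n powr (1/4)" using assms(1) by (simp add: powr_def)
  finally show ?thesis by (simp add: field_simps)
qed

text \<open>Paths of length at least \<open>ln n / 4\<close> pay at most \<open>4 / ln n\<close>.
  Shorter ones are charged to the second term, which is then at least \<open>1\<close>, but whose
  sum over all vertices has mean at most \<open>2 * n powr (3/4)\<close> when the paths lead to the
  root.\<close>

lemma inverse_le_split:
  assumes "n \<ge> 2" "d \<ge> 1"
  shows "1 / real d \<le> 4 / ln (real n) + real n powr (1/4) * (1/2) ^ d"
proof (cases "real d < ln (real n) / 4")
  case True
  have "1 / real d \<le> 1" using assms by simp
  moreover have "4 / ln (real n) \<ge> 0" using assms by simp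
  ultimately show ?thesis using one_le_powr_half_power[OF assms(1) True] by linarith
next
  case False
  then have "1 / real d \<le> 4 / ln (real n)" using assms by (simp add: field_simps)
  then show ?thesis by (simp add: add_increasing2)
qed

lemma inverse_square_le_split:
  assumes "n \<ge> 2" "d \<ge> 1"
  shows "1 / (real d)\<^sup>2 \<le> 16 / (ln (real n))\<^sup>2 + real n powr (1/4) * (1/2) ^ d"
proof (cases "real d < ln (real n) / 4")
  case True
  have "1 / (real d)\<^sup>2 \<le> 1" using assms by simp
  moreover have "16 / (ln (real n))\<^sup>2 \<ge> 0" by simp
  ultimately show ?thesis using one_le_powr_half_power[OF assms(1) True] by linarith
next
  case False
  then have "1 / real d \<le> 4 / ln (real n)" using assms by (simp add: field_simps)
  then have "(1 / real d)\<^sup>2 \<le> (4 / ln (real n))\<^sup>2" by (intro power_mono) auto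
  then show ?thesis by (simp add: power_divide add_increasing2)
qed

lemma subtree_root:
  assumes "f \<in> parent_funs n"
  shows "subtree n f 1 = {1..n}"
  using anc_range(2)[OF assms] by (auto simp: subtree_def)

lemma card_seg_pos: "t < x \<Longrightarrow> 1 \<le> card (seg f t x)"
  by (auto simp: Suc_le_eq card_gt_0_iff seg_def intro!: exI[of _ x])

context
  fixes n :: nat
  assumes n: "n \<ge> 2"
begin

text \<open>At the root the weight is the constant \<open>n + 1\<close> and can be divided out of
  \<open>expectation_path_sum\<close>; this lowers the exponent from \<open>1 + s\<close> to
  \<open>s\<close>.\<close>

lemma expectation_root_path_sum:
  assumes "0 \<le> s" "s \<le> 1"
  shows "measure_pmf.expectation (random_parents n) (\<lambda>f. path_sum s n f 1) \<le> 2 * real n powr s"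
proof -
  have "(real n + 1) * measure_pmf.expectation (random_parents n) (\<lambda>f. path_sum s n f 1) =
      measure_pmf.expectation (random_parents n) (\<lambda>f. (real n + 1) * path_sum s n f 1)"
    by (rule integral_mult_right_zero[symmetric])
  also have "\<dots> = measure_pmf.expectation (random_parents n) (\<lambda>f. (real (card (subtree n f 1)) + 1) * path_sum s n f 1)"
    by (intro integral_cong_AE) (auto simp: AE_measure_pmf_iff subtree_root[simplified])
  also have "\<dots> \<le> 2 * (real n / real 1) powr (1 + s)"
    using n assms by (intro expectation_path_sum) auto
  also have "\<dots> = real n * (2 * real n powr s)" using n by (simp add: powr_add)
  also have "\<dots> \<le> (real n + 1) * (2 * real n powr s)" by (intro mult_right_mono) auto
  finally show ?thesis by (rule mult_left_le_imp_le) simp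
qed

lemma expectation_card_subtree_squared:
  assumes "u \<in> {1..n}"
  shows "measure_pmf.expectation (random_parents n) (\<lambda>f. (real (card (subtree n f u)) + 1) * real (card (subtree n f u)))
    \<le> 2 * (real n / real u)\<^sup>2"
  using expectation_path_sum[of u n 1] assms n by (simp add: path_sum_one powr_numeral)

text \<open>The second moment is reused through \<open>N \<le> ((N + 1) * N / a + a) / 2\<close>
  with \<open>a = n / u\<close>; the constant is \<open>(2 + 1) / 2\<close>.\<close>

lemma expectation_card_subtree:
  assumes "u \<in> {1..n}"
  shows "measure_pmf.expectation (random_parents n) (\<lambda>f. real (card (subtree n f u))) \<le> 3 / 2 * (real n / real u)"
proof -
  define a where "a = real n / real u"
  have a: "a > 0" using assms n by (simp add: a_def)
  have amgm: "N \<le> ((N + 1) * N / a + a) / 2" if "N \<ge> 0" for N :: real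
  proof -
    have "0 \<le> (N - a)\<^sup>2 + N" using that by simp
    then show ?thesis using a by (simp add: field_simps power2_eq_square)
  qed
  have affine: "measure_pmf.expectation (random_parents n) (\<lambda>f. (X f / a + a) / 2) =
      (measure_pmf.expectation (random_parents n) X / a + a) / 2" for X
    by simp
  have "measure_pmf.expectation (random_parents n) (\<lambda>f. real (card (subtree n f u))) \<le>
    measure_pmf.expectation (random_parents n) (\<lambda>f. ((real (card (subtree n f u)) + 1) * real (card (subtree n f u)) / a + a) / 2)"
    by (intro expectation_mono amgm) auto
  also have "\<dots> = (measure_pmf.expectation (random_parents n)
      (\<lambda>f. (real (card (subtree n f u)) + 1) * real (card (subtree n f u))) / a + a) / 2"
    by (rule affine)
  also have "\<dots> \<le> (2 * a\<^sup>2 / a + a) / 2"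
    using expectation_card_subtree_squared[OF assms] a
    by (intro divide_right_mono add_right_mono) (auto simp: a_def)
  also have "\<dots> = 3 / 2 * a" using a by (simp add: power2_eq_square)
  finally show ?thesis by (simp add: a_def)
qed

end

section \<open>Fires started below a vertex other than the root\<close>

context
  fixes n :: nat and p :: real
  assumes n: "n \<ge> 2" and p: "0 \<le> p" "p \<le> 1"
begin

lemma prob_ignites:
  assumes f: "f \<in> parent_funs n" and "t \<in> {2..n}" "x \<in> {2..n}" "t \<in> anc f x" "t < x"
  shows "measure_pmf.prob (decisions p n) {(vs, b). ignites f b vs t x} \<le> p * (1 / (real (card (seg f t x)))\<^sup>2)"
proof -
  have "{(vs, b). ignites f b vs t x} = {(vs, b). b x \<and> (first_in vs x (seg f t x) \<and> pos vs t < pos vs x)}"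
    using assms by (auto simp: ignites_def)
  then have "measure_pmf.prob (decisions p n) {(vs, b). ignites f b vs t x} =
      p * measure_pmf.prob (random_perm {2..n}) {vs. first_in vs x (seg f t x) \<and> pos vs t < pos vs x}"
    using prob_mark_and[OF p assms(3)] by simp
  also have "\<dots> \<le> p * (1 / (real (card (seg f t x)))\<^sup>2)"
    using assms seg_subset[OF f, of x t] p
    by (intro mult_left_mono prob_first_second) (auto simp: seg_def)
  finally show ?thesis .
qed

lemma prob_exists_ignites:
  assumes f: "f \<in> parent_funs n" and t: "t \<in> {2..n}"
  shows "measure_pmf.prob (decisions p n) {(vs, b). \<exists>x\<in>{2..n}. ignites f b vs t x} \<le>
    p * (16 / (ln (real n))\<^sup>2 * real (card (subtree n f t)) + real n powr (1/4) * path_sum (1/2) n f t)"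
proof -
  let ?w = "\<lambda>d. 16 / (ln (real n))\<^sup>2 + real n powr (1/4) * (1/2) ^ d"
  have "measure_pmf.prob (decisions p n) {(vs, b). \<exists>x\<in>{2..n}. ignites f b vs t x} \<le>
      (\<Sum>x\<in>{2..n}. measure_pmf.prob (decisions p n) {(vs, b). ignites f b vs t x})"
    using prob_union_le[of "decisions p n" "{2..n}" "\<lambda>x (vs, b). ignites f b vs t x"]
    by (simp add: case_prod_unfold)
  also have "\<dots> \<le> (\<Sum>x\<in>{2..n}. if x \<in> subtree n f t then p * ?w (card (seg f t x)) else 0)"
  proof (intro sum_mono)
    fix x assume x: "x \<in> {2..n}"
    show "measure_pmf.prob (decisions p n) {(vs, b). ignites f b vs t x} \<le>
        (if x \<in> subtree n f t then p * ?w (card (seg f t x)) else 0)"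
    proof (cases "t \<in> anc f x \<and> t < x")
      case True
      have "measure_pmf.prob (decisions p n) {(vs, b). ignites f b vs t x} \<le> p * (1 / (real (card (seg f t x)))\<^sup>2)"
        using prob_ignites[OF f t x] True by blast
      also have "\<dots> \<le> p * ?w (card (seg f t x))"
        using True p by (intro mult_left_mono inverse_square_le_split n card_seg_pos) auto
      finally show ?thesis using True x by (simp add: subtree_def)
    next
      case False
      then have empty: "{(vs, b). ignites f b vs t x} = {}" by (auto simp: ignites_def)
      show ?thesis unfolding empty using p by simp
    qed
  qed
  also have "\<dots> \<le> (\<Sum>x\<in>subtree n f t. p * ?w (card (seg f t x)))"
    using p by (subst sum.inter_restrict[symmetric]) (auto intro!: sum_mono2 mult_nonneg_nonneg add_nonneg_nonneg)
  also have "\<dots> = p * (16 / (ln (real n))\<^sup>2 * real (card (subtree n f t)) + real n powr (1/4) * path_sum (1/2) n f t)"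
    by (simp add: path_sum_def sum.distrib sum_distrib_left distrib_left mult.assoc)
  finally show ?thesis .
qed

text \<open>The bound is of order \<open>n / ln n\<close> when \<open>p\<close> is of order \<open>ln n / n\<close>: in a subtree, the edge
  set on fire has to come first on a path of typical length \<open>ln n\<close>, and the edge above the
  subtree even earlier, which gains a factor \<open>(ln n)\<^sup>2\<close>.\<close>

lemma expectation_burnt_below:
  "measure_pmf.expectation (coupling p n) (\<lambda>(f, vs, b).
      \<Sum>t | t \<in> {2..n} \<and> (\<exists>x\<in>{2..n}. ignites f b vs t x). real (card (subtree n f t)))
    \<le> p * (32 * (real n / ln (real n))\<^sup>2 + 2 * real n powr (7/4) * ln (real n))"
proof -
  let ?N = "\<lambda>f t. real (card (subtree n f t))"
  let ?B = "\<lambda>f vs b t. \<exists>x\<in>{2..n}. ignites f b vs t x"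
  let ?P = "\<lambda>f t. measure_pmf.prob (decisions p n) {(vs, b). ?B f vs b t}"
  let ?a = "16 / (ln (real n))\<^sup>2" and ?b = "real n powr (1/4)"
  have "measure_pmf.expectation (coupling p n) (\<lambda>(f, vs, b). \<Sum>t | t \<in> {2..n} \<and> ?B f vs b t. ?N f t)
      = measure_pmf.expectation (random_parents n) (\<lambda>f. \<Sum>t\<in>{2..n}. ?N f t * ?P f t)"
  proof -
    have "measure_pmf.expectation (decisions p n) (\<lambda>(vs, b). \<Sum>t | t \<in> {2..n} \<and> ?B f vs b t. ?N f t)
      = (\<Sum>t\<in>{2..n}. ?N f t * ?P f t)" for f
    proof -
      have "(\<Sum>t | t \<in> {2..n} \<and> ?B f vs b t. ?N f t) = (\<Sum>t\<in>{2..n}. ?N f t * of_bool (?B f vs b t))" for vs b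
        unfolding sum.inter_filter[OF finite_atLeastAtMost] by (intro sum.cong) auto
      then have "measure_pmf.expectation (decisions p n) (\<lambda>(vs, b). \<Sum>t | t \<in> {2..n} \<and> ?B f vs b t. ?N f t)
        = measure_pmf.expectation (decisions p n) (\<lambda>d. \<Sum>t\<in>{2..n}. ?N f t * of_bool (?B f (fst d) (snd d) t))"
        by (simp add: case_prod_unfold)
      also have "\<dots> = (\<Sum>t\<in>{2..n}. ?N f t * measure_pmf.expectation (decisions p n) (\<lambda>d. of_bool (?B f (fst d) (snd d) t)))"
        by (subst expectation_sum) auto
      finally show ?thesis
        by (simp add: prob_eq_expectation[symmetric] case_prod_unfold)
    qed
    then show ?thesis by (simp add: expectation_coupling case_prod_unfold)
  qed
  also have "\<dots> \<le> measure_pmf.expectation (random_parents n) (\<lambda>f. \<Sum>t\<in>{2..n}.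
      p * (?a * ((?N f t + 1) * path_sum 1 n f t) + ?b * ((?N f t + 1) * path_sum (1/2) n f t)))"
  proof (intro expectation_mono sum_mono)
    fix f t assume f: "f \<in> set_pmf (random_parents n)" and t: "t \<in> {2..n}"
    have "?N f t * ?P f t \<le> ?N f t * (p * (?a * ?N f t + ?b * path_sum (1/2) n f t))"
      using f t by (intro mult_left_mono prob_exists_ignites) auto
    \<comment> \<open>Raising the size by one puts both terms in the form of
      \<open>expectation_path_sum\<close>; in the first term the size is itself
      \<open>path_sum 1\<close>.\<close>
    also have "\<dots> \<le> (?N f t + 1) * (p * (?a * ?N f t + ?b * path_sum (1/2) n f t))"
      using p by (intro mult_right_mono mult_nonneg_nonneg add_nonneg_nonneg path_sum_nonneg) auto
    also have "\<dots> = p * (?a * ((?N f t + 1) * path_sum 1 n f t) + ?b * ((?N f t + 1) * path_sum (1/2) n f t))"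
      by (simp add: path_sum_one algebra_simps add_divide_distrib)
    finally show "?N f t * ?P f t \<le> \<dots>" .
  qed simp
  also have "\<dots> = (\<Sum>t\<in>{2..n}. p * (
      ?a * measure_pmf.expectation (random_parents n) (\<lambda>f. (?N f t + 1) * path_sum 1 n f t) +
      ?b * measure_pmf.expectation (random_parents n) (\<lambda>f. (?N f t + 1) * path_sum (1/2) n f t)))"
    by (subst expectation_sum, simp)
      (simp only: integral_mult_right_zero Bochner_Integration.integral_add integrable_random_parents)
  also have "\<dots> \<le> (\<Sum>t\<in>{2..n}. p * (32 * (real n / ln (real n))\<^sup>2 * (1 / (real t)\<^sup>2) +
      2 * real n powr (7/4) * (1 / real t)))"
  proof (intro sum_mono mult_left_mono add_mono)
    fix t assume t: "t \<in> {2..n}"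
    have "?a * measure_pmf.expectation (random_parents n) (\<lambda>f. (?N f t + 1) * path_sum 1 n f t) \<le>
        ?a * (2 * (real n / real t) powr (1 + 1))"
      using t by (intro mult_left_mono expectation_path_sum) auto
    also have "\<dots> = 32 * (real n / ln (real n))\<^sup>2 * (1 / (real t)\<^sup>2)"
      using n t by (simp add: powr_numeral power_divide)
    finally show "?a * measure_pmf.expectation (random_parents n) (\<lambda>f. (?N f t + 1) * path_sum 1 n f t) \<le> \<dots>" .
    have "?b * measure_pmf.expectation (random_parents n) (\<lambda>f. (?N f t + 1) * path_sum (1/2) n f t) \<le>
        ?b * (2 * (real n / real t) powr (1 + 1/2))"
      using t by (intro mult_left_mono expectation_path_sum) auto
    also have "(real n / real t) powr (1 + 1/2) = real n powr (3/2) / real t powr (3/2)"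
      using t by (simp add: powr_divide)
    also have "?b * (2 * (real n powr (3/2) / real t powr (3/2))) = 2 * real n powr (7/4) / real t powr (3/2)"
      using n by (simp add: powr_add[symmetric])
    \<comment> \<open>The exponent \<open>3/2\<close> is lowered to \<open>1\<close> in order to
      reuse the harmonic bound; the extra \<open>ln n\<close> is negligible next to a power of
      \<open>n\<close>.\<close>
    also have "\<dots> \<le> 2 * real n powr (7/4) / real t"
      using t powr_mono[of 1 "3/2" "real t"] by (intro divide_left_mono) auto
    finally show "?b * measure_pmf.expectation (random_parents n) (\<lambda>f. (?N f t + 1) * path_sum (1/2) n f t) \<le>
        2 * real n powr (7/4) * (1 / real t)" by simp
  qed (use p in simp)
  also have "\<dots> = p * (32 * (real n / ln (real n))\<^sup>2 * (\<Sum>t=2..n. 1 / (real t)\<^sup>2) +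
      2 * real n powr (7/4) * (\<Sum>t=2..n. 1 / real t))"
    by (simp only: sum_distrib_left[symmetric] sum.distrib)
  also have "\<dots> \<le> p * (32 * (real n / ln (real n))\<^sup>2 * 1 + 2 * real n powr (7/4) * ln (real n))"
  proof (intro mult_left_mono add_mono)
    show "(\<Sum>t=2..n. 1 / (real t)\<^sup>2) \<le> 1"
      using sum_inverse_squares_le[of 1 n] by (simp add: numeral_2_eq_2)
    show "(\<Sum>t=2..n. 1 / real t) \<le> ln (real n)"
      using n by (intro harmonic_le_ln) simp
  qed (use p in auto)
  finally show ?thesis by simp
qed

end

text \<open>From \<open>(1 - p) ^ k * (1 + p) ^ k \<le> 1\<close> and Bernoulli's inequality. It
  serves for the chance that one of \<open>k\<close> marks burns; enlarging the denominator of the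
  fraction later makes the bound linear in \<open>k\<close>.\<close>

lemma one_minus_power_ge:
  fixes p :: real
  assumes "0 \<le> p" "p \<le> 1"
  shows "p * real k / (1 + p * real k) \<le> 1 - (1 - p) ^ k"
proof -
  have "(1 - p) ^ k * (1 + real k * p) \<le> (1 - p) ^ k * (1 + p) ^ k"
    using assms Bernoulli_inequality[of p k] by (intro mult_left_mono) auto
  also have "\<dots> = (1 - p\<^sup>2) ^ k"
    by (simp add: power_mult_distrib[symmetric] algebra_simps power2_eq_square)
  also have "\<dots> \<le> 1" using assms by (intro power_le_one) (auto simp: power_le_one)
  finally have "(1 - p) ^ k \<le> 1 / (1 + real k * p)"
    using assms by (subst pos_le_divide_eq) (auto intro: add_pos_nonneg)
  moreover have "p * real k / (1 + p * real k) = 1 - 1 / (1 + real k * p)"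
  proof -
    have "1 + real k * p > 0" using assms by (intro add_pos_nonneg) auto
    then show ?thesis by (simp add: field_simps)
  qed
  ultimately show ?thesis by simp
qed

lemma expectation_affine:
  fixes X :: "'a \<Rightarrow> real"
  assumes "finite (set_pmf M)"
  shows "measure_pmf.expectation M (\<lambda>\<omega>. u * (1 - l * (X \<omega> - m))) = u * (1 - l * (measure_pmf.expectation M X - m))"
  using integrable_measure_pmf_finite[OF assms, of X] by simp

lemma prob_decisions_order:
  "measure_pmf.prob (decisions p n) {(vs, b). Q vs} = measure_pmf.prob (random_perm {2..n}) {vs. Q vs}"
  unfolding prob_decisions prob_eq_expectation[of "random_perm {2..n}"]
  by (intro Bochner_Integration.integral_cong refl) auto

section \<open>Whether and when the root burns\<close>

context
  fixes n :: nat and p :: real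
  assumes n: "n \<ge> 2" and p: "0 \<le> p" "p \<le> 1"
begin

lemma sum_root_path_lengths:
  assumes f: "f \<in> parent_funs n" and s: "0 \<le> s"
    and g: "\<And>d. d \<ge> 1 \<Longrightarrow> g d \<le> a * s ^ d + c * (1/2) ^ d" and a: "0 \<le> a" "0 \<le> c"
  shows "(\<Sum>x=2..n. g (card (seg f 1 x))) \<le> a * path_sum s n f 1 + c * path_sum (1/2) n f 1"
proof -
  have "(\<Sum>x=2..n. g (card (seg f 1 x))) \<le> (\<Sum>x=2..n. a * s ^ card (seg f 1 x) + c * (1/2) ^ card (seg f 1 x))"
    by (intro sum_mono g card_seg_pos) auto
  also have "\<dots> \<le> (\<Sum>x=1..n. a * s ^ card (seg f 1 x) + c * (1/2) ^ card (seg f 1 x))"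
    using s a by (intro sum_mono2) (auto intro!: add_nonneg_nonneg mult_nonneg_nonneg)
  also have "\<dots> = a * path_sum s n f 1 + c * path_sum (1/2) n f 1"
    by (simp only: path_sum_def subtree_root[OF f] sum.distrib sum_distrib_left)
  finally show ?thesis .
qed

lemma ignites_root_iff:
  assumes "f \<in> parent_funs n" "x \<in> {2..n}"
  shows "ignites f b vs 1 x \<longleftrightarrow> b x \<and> first_in vs x (seg f 1 x)"
  using assms anc_range(2)[OF assms(1), of x] by (auto simp: ignites_def)

lemma root_seg:
  assumes "f \<in> parent_funs n" "x \<in> {2..n}"
  shows "seg f 1 x \<subseteq> {2..n}" "x \<in> seg f 1 x"
  using assms seg_subset[OF assms(1), of x 1] by (auto simp: seg_def)

text \<open>A union bound over \<open>x\<close>: the factor \<open>p\<close> is the mark, and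
  \<open>r ^ d / d\<close> with \<open>r = 1 - M / (n - 1)\<close> bounds the chance that
  \<open>x\<close> is first on a path of \<open>d\<close> edges none of which is early. The
  generating function at \<open>r\<close> brings in \<open>n powr r\<close>, which is about
  \<open>n * exp (- T)\<close> for \<open>M\<close> near \<open>T * n / ln n\<close>.\<close>

lemma prob_late_root_fire:
  assumes M: "M \<le> n - 1"
  shows "measure_pmf.prob (coupling p n) {(f, vs, b). \<exists>x\<in>{2..n}. ignites f b vs 1 x \<and> M \<le> pos vs x} \<le>
    p * (8 / ln (real n) * real n powr (1 - real M / (real n - 1)) + 2 * real n powr (3/4))"
proof -
  define r where "r = 1 - real M / (real n - 1)"
  have r: "0 \<le> r" "r \<le> 1" using M n by (auto simp: r_def of_nat_diff divide_le_eq)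
  let ?a = "4 / ln (real n)" and ?b = "real n powr (1/4)"
  have a: "0 \<le> ?a" using n by simp
  have "measure_pmf.prob (decisions p n) {(vs, b). \<exists>x\<in>{2..n}. ignites f b vs 1 x \<and> M \<le> pos vs x} \<le>
      p * (?a * path_sum r n f 1 + ?b * path_sum (1/2) n f 1)" if f: "f \<in> parent_funs n" for f
  proof -
    have "measure_pmf.prob (decisions p n) {(vs, b). \<exists>x\<in>{2..n}. ignites f b vs 1 x \<and> M \<le> pos vs x} \<le>
        (\<Sum>x=2..n. measure_pmf.prob (decisions p n) {(vs, b). ignites f b vs 1 x \<and> M \<le> pos vs x})"
      using prob_union_le[of "decisions p n" "{2..n}" "\<lambda>x (vs, b). ignites f b vs 1 x \<and> M \<le> pos vs x"]
      by (simp add: case_prod_unfold)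
    also have "\<dots> \<le> (\<Sum>x=2..n. p * (r ^ card (seg f 1 x) / real (card (seg f 1 x))))"
    proof (intro sum_mono)
      fix x assume x: "x \<in> {2..n}"
      have "{(vs, b). ignites f b vs 1 x \<and> M \<le> pos vs x} = {(vs, b). b x \<and> (first_in vs x (seg f 1 x) \<and> M \<le> pos vs x)}"
        using ignites_root_iff[OF f x] by auto
      then have "measure_pmf.prob (decisions p n) {(vs, b). ignites f b vs 1 x \<and> M \<le> pos vs x} =
          p * measure_pmf.prob (random_perm {2..n}) {vs. first_in vs x (seg f 1 x) \<and> M \<le> pos vs x}"
        using prob_mark_and[OF p x] by simp
      also have "\<dots> \<le> p * ((1 - real M / real (card {2..n})) ^ card (seg f 1 x) / real (card (seg f 1 x)))"
        using M p root_seg[OF f x] by (intro mult_left_mono prob_first_in_late) auto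
      also have "1 - real M / real (card {2..n}) = r" using n by (simp add: r_def of_nat_diff)
      finally show "measure_pmf.prob (decisions p n) {(vs, b). ignites f b vs 1 x \<and> M \<le> pos vs x} \<le>
          p * (r ^ card (seg f 1 x) / real (card (seg f 1 x)))" .
    qed
    also have "\<dots> = p * (\<Sum>x=2..n. r ^ card (seg f 1 x) / real (card (seg f 1 x)))"
      by (simp add: sum_distrib_left)
    also have "\<dots> \<le> p * (?a * path_sum r n f 1 + ?b * path_sum (1/2) n f 1)"
    proof (intro mult_left_mono sum_root_path_lengths[OF f r(1), where g = "\<lambda>d. r ^ d / real d"])
      fix d :: nat assume d: "d \<ge> 1"
      have "r ^ d / real d = r ^ d * (1 / real d)" by simp
      also have "\<dots> \<le> r ^ d * (?a + ?b * (1/2) ^ d)"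
        using r d by (intro mult_left_mono inverse_le_split n) auto
      \<comment> \<open>The factor \<open>r ^ d\<close> is kept in the main term and dropped, being
        at most \<open>1\<close>, in the other.\<close>
      also have "\<dots> \<le> ?a * r ^ d + ?b * (1/2) ^ d"
        using r power_le_one[OF r, of d] by (simp add: algebra_simps mult_left_le_one_le)
      finally show "r ^ d / real d \<le> ?a * r ^ d + ?b * (1/2) ^ d" .
    qed (use p a in auto)
    finally show ?thesis .
  qed
  then have "measure_pmf.prob (coupling p n) {(f, vs, b). \<exists>x\<in>{2..n}. ignites f b vs 1 x \<and> M \<le> pos vs x} \<le>
      measure_pmf.expectation (random_parents n) (\<lambda>f. p * (?a * path_sum r n f 1 + ?b * path_sum (1/2) n f 1))"
    unfolding prob_coupling by (intro expectation_mono) auto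
  also have "\<dots> = p * (?a * measure_pmf.expectation (random_parents n) (\<lambda>f. path_sum r n f 1) +
      ?b * measure_pmf.expectation (random_parents n) (\<lambda>f. path_sum (1/2) n f 1))"
    by (simp only: integral_mult_right_zero Bochner_Integration.integral_add integrable_random_parents)
  also have "\<dots> \<le> p * (?a * (2 * real n powr r) + ?b * (2 * real n powr (1/2)))"
    using p a r by (intro mult_left_mono add_mono expectation_root_path_sum[OF n]) auto
  also have "?b * (2 * real n powr (1/2)) = 2 * real n powr (3/4)"
    using n by (simp add: powr_add[symmetric])
  finally show ?thesis by (simp add: r_def)
qed

lemma prob_large_early_subtree:
  assumes M: "M \<le> n - 1" and y: "y > 0"
  shows "measure_pmf.prob (coupling p n) {(f, vs, b). \<exists>u\<in>{2..n}. y < real (card (subtree n f u)) \<and> pos vs u < M} \<le>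
    real M / (real n - 1) * (3 * (real n / y) + 1)"
proof -
  let ?q = "real M / (real n - 1)"
  have q: "0 \<le> ?q" using n by simp
  define a where "a = real n / y"
  have a: "a > 0" using n y by (simp add: a_def)
  define m where "m = nat \<lceil>a\<rceil>"
  have m: "m \<ge> 1" "a \<le> real m" "real m \<le> a + 1"
    using a by (auto simp: m_def Suc_le_eq)
  let ?P = "\<lambda>u. measure_pmf.prob (random_parents n) {f. y < real (card (subtree n f u))}"
  have "measure_pmf.prob (decisions p n) {(vs, b). \<exists>u\<in>{2..n}. y < real (card (subtree n f u)) \<and> pos vs u < M} \<le>
      ?q * (\<Sum>u=2..n. of_bool (y < real (card (subtree n f u))))" for f
  proof -
    have "measure_pmf.prob (decisions p n) {(vs, b). \<exists>u\<in>{2..n}. y < real (card (subtree n f u)) \<and> pos vs u < M} \<le>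
        (\<Sum>u=2..n. measure_pmf.prob (random_perm {2..n}) {vs. y < real (card (subtree n f u)) \<and> pos vs u < M})"
      unfolding prob_decisions_order by (intro prob_union_le) auto
    also have "\<dots> = (\<Sum>u=2..n. ?q * of_bool (y < real (card (subtree n f u))))"
    proof (intro sum.cong refl)
      fix u assume "u \<in> {2..n}"
      then have "measure_pmf.prob (random_perm {2..n}) {vs. pos vs u < M} = ?q"
        using M n by (subst prob_pos_less) (auto simp: of_nat_diff)
      then show "measure_pmf.prob (random_perm {2..n}) {vs. y < real (card (subtree n f u)) \<and> pos vs u < M} =
          ?q * of_bool (y < real (card (subtree n f u)))" by simp
    qed
    finally show ?thesis by (simp only: sum_distrib_left)
  qed
  then have "measure_pmf.prob (coupling p n) {(f, vs, b). \<exists>u\<in>{2..n}. y < real (card (subtree n f u)) \<and> pos vs u < M} \<le>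
      measure_pmf.expectation (random_parents n) (\<lambda>f. ?q * (\<Sum>u=2..n. of_bool (y < real (card (subtree n f u)))))"
    unfolding prob_coupling by (intro expectation_mono) auto
  also have "\<dots> = ?q * (\<Sum>u=2..n. ?P u)"
    unfolding integral_mult_right_zero prob_eq_expectation by (subst expectation_sum) auto
  also have "\<dots> \<le> ?q * (3 * a + 1)"
  proof (intro mult_left_mono q)
    have tail: "?P u \<le> 2 * a\<^sup>2 * (1 / (real u)\<^sup>2)" if "u \<in> {1..n}" for u
    proof -
      let ?N = "\<lambda>f. real (card (subtree n f u))"
      have "?P u \<le> measure_pmf.expectation (random_parents n) (\<lambda>f. (?N f + 1) * ?N f / y\<^sup>2)"
        unfolding prob_eq_expectation
      proof (intro expectation_mono)
        fix f
        show "of_bool (y < ?N f) \<le> (?N f + 1) * ?N f / y\<^sup>2"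
        proof (cases "y < ?N f")
          case True
          then have "y * y \<le> (?N f + 1) * ?N f" using y by (intro mult_mono) auto
          then show ?thesis using True y by (simp add: power2_eq_square)
        qed simp
      qed simp
      also have "\<dots> = measure_pmf.expectation (random_parents n) (\<lambda>f. (?N f + 1) * ?N f) / y\<^sup>2"
        by (rule integral_divide_zero)
      also have "\<dots> \<le> 2 * (real n / real u)\<^sup>2 / y\<^sup>2"
        by (intro divide_right_mono expectation_card_subtree_squared[OF n that]) simp
      also have "\<dots> = 2 * a\<^sup>2 * (1 / (real u)\<^sup>2)" by (simp add: a_def power_divide)
      finally show ?thesis .
    qed
    have "(\<Sum>u=2..n. ?P u) \<le> (\<Sum>u\<in>{1..m} \<union> {Suc m..n}. ?P u)"
      by (intro sum_mono2) auto
    also have "\<dots> = (\<Sum>u=1..m. ?P u) + (\<Sum>u=Suc m..n. ?P u)"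
      by (intro sum.union_disjoint) auto
    also have "\<dots> \<le> (\<Sum>u=1..m. 1) + (\<Sum>u=Suc m..n. 2 * a\<^sup>2 * (1 / (real u)\<^sup>2))"
      using m(1) by (intro add_mono sum_mono tail) auto
    also have "(\<Sum>u=Suc m..n. 2 * a\<^sup>2 * (1 / (real u)\<^sup>2)) = 2 * a\<^sup>2 * (\<Sum>u=Suc m..n. 1 / (real u)\<^sup>2)"
      by (simp only: sum_distrib_left)
    also have "\<dots> \<le> 2 * a\<^sup>2 * (1 / real m)"
      by (intro mult_left_mono sum_inverse_squares_le m) simp
    also have "\<dots> \<le> 2 * a"
    proof -
      have "a * a \<le> a * real m" using m a by (intro mult_left_mono) auto
      then show ?thesis using m(1) by (simp add: power2_eq_square field_simps)
    qed
    finally show "(\<Sum>u=2..n. ?P u) \<le> 3 * a + 1" using m by simp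
  qed
  finally show ?thesis by (simp add: a_def)
qed

text \<open>Given tree and order, the root stays fireproof with probability
  \<open>(1 - p) ^ X\<close>, where \<open>X\<close> counts the \<open>x\<close> that come first on
  their path to the root. Bounding the exponential from below by its tangent at \<open>\<mu>\<close>
  reduces the claim to the fact that the mean of \<open>X\<close> is at most
  \<open>\<mu>\<close>.\<close>

lemma prob_root_fireproof_ge:
  assumes "p \<le> 1/2"
  shows "exp (- 2 * p * (4 * real n / ln (real n) + 2 * real n powr (3/4))) \<le>
    measure_pmf.prob (coupling p n) {(f, vs, b). \<not> (\<exists>x\<in>{2..n}. ignites f b vs 1 x)}"
proof -
  define \<mu> where "\<mu> = 4 * real n / ln (real n) + 2 * real n powr (3/4)"
  define l where "l = - ln (1 - p)"
  \<comment> \<open>From \<open>- ln (1 - p) \<le> p + 2 * p^2\<close>; as \<open>p\<close> is at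
    most \<open>1/2\<close>, the last summand is at most \<open>p\<close>.\<close>
  have l: "0 \<le> l" "l \<le> 2 * p"
  proof -
    show "0 \<le> l" using p assms by (simp add: l_def)
    have "p\<^sup>2 \<le> p * (1/2)" unfolding power2_eq_square using p assms by (intro mult_left_mono) auto
    then show "l \<le> 2 * p" using ln_one_minus_pos_lower_bound[of p] p assms by (simp add: l_def)
  qed
  let ?X = "\<lambda>f vs. {x\<in>{2..n}. first_in vs x (seg f 1 x)}"
  have fin: "finite (set_pmf (random_perm {2..n}))" by simp
  have a: "0 \<le> 4 / ln (real n)" using n by simp
  have EX: "measure_pmf.expectation (random_parents n) (\<lambda>f.
      measure_pmf.expectation (random_perm {2..n}) (\<lambda>vs. real (card (?X f vs)))) \<le> \<mu>"
  proof -
    have "measure_pmf.expectation (random_perm {2..n}) (\<lambda>vs. real (card (?X f vs))) \<le>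
        4 / ln (real n) * path_sum 1 n f 1 + real n powr (1/4) * path_sum (1/2) n f 1"
      if f: "f \<in> parent_funs n" for f
    proof -
      have "measure_pmf.expectation (random_perm {2..n}) (\<lambda>vs. real (card (?X f vs))) =
          measure_pmf.expectation (random_perm {2..n}) (\<lambda>vs. \<Sum>x=2..n. of_bool (first_in vs x (seg f 1 x)))"
        by (simp add: sum_of_bool_eq Int_def)
      also have "\<dots> = (\<Sum>x=2..n. measure_pmf.prob (random_perm {2..n}) {vs. first_in vs x (seg f 1 x)})"
        unfolding prob_eq_expectation by (rule expectation_sum[OF fin])
      also have "\<dots> \<le> (\<Sum>x=2..n. 1 / real (card (seg f 1 x)))"
        using root_seg[OF f] by (intro sum_mono prob_first_in) auto
      also have "\<dots> \<le> 4 / ln (real n) * path_sum 1 n f 1 + real n powr (1/4) * path_sum (1/2) n f 1"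
        using inverse_le_split[OF n] a by (intro sum_root_path_lengths[OF f]) auto
      finally show ?thesis .
    qed
    then have "measure_pmf.expectation (random_parents n) (\<lambda>f.
      measure_pmf.expectation (random_perm {2..n}) (\<lambda>vs. real (card (?X f vs)))) \<le>
      measure_pmf.expectation (random_parents n) (\<lambda>f. 4 / ln (real n) * path_sum 1 n f 1 + real n powr (1/4) * path_sum (1/2) n f 1)"
      by (intro expectation_mono) auto
    also have "\<dots> = measure_pmf.expectation (random_parents n) (\<lambda>f. 4 / ln (real n) * real n + real n powr (1/4) * path_sum (1/2) n f 1)"
      by (intro integral_cong_AE) (auto simp: AE_measure_pmf_iff path_sum_one subtree_root[simplified])
    also have "\<dots> = 4 / ln (real n) * real n + real n powr (1/4) * measure_pmf.expectation (random_parents n) (\<lambda>f. path_sum (1/2) n f 1)"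
      by simp
    also have "\<dots> \<le> 4 / ln (real n) * real n + real n powr (1/4) * (2 * real n powr (1/2))"
      by (intro add_left_mono mult_left_mono expectation_root_path_sum[OF n]) auto
    also have "\<dots> = \<mu>" using n by (simp add: \<mu>_def powr_add[symmetric])
    finally show ?thesis .
  qed
  have "exp (- 2 * p * \<mu>) \<le> exp (- l * \<mu>)"
  proof -
    have "0 \<le> \<mu>" using n by (simp add: \<mu>_def)
    then have "l * \<mu> \<le> 2 * p * \<mu>" using l by (intro mult_right_mono) auto
    then show ?thesis by simp
  qed
  \<comment> \<open>Since the mean of \<open>X\<close> is at most \<open>\<mu>\<close> and
    \<open>l\<close> is nonnegative, the inserted factor is at least \<open>1\<close>.\<close>
  also have "\<dots> \<le> exp (- l * \<mu>) * (1 - l * (measure_pmf.expectation (random_parents n) (\<lambda>f.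
      measure_pmf.expectation (random_perm {2..n}) (\<lambda>vs. real (card (?X f vs)))) - \<mu>))"
    (is "_ \<le> exp (- l * \<mu>) * (1 - ?z)")
  proof -
    have "?z \<le> 0" using l(1) EX by (intro mult_nonneg_nonpos) auto
    then have "exp (- l * \<mu>) * 1 \<le> exp (- l * \<mu>) * (1 - ?z)" by (intro mult_left_mono) (linarith, simp)
    then show ?thesis by (simp only: mult_1_right)
  qed
  also have "\<dots> = measure_pmf.expectation (random_parents n) (\<lambda>f.
      measure_pmf.expectation (random_perm {2..n}) (\<lambda>vs. exp (- l * \<mu>) * (1 - l * (real (card (?X f vs)) - \<mu>))))"
    by (simp only: expectation_affine[OF fin] expectation_affine[of "random_parents n"]
        set_random_parents finite_parent_funs)
  also have "\<dots> \<le> measure_pmf.expectation (random_parents n) (\<lambda>f.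
      measure_pmf.prob (decisions p n) {(vs, b). \<not> (\<exists>x\<in>{2..n}. ignites f b vs 1 x)})"
  proof (intro expectation_mono)
    fix f assume "f \<in> set_pmf (random_parents n)"
    then have f: "f \<in> parent_funs n" by simp
    show "measure_pmf.expectation (random_perm {2..n}) (\<lambda>vs. exp (- l * \<mu>) * (1 - l * (real (card (?X f vs)) - \<mu>))) \<le>
      measure_pmf.prob (decisions p n) {(vs, b). \<not> (\<exists>x\<in>{2..n}. ignites f b vs 1 x)}"
      unfolding prob_decisions
    proof (intro expectation_mono fin)
      fix vs
      have "exp (- l * \<mu>) * (1 - l * (real (card (?X f vs)) - \<mu>)) \<le> exp (- l * \<mu>) * exp (- l * (real (card (?X f vs)) - \<mu>))"
        using exp_ge_add_one_self[of "- l * (real (card (?X f vs)) - \<mu>)"] by (intro mult_left_mono) auto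
      also have "\<dots> = exp (- l) ^ card (?X f vs)"
        by (simp add: exp_add[symmetric] exp_of_nat_mult[symmetric] algebra_simps)
      also have "exp (- l) = 1 - p" using p assms by (simp add: l_def)
      also have "(1 - p) ^ card (?X f vs) = measure_pmf.prob (marks p n) {b. \<forall>x\<in>?X f vs. \<not> b x}"
        by (intro prob_no_mark[OF p, symmetric]) auto
      also have "{b. \<forall>x\<in>?X f vs. \<not> b x} = {b. \<not> (\<exists>x\<in>{2..n}. ignites f b vs 1 x)}"
        using ignites_root_iff[OF f] by auto
      finally show "exp (- l * \<mu>) * (1 - l * (real (card (?X f vs)) - \<mu>)) \<le>
        measure_pmf.prob (marks p n) {b. \<not> (\<exists>x\<in>{2..n}. ignites f b vs 1 x)}" .
    qed
  qed simp
  finally show ?thesis by (simp add: \<mu>_def prob_coupling)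
qed

text \<open>\<open>?R\<close> collects the \<open>x\<close> among the first \<open>M\<close> edges
  whose path to the root has no other edge among these. Each is first on its path, so one burning
  mark on \<open>?R\<close> suffices to burn the root. A union bound over the other edges of the
  path shows that the mean size of \<open>?R\<close> is at least \<open>M\<close> minus
  \<open>(M / (n - 1))^2\<close> times the total depth, and the mean total depth is at most
  \<open>3 / 2 * n * ln n\<close>.\<close>

lemma prob_root_burns_ge:
  assumes M: "M \<le> n - 1"
  shows "p * (real M - (real M / (real n - 1))\<^sup>2 * (3 / 2 * real n * ln (real n))) / (1 + p * real M) \<le>
    measure_pmf.prob (coupling p n) {(f, vs, b). \<exists>x\<in>{2..n}. ignites f b vs 1 x}"
proof -
  let ?q = "real M / (real n - 1)"
  let ?R = "\<lambda>f vs. {x\<in>{2..n}. pos vs x < M \<and> (\<forall>y\<in>seg f 1 x. y \<noteq> x \<longrightarrow> \<not> pos vs y < M)}"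
  have fin: "finite (set_pmf (random_perm {2..n}))" by simp
  have cardA: "real (card {2..n}) = real n - 1" using n by (simp add: of_nat_diff)
  let ?P = "measure_pmf.prob (random_perm {2..n})"
  have ER: "real M - ?q\<^sup>2 * (\<Sum>t=2..n. real (card (subtree n f t))) \<le>
      measure_pmf.expectation (random_perm {2..n}) (\<lambda>vs. real (card (?R f vs)))"
    if f: "f \<in> parent_funs n" for f
  proof -
    \<comment> \<open>The total depth equals the total size of the subtrees of \<open>2..n\<close>:
      pairs of ancestor and descendant are counted in both orders.\<close>
    have "(\<Sum>x=2..n. real (card (seg f 1 x))) = (\<Sum>x=2..n. \<Sum>t=2..n. of_bool (t \<in> anc f x))"
    proof (intro sum.cong refl)
      fix x assume x: "x \<in> {2..n}"
      have "seg f 1 x = {t\<in>{2..n}. t \<in> anc f x}"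
        using root_seg(1)[OF f x] by (auto simp: seg_def)
      then show "real (card (seg f 1 x)) = (\<Sum>t=2..n. of_bool (t \<in> anc f x))"
        by (simp add: sum_of_bool_eq Int_def)
    qed
    also have "\<dots> = (\<Sum>t=2..n. \<Sum>x=2..n. of_bool (t \<in> anc f x))" by (rule sum.swap)
    also have "\<dots> = (\<Sum>t=2..n. real (card (subtree n f t)))"
    proof (intro sum.cong refl)
      fix t assume t: "t \<in> {2..n}"
      have "subtree n f t = {x\<in>{2..n}. t \<in> anc f x}"
        using t by (auto simp: subtree_def dest: anc_le)
      then show "(\<Sum>x=2..n. of_bool (t \<in> anc f x)) = real (card (subtree n f t))"
        by (simp add: sum_of_bool_eq Int_def)
    qed
    finally have swap: "(\<Sum>x=2..n. real (card (seg f 1 x))) = (\<Sum>t=2..n. real (card (subtree n f t)))" .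
    have "real M - ?q\<^sup>2 * (\<Sum>t=2..n. real (card (subtree n f t))) = (\<Sum>x=2..n. ?q - real (card (seg f 1 x)) * ?q\<^sup>2)"
    proof -
      have "(\<Sum>x=2..n. ?q) = real M" using n cardA by simp
      then show ?thesis by (simp add: sum_subtractf swap[symmetric] sum_distrib_left mult.commute)
    qed
    also have "\<dots> \<le> (\<Sum>x=2..n. ?P {vs. pos vs x < M \<and> (\<forall>y\<in>seg f 1 x. y \<noteq> x \<longrightarrow> \<not> pos vs y < M)})"
    proof (intro sum_mono)
      fix x assume x: "x \<in> {2..n}"
      let ?S = "seg f 1 x - {x}"
      have "?q = ?P {vs. pos vs x < M}" using x M cardA by (subst prob_pos_less) auto
      also have "\<dots> \<le> ?P ({vs. pos vs x < M \<and> (\<forall>y\<in>seg f 1 x. y \<noteq> x \<longrightarrow> \<not> pos vs y < M)} \<union>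
          {vs. \<exists>y\<in>?S. pos vs x < M \<and> pos vs y < M})"
        by (intro measure_pmf.finite_measure_mono) auto
      also have "\<dots> \<le> ?P {vs. pos vs x < M \<and> (\<forall>y\<in>seg f 1 x. y \<noteq> x \<longrightarrow> \<not> pos vs y < M)} +
          ?P {vs. \<exists>y\<in>?S. pos vs x < M \<and> pos vs y < M}"
        by (intro measure_Un_le) auto
      also have "?P {vs. \<exists>y\<in>?S. pos vs x < M \<and> pos vs y < M} \<le> (\<Sum>y\<in>?S. ?P {vs. pos vs x < M \<and> pos vs y < M})"
        by (intro prob_union_le fin) auto
      also have "\<dots> \<le> (\<Sum>y\<in>?S. ?q\<^sup>2)"
      proof (intro sum_mono)
        fix y assume y: "y \<in> ?S"
        then have "?P {vs. pos vs x < M \<and> pos vs y < M} \<le> (real M / real (card {2..n}))\<^sup>2"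
          using root_seg(1)[OF f x] x M by (intro prob_pos_less_two) auto
        then show "?P {vs. pos vs x < M \<and> pos vs y < M} \<le> ?q\<^sup>2" unfolding cardA .
      qed
      also have "\<dots> \<le> (\<Sum>y\<in>seg f 1 x. ?q\<^sup>2)" by (intro sum_mono2) auto
      finally show "?q - real (card (seg f 1 x)) * ?q\<^sup>2 \<le>
          ?P {vs. pos vs x < M \<and> (\<forall>y\<in>seg f 1 x. y \<noteq> x \<longrightarrow> \<not> pos vs y < M)}" by simp
    qed
    also have "\<dots> = measure_pmf.expectation (random_perm {2..n}) (\<lambda>vs. \<Sum>x=2..n.
        of_bool (pos vs x < M \<and> (\<forall>y\<in>seg f 1 x. y \<noteq> x \<longrightarrow> \<not> pos vs y < M)))"
      unfolding prob_eq_expectation by (rule expectation_sum[OF fin, symmetric])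
    also have "\<dots> = measure_pmf.expectation (random_perm {2..n}) (\<lambda>vs. real (card (?R f vs)))"
      by (simp add: sum_of_bool_eq Int_def)
    finally show ?thesis .
  qed
  have "p * (real M - ?q\<^sup>2 * (3 / 2 * real n * ln (real n))) / (1 + p * real M) \<le>
      p * (real M - ?q\<^sup>2 * (\<Sum>t=2..n. measure_pmf.expectation (random_parents n) (\<lambda>f. real (card (subtree n f t))))) / (1 + p * real M)"
  proof (intro divide_right_mono mult_left_mono diff_left_mono)
    have "(\<Sum>t=2..n. measure_pmf.expectation (random_parents n) (\<lambda>f. real (card (subtree n f t)))) \<le>
        (\<Sum>t=2..n. 3 / 2 * real n * (1 / real t))"
      using expectation_card_subtree[OF n] by (intro sum_mono) auto
    also have "\<dots> = 3 / 2 * real n * (\<Sum>t=2..n. 1 / real t)" by (simp only: sum_distrib_left)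
    also have "\<dots> \<le> 3 / 2 * real n * ln (real n)"
      using n by (intro mult_left_mono harmonic_le_ln) auto
    finally show "(\<Sum>t=2..n. measure_pmf.expectation (random_parents n) (\<lambda>f. real (card (subtree n f t)))) \<le>
        3 / 2 * real n * ln (real n)" .
  qed (use p in auto)
  also have "\<dots> = measure_pmf.expectation (random_parents n) (\<lambda>f.
      p * (real M - ?q\<^sup>2 * (\<Sum>t=2..n. real (card (subtree n f t)))) / (1 + p * real M))"
    by simp
  also have "\<dots> \<le> measure_pmf.expectation (random_parents n) (\<lambda>f.
      measure_pmf.expectation (random_perm {2..n}) (\<lambda>vs. p * real (card (?R f vs)) / (1 + p * real M)))"
  proof (intro expectation_mono)
    fix f assume "f \<in> set_pmf (random_parents n)"
    then have f: "f \<in> parent_funs n" by simp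
    have "p * (real M - ?q\<^sup>2 * (\<Sum>t=2..n. real (card (subtree n f t)))) / (1 + p * real M) \<le>
        p * measure_pmf.expectation (random_perm {2..n}) (\<lambda>vs. real (card (?R f vs))) / (1 + p * real M)"
      using p by (intro divide_right_mono mult_left_mono ER[OF f]) auto
    then show "p * (real M - ?q\<^sup>2 * (\<Sum>t=2..n. real (card (subtree n f t)))) / (1 + p * real M) \<le>
        measure_pmf.expectation (random_perm {2..n}) (\<lambda>vs. p * real (card (?R f vs)) / (1 + p * real M))"
      by simp
  qed simp
  also have "\<dots> \<le> measure_pmf.prob (coupling p n) {(f, vs, b). \<exists>x\<in>{2..n}. ignites f b vs 1 x}"
    unfolding prob_coupling prob_decisions
  proof (intro expectation_mono fin)
    fix f vs assume "f \<in> set_pmf (random_parents n)" "vs \<in> set_pmf (random_perm {2..n})"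
    then have f: "f \<in> parent_funs n" and vs: "vs \<in> permutations_of_set {2..n}" by auto
    have "card (?R f vs) \<le> card {x\<in>{2..n}. pos vs x < M}" by (intro card_mono) auto
    also have "\<dots> = M" using vs M by (intro card_pos_less) auto
    finally have RM: "real (card (?R f vs)) \<le> real M" by simp
    \<comment> \<open>The count is at most \<open>M\<close>; putting \<open>M\<close> in the
      denominator leaves an expression linear in the count, whose mean is controlled by
      \<open>ER\<close>.\<close>
    have "p * real (card (?R f vs)) / (1 + p * real M) \<le> p * real (card (?R f vs)) / (1 + p * real (card (?R f vs)))"
      using p RM by (intro divide_left_mono add_left_mono mult_left_mono mult_pos_pos add_pos_nonneg) auto
    also have "\<dots> \<le> 1 - (1 - p) ^ card (?R f vs)" by (rule one_minus_power_ge[OF p])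
    also have "(1 - p) ^ card (?R f vs) = measure_pmf.prob (marks p n) {b. \<forall>x\<in>?R f vs. \<not> b x}"
      by (intro prob_no_mark[OF p, symmetric]) auto
    also have "1 - \<dots> = measure_pmf.prob (marks p n) (UNIV - {b. \<forall>x\<in>?R f vs. \<not> b x})"
      using measure_pmf.prob_compl[of "{b. \<forall>x\<in>?R f vs. \<not> b x}" "marks p n"] by simp
    also have "\<dots> \<le> measure_pmf.prob (marks p n) {b. \<exists>x\<in>{2..n}. ignites f b vs 1 x}"
    proof (intro measure_pmf.finite_measure_mono subsetI)
      fix b assume "b \<in> UNIV - {b. \<forall>x\<in>?R f vs. \<not> b x}"
      then obtain x where x: "x \<in> ?R f vs" "b x" by auto
      have "first_in vs x (seg f 1 x)"
        unfolding first_in_def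
      proof (intro ballI impI)
        fix y assume "y \<in> seg f 1 x" "y \<noteq> x"
        then have "\<not> pos vs y < M" using x(1) by blast
        then show "pos vs x < pos vs y" using x(1) by auto
      qed
      then show "b \<in> {b. \<exists>x\<in>{2..n}. ignites f b vs 1 x}"
        using x ignites_root_iff[OF f, of x] by (auto intro!: bexI[of _ x])
    qed simp
    finally show "p * real (card (?R f vs)) / (1 + p * real M) \<le>
        measure_pmf.prob (marks p n) {b. \<exists>x\<in>{2..n}. ignites f b vs 1 x}" .
  qed simp
  finally show ?thesis .
qed

end

section \<open>Transfer to the law of the dynamics\<close>

lemma prob_mono_support:
  assumes "finite (set_pmf M)" "\<And>\<omega>. \<omega> \<in> set_pmf M \<Longrightarrow> P \<omega> \<Longrightarrow> Q \<omega>"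
  shows "measure_pmf.prob M {\<omega>. P \<omega>} \<le> measure_pmf.prob M {\<omega>. Q \<omega>}"
  unfolding prob_eq_expectation using assms by (intro expectation_mono) auto

lemma prob_coupling_mono:
  assumes "\<And>f vs b. f \<in> parent_funs n \<Longrightarrow> vs \<in> permutations_of_set {2..n} \<Longrightarrow> P f vs b \<Longrightarrow> Q f vs b"
  shows "measure_pmf.prob (coupling p n) {(f, vs, b). P f vs b} \<le> measure_pmf.prob (coupling p n) {(f, vs, b). Q f vs b}"
  using assms set_coupling by (intro prob_mono_support) auto

lemma prob_fire_on_rrt:
  assumes "n \<ge> 1"
  shows "measure_pmf.prob (fire_on_rrt p n) {(E, s). Q E s} =
    measure_pmf.prob (coupling p n) {(f, vs, b). Q (parent_tree n f) (fire_state n f b vs)}"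
  unfolding fire_on_rrt_eq[OF assms] measure_map_pmf
  by (intro arg_cong[where f = "measure_pmf.prob _"]) auto

lemma prob_root_burns:
  assumes "n \<ge> 1"
  shows "measure_pmf.prob (fire_on_rrt p n) {(E, s). \<not> fireproof_vertex E s 1} =
    measure_pmf.prob (coupling p n) {(f, vs, b). \<exists>x\<in>{2..n}. ignites f b vs 1 x}"
  unfolding prob_fire_on_rrt[OF assms]
  using root_burns_iff[OF _ _ assms] by (intro antisym prob_coupling_mono) auto

lemma prob_root_fireproof:
  assumes "n \<ge> 1"
  shows "measure_pmf.prob (fire_on_rrt p n) {(E, s). fireproof_vertex E s 1} =
    measure_pmf.prob (coupling p n) {(f, vs, b). \<not> (\<exists>x\<in>{2..n}. ignites f b vs 1 x)}"
  unfolding prob_fire_on_rrt[OF assms]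
proof (intro antisym prob_coupling_mono)
  fix f vs b assume fv: "f \<in> parent_funs n" "vs \<in> permutations_of_set {2..n}"
  note iff = root_burns_iff[OF fv assms, of b]
  show "\<not> (\<exists>x\<in>{2..n}. ignites f b vs 1 x)" if "fireproof_vertex (parent_tree n f) (fire_state n f b vs) 1"
    using that iff by blast
  show "fireproof_vertex (parent_tree n f) (fire_state n f b vs) 1" if "\<not> (\<exists>x\<in>{2..n}. ignites f b vs 1 x)"
    using that iff by blast
qed

lemma prob_cond_pmf:
  assumes "measure_pmf.prob M S > 0"
  shows "measure_pmf.prob (cond_pmf M S) A = measure_pmf.prob M (S \<inter> A) / measure_pmf.prob M S"
proof -
  have "set_pmf M \<inter> S \<noteq> {}"
    using assms measure_pmf_zero_iff[of M S] by auto
  moreover have "emeasure (measure_pmf M) S \<noteq> 0"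
    using assms by (simp add: measure_pmf.emeasure_eq_measure)
  ultimately show ?thesis by (simp add: cond_pmf.rep_eq)
qed

context
  fixes n :: nat and p :: real
  assumes n: "n \<ge> 2" and p: "0 \<le> p" "p \<le> 1"
begin

definition burnt_below :: "(nat \<Rightarrow> nat) \<times> nat list \<times> (nat \<Rightarrow> bool) \<Rightarrow> real" where
  "burnt_below = (\<lambda>(f, vs, b). \<Sum>t | t \<in> {2..n} \<and> (\<exists>x\<in>{2..n}. ignites f b vs t x). real (card (subtree n f t)))"

lemma prob_burnt_below:
  assumes "y > 0"
  shows "measure_pmf.prob (coupling p n) {\<omega>. y \<le> burnt_below \<omega>} \<le>
    p * (32 * (real n / ln (real n))\<^sup>2 + 2 * real n powr (7/4) * ln (real n)) / y"
proof -
  have "measure_pmf.prob (coupling p n) {\<omega>. y \<le> burnt_below \<omega>} \<le> measure_pmf.expectation (coupling p n) burnt_below / y"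
    using assms by (intro markov_pmf) (auto simp: burnt_below_def intro!: sum_nonneg)
  also have "\<dots> \<le> p * (32 * (real n / ln (real n))\<^sup>2 + 2 * real n powr (7/4) * ln (real n)) / y"
    using assms expectation_burnt_below[OF n p] by (intro divide_right_mono) (auto simp: burnt_below_def)
  finally show ?thesis .
qed

text \<open>The three summands bound the three cases of \<open>largest_fireproof_root_burnt\<close>,
  in that order.\<close>

lemma prob_root_burns_large_fireproof:
  assumes y: "y > 0" and M: "M \<le> n - 1"
  shows "measure_pmf.prob (fire_on_rrt p n) {(E, s). \<not> fireproof_vertex E s 1 \<and> y < real (largest_fireproof n E s)} \<le>
    real M / (real n - 1) * (3 * (real n / y) + 1) +
    p * (8 / ln (real n) * real n powr (1 - real M / (real n - 1)) + 2 * real n powr (3/4)) +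
    p * (32 * (real n / ln (real n))\<^sup>2 + 2 * real n powr (7/4) * ln (real n)) / y"
proof -
  let ?P = "measure_pmf.prob (coupling p n)"
  let ?A = "{(f, vs, b). \<exists>u\<in>{2..n}. y < real (card (subtree n f u)) \<and> pos vs u < M}"
  let ?B = "{(f, vs, b). \<exists>x\<in>{2..n}. ignites f b vs 1 x \<and> M \<le> pos vs x}"
  let ?C = "{\<omega>. y \<le> burnt_below \<omega>}"
  have n1: "n \<ge> 1" using n by simp
  have "measure_pmf.prob (fire_on_rrt p n) {(E, s). \<not> fireproof_vertex E s 1 \<and> y < real (largest_fireproof n E s)}
    \<le> ?P {(f, vs, b). (f, vs, b) \<in> ?A \<union> ?B \<union> ?C}"
    unfolding prob_fire_on_rrt[OF n1]
  proof (intro prob_coupling_mono, elim conjE)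
    fix f vs b
    assume fv: "f \<in> parent_funs n" "vs \<in> permutations_of_set {2..n}"
      and root: "\<not> fireproof_vertex (parent_tree n f) (fire_state n f b vs) 1"
      and large: "y < real (largest_fireproof n (parent_tree n f) (fire_state n f b vs))"
    consider "\<exists>u\<in>{2..n}. y < real (card (subtree n f u)) \<and> pos vs u < M"
      | "\<exists>x\<in>{2..n}. ignites f b vs 1 x \<and> M \<le> pos vs x"
      | t where "t \<in> {2..n}" "\<exists>x\<in>{2..n}. ignites f b vs t x" "y < real (card (subtree n f t))"
      using largest_fireproof_root_burnt[OF fv root _ large, of M] y by fastforce
    then show "(f, vs, b) \<in> ?A \<union> ?B \<union> ?C"
    proof cases
      \<comment> \<open>One large subtree alone already lifts \<open>burnt_below\<close> to
        \<open>y\<close>.\<close>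
      case 3
      have "real (card (subtree n f t)) \<le> burnt_below (f, vs, b)"
        unfolding burnt_below_def prod.case using 3 by (intro member_le_sum) auto
      then show ?thesis using 3 by simp
    qed auto
  qed
  also have "{(f, vs, b). (f, vs, b) \<in> ?A \<union> ?B \<union> ?C} = ?A \<union> ?B \<union> ?C" by auto
  also have "?P (?A \<union> ?B \<union> ?C) \<le> ?P ?A + ?P ?B + ?P ?C"
    by (intro order.trans[OF measure_Un_le] add_right_mono measure_Un_le) auto
  also have "\<dots> \<le> real M / (real n - 1) * (3 * (real n / y) + 1) +
    p * (8 / ln (real n) * real n powr (1 - real M / (real n - 1)) + 2 * real n powr (3/4)) +
    p * (32 * (real n / ln (real n))\<^sup>2 + 2 * real n powr (7/4) * ln (real n)) / y"
    by (intro add_mono prob_large_early_subtree[OF n p M y] prob_late_root_fire[OF n p M] prob_burnt_below y)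
  finally show ?thesis .
qed

lemma prob_root_fireproof_not_giant:
  assumes e: "\<epsilon> > 0"
  shows "measure_pmf.prob (fire_on_rrt p n)
      {(E, s). fireproof_vertex E s 1 \<and> \<epsilon> < \<bar>real (largest_fireproof n E s) / real n - 1\<bar>} \<le>
    p * (32 * (real n / ln (real n))\<^sup>2 + 2 * real n powr (7/4) * ln (real n)) / (\<epsilon> * real n)"
proof -
  have n1: "n \<ge> 1" using n by simp
  have "measure_pmf.prob (fire_on_rrt p n)
      {(E, s). fireproof_vertex E s 1 \<and> \<epsilon> < \<bar>real (largest_fireproof n E s) / real n - 1\<bar>} \<le>
      measure_pmf.prob (coupling p n) {(f, vs, b). \<epsilon> * real n \<le> burnt_below (f, vs, b)}"
    unfolding prob_fire_on_rrt[OF n1]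
  proof (intro prob_coupling_mono, elim conjE)
    fix f vs b
    let ?l = "largest_fireproof n (parent_tree n f) (fire_state n f b vs)"
    assume fv: "f \<in> parent_funs n" "vs \<in> permutations_of_set {2..n}"
      and root: "fireproof_vertex (parent_tree n f) (fire_state n f b vs) 1"
      and gap: "\<epsilon> < \<bar>real ?l / real n - 1\<bar>"
    have "real n \<le> real (?l + (\<Sum>t | t \<in> {2..n} \<and> (\<exists>x\<in>{2..n}. ignites f b vs t x). card (subtree n f t)))"
      using largest_fireproof_root_fireproof[OF fv n1 root] by (rule of_nat_mono)
    then have "real n \<le> real ?l + burnt_below (f, vs, b)" by (simp add: burnt_below_def)
    moreover have "\<epsilon> * real n < real n - real ?l"
    proof -
      have "real ?l \<le> real n" using largest_fireproof_le by simp
      then have "\<bar>real ?l / real n - 1\<bar> = (real n - real ?l) / real n"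
        using n by (simp add: field_simps)
      then show ?thesis using gap n by (simp add: field_simps)
    qed
    ultimately show "\<epsilon> * real n \<le> burnt_below (f, vs, b)" by linarith
  qed
  also have "{(f, vs, b). \<epsilon> * real n \<le> burnt_below (f, vs, b)} = {\<omega>. \<epsilon> * real n \<le> burnt_below \<omega>}"
    by auto
  also have "measure_pmf.prob (coupling p n) \<dots> \<le>
      p * (32 * (real n / ln (real n))\<^sup>2 + 2 * real n powr (7/4) * ln (real n)) / (\<epsilon> * real n)"
    using e n by (intro prob_burnt_below) simp
  finally show ?thesis .
qed

end

section \<open>The critical regime\<close>

text \<open>\<open>tight\<close> asks for one interval valid for every \<open>k\<close>. Each single
  law has its own bound, so the finitely many indices not covered by \<open>ev\<close> are absorbed
  by a maximum. The left end is \<open>-1\<close> because the interval is open there and the value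
  \<open>0\<close> may occur.\<close>

lemma tight_distrI:
  fixes M :: "nat \<Rightarrow> 'a pmf" and X :: "nat \<Rightarrow> 'a \<Rightarrow> real"
  assumes nonneg: "\<And>k \<omega>. 0 \<le> X k \<omega>"
    and ev: "\<And>\<epsilon>. \<epsilon> > 0 \<Longrightarrow> \<exists>b. \<forall>\<^sub>F k in sequentially. measure_pmf.prob (M k) {\<omega>. b < X k \<omega>} < \<epsilon>"
  shows "tight (\<lambda>k. distr (measure_pmf (M k)) borel (X k))"
proof -
  let ?\<mu> = "\<lambda>k. distr (measure_pmf (M k)) borel (X k)"
  have rd: "real_distribution (?\<mu> k)" for k
    by (intro prob_space.real_distribution_distr measure_pmf.prob_space_axioms) simp
  have compl: "measure (?\<mu> k) {-1<..b} = 1 - measure_pmf.prob (M k) {\<omega>. b < X k \<omega>}" for k b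
  proof -
    have "-1 < X k \<omega>" for \<omega> using nonneg[of k \<omega>] by linarith
    then have "X k -` {-1<..b} = UNIV - {\<omega>. b < X k \<omega>}" by auto
    then have "measure (?\<mu> k) {-1<..b} = measure_pmf.prob (M k) (UNIV - {\<omega>. b < X k \<omega>})"
      by (subst measure_distr) auto
    then show ?thesis using measure_pmf.prob_compl[of "{\<omega>. b < X k \<omega>}" "M k"] by simp
  qed
  have each: "\<exists>b. measure_pmf.prob (M k) {\<omega>. b < X k \<omega>} < \<epsilon>" if "\<epsilon> > 0" for k \<epsilon>
  proof -
    interpret D: real_distribution "?\<mu> k" by (rule rd)
    have "\<forall>\<^sub>F x in at_top. cdf (?\<mu> k) x > 1 - \<epsilon>"
      using D.cdf_lim_at_top_prob that by (intro order_tendstoD) auto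
    then obtain b where "cdf (?\<mu> k) b > 1 - \<epsilon>" by (metis eventually_happens trivial_limit_at_top_linorder)
    moreover have "cdf (?\<mu> k) b = measure_pmf.prob (M k) (UNIV - {\<omega>. b < X k \<omega>})"
      unfolding cdf_def2 by (subst measure_distr) (auto intro!: arg_cong[where f = "measure_pmf.prob _"])
    ultimately show ?thesis
      using measure_pmf.prob_compl[of "{\<omega>. b < X k \<omega>}" "M k"] by (intro exI[of _ b]) simp
  qed
  have "\<exists>a b. a < b \<and> (\<forall>k. measure (?\<mu> k) {a<..b} > 1 - \<epsilon>)" if e: "\<epsilon> > 0" for \<epsilon>
  proof -
    obtain b0 N where b0: "\<And>k. k \<ge> N \<Longrightarrow> measure_pmf.prob (M k) {\<omega>. b0 < X k \<omega>} < \<epsilon>"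
      using ev[OF e] by (auto simp: eventually_sequentially)
    obtain b1 where b1: "\<And>k. measure_pmf.prob (M k) {\<omega>. b1 k < X k \<omega>} < \<epsilon>"
      using each[OF e] by metis
    define b where "b = Max (insert 0 (insert b0 (b1 ` {..<N})))"
    have b: "0 \<le> b" "b0 \<le> b" "\<And>k. k < N \<Longrightarrow> b1 k \<le> b" unfolding b_def by (auto intro!: Max_ge simp del: Max_insert)
    have "measure_pmf.prob (M k) {\<omega>. b < X k \<omega>} < \<epsilon>" for k
    proof (cases "k < N")
      case True
      have "measure_pmf.prob (M k) {\<omega>. b < X k \<omega>} \<le> measure_pmf.prob (M k) {\<omega>. b1 k < X k \<omega>}"
        using b(3)[OF True] by (intro measure_pmf.finite_measure_mono) auto
      then show ?thesis using b1[of k] by linarith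
    next
      case False
      have "measure_pmf.prob (M k) {\<omega>. b < X k \<omega>} \<le> measure_pmf.prob (M k) {\<omega>. b0 < X k \<omega>}"
        using b(2) by (intro measure_pmf.finite_measure_mono) auto
      then show ?thesis using b0[of k] False by linarith
    qed
    then show ?thesis using b(1) by (intro exI[of _ "-1"] exI[of _ b]) (simp add: compl)
  qed
  then show ?thesis unfolding tight_def using rd by auto
qed

context
  fixes c :: real and p :: "nat \<Rightarrow> real"
  assumes c: "c > 0"
    and p: "\<And>n. n \<ge> 1 \<Longrightarrow> 0 \<le> p n \<and> p n \<le> 1"
    and asymp: "p \<sim>[at_top] (\<lambda>n. c * ln (real n) / real n)"
begin

lemma critical_bounds:
  "\<forall>\<^sub>F n in sequentially. c / 2 * (ln (real n) / real n) \<le> p n \<and> p n \<le> 2 * c * (ln (real n) / real n)"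
proof -
  let ?g = "\<lambda>n. c * ln (real n) / real n"
  \<comment> \<open>The case distinction comes from the definition of asymptotic equivalence, which
    reads \<open>0 / 0\<close> as \<open>1\<close>; from \<open>n = 2\<close> on the reference
    function is positive.\<close>
  have "(\<lambda>n. if p n = 0 \<and> ?g n = 0 then 1 else p n / ?g n) \<longlonglongrightarrow> 1"
    by (rule asymp_equivD[OF asymp])
  then have "\<forall>\<^sub>F n in sequentially. 1/2 < (if p n = 0 \<and> ?g n = 0 then 1 else p n / ?g n)"
    "\<forall>\<^sub>F n in sequentially. (if p n = 0 \<and> ?g n = 0 then 1 else p n / ?g n) < 2"
    by (rule order_tendstoD, simp)+
  with eventually_ge_at_top[of "2::nat"] show ?thesis
  proof eventually_elim
    case (elim n)
    have g: "?g n > 0" using c elim(1) by simp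
    then have "1/2 < p n / ?g n" "p n / ?g n < 2" using elim by (auto split: if_splits)
    then have "1/2 * ?g n < p n" "p n < 2 * ?g n"
      by (simp_all only: pos_less_divide_eq[OF g] pos_divide_less_eq[OF g])
    then show ?case by simp
  qed
qed

lemma eventually_p_le: "\<delta> > 0 \<Longrightarrow> \<forall>\<^sub>F n in sequentially. p n \<le> \<delta>"
proof -
  assume d: "\<delta> > 0"
  have "(\<lambda>n. ln (real n) / real n) \<longlonglongrightarrow> 0" by real_asymp
  then have "\<forall>\<^sub>F n in sequentially. ln (real n) / real n < \<delta> / (2 * c)"
    using d c by (intro order_tendstoD) auto
  with critical_bounds show "\<forall>\<^sub>F n in sequentially. p n \<le> \<delta>"
  proof eventually_elim
    case (elim n)
    have "2 * c * (ln (real n) / real n) \<le> \<delta>" using elim(2) c by (simp add: field_simps)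
    then show ?case using elim by linarith
  qed
qed

text \<open>\<open>M\<close> is taken near \<open>n / (4 ln n)\<close>: small enough for the
  correction in \<open>prob_root_burns_ge\<close> to remove at most half of \<open>M\<close>, large
  enough for \<open>p n * M\<close> to stay above \<open>c / 16\<close>.\<close>

lemma eventually_root_burns_ge:
  "\<exists>q>0. \<forall>\<^sub>F n in sequentially. q \<le> measure_pmf.prob (fire_on_rrt (p n) n) {(E, s). \<not> fireproof_vertex E s 1}"
proof -
  \<comment> \<open>The map sending \<open>v\<close> to \<open>v / 2 / (1 + v)\<close> is
    increasing; \<open>q\<close> is its value at the lower bound \<open>c / 16\<close> of
    \<open>p n * M\<close>.\<close>
  define q where "q = (c / 16) / 2 / (1 + c / 16)"
  have "(\<lambda>n. ln (real n) / real n) \<longlonglongrightarrow> 0" by real_asymp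
  then have "\<forall>\<^sub>F n in sequentially. ln (real n) / real n < 1/8"
    by (rule order_tendstoD) simp
  moreover have "filterlim (\<lambda>n. ln (real n)) at_top sequentially" by real_asymp
  then have "\<forall>\<^sub>F n in sequentially. 1 \<le> ln (real n)" by (simp add: filterlim_at_top)
  ultimately have "\<forall>\<^sub>F n in sequentially. q \<le> measure_pmf.prob (fire_on_rrt (p n) n) {(E, s). \<not> fireproof_vertex E s 1}"
    using critical_bounds eventually_ge_at_top[of "8::nat"]
  proof eventually_elim
    case (elim n)
    let ?L = "ln (real n)"
    have n: "n \<ge> 2" "n \<ge> 1" "real n \<ge> 8" and L: "?L \<ge> 1" using elim by auto
    have pn: "0 \<le> p n" "p n \<le> 1" using p n by auto
    define a where "a = real n / (4 * ?L)"
    have a: "0 \<le> a" "a \<le> real n / 4" using n L by (auto simp: a_def field_simps)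
    define M where "M = nat \<lfloor>a\<rfloor>"
    have M: "real M \<le> a" "a - 1 \<le> real M" using a by (auto simp: M_def)
    have "real n / ?L \<ge> 8"
      using elim(1) L n by (simp add: field_simps)
    \<comment> \<open>Rounding down loses at most \<open>1\<close>, which is at most
      \<open>n / (8 ln n)\<close>, so at least half of \<open>a\<close> is left.\<close>
    then have M2: "real n / (8 * ?L) \<le> real M" using M(2) by (simp add: a_def)
    have Mn: "M \<le> n - 1" using M(1) a(2) n by linarith
    have err: "(real M / (real n - 1))\<^sup>2 * (3 / 2 * real n * ?L) \<le> real M / 2"
    proof -
      have "(real M / (real n - 1))\<^sup>2 * (3 / 2 * real n * ?L) = real M * (real M * ?L) * (3 / 2 * real n) / (real n - 1)\<^sup>2"
        by (simp add: power2_eq_square field_simps)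
      also have "\<dots> \<le> real M * (real n / 4) * (3 / 2 * real n) / (real n - 1)\<^sup>2"
      proof (intro divide_right_mono mult_right_mono mult_left_mono)
        have "real M * ?L \<le> a * ?L" using M L by (intro mult_right_mono) auto
        then show "real M * ?L \<le> real n / 4" using L by (simp add: a_def)
      qed auto
      also have "\<dots> = real M / 2 * (3 / 4 * (real n)\<^sup>2 / (real n - 1)\<^sup>2)" by (simp add: power2_eq_square)
      also have "\<dots> \<le> real M / 2 * 1"
      proof (intro mult_left_mono)
        have "0 \<le> real n * (real n - 8)" using n by (intro mult_nonneg_nonneg) auto
        then have "3 / 4 * (real n)\<^sup>2 \<le> (real n - 1)\<^sup>2" by (simp add: power2_eq_square algebra_simps)
        then show "3 / 4 * (real n)\<^sup>2 / (real n - 1)\<^sup>2 \<le> 1" using n by (simp add: divide_le_eq)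
      qed simp
      finally show ?thesis by simp
    qed
    have "c / 2 * (?L / real n) * (real n / (8 * ?L)) \<le> p n * real M"
      using elim(3) M2 c L n by (intro mult_mono) auto
    then have pM: "c / 16 \<le> p n * real M" using L n by simp
    have "q = 1/2 * (1 - 1 / (1 + c / 16))" using c by (simp add: q_def field_simps)
    also have "\<dots> \<le> 1/2 * (1 - 1 / (1 + p n * real M))"
      using pM c by (intro mult_left_mono diff_left_mono divide_left_mono mult_pos_pos) auto
    also have "\<dots> = p n * (real M - real M / 2) / (1 + p n * real M)"
    proof -
      have "1 + p n * real M > 0" using pM c by simp
      then show ?thesis by (simp add: field_simps)
    qed
    also have "\<dots> \<le> p n * (real M - (real M / (real n - 1))\<^sup>2 * (3 / 2 * real n * ?L)) / (1 + p n * real M)"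
      using err pn by (intro divide_right_mono mult_left_mono diff_left_mono) auto
    also have "\<dots> \<le> measure_pmf.prob (coupling (p n) n) {(f, vs, b). \<exists>x\<in>{2..n}. ignites f b vs 1 x}"
      by (rule prob_root_burns_ge[OF n(1) pn Mn])
    also have "\<dots> = measure_pmf.prob (fire_on_rrt (p n) n) {(E, s). \<not> fireproof_vertex E s 1}"
      by (rule prob_root_burns[OF n(2), symmetric])
    finally show ?case .
  qed
  moreover have "q > 0" using c by (simp add: q_def)
  ultimately show ?thesis by blast
qed

text \<open>The mean number of edges that are first on their path to the root is at most of order
  \<open>n / ln n\<close>, so its product with \<open>p n\<close> stays bounded. In the exponent,
  \<open>16 * c\<close> is \<open>2 * 2 * c * 4\<close> from the main term, and the \<open>1\<close>
  covers the vanishing rest.\<close>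

lemma eventually_root_fireproof_ge:
  "\<exists>q>0. \<forall>\<^sub>F n in sequentially. q \<le> measure_pmf.prob (fire_on_rrt (p n) n) {(E, s). fireproof_vertex E s 1}"
proof -
  have "(\<lambda>n. ln (real n) / real n * real n powr (3/4)) \<longlonglongrightarrow> 0" by real_asymp
  then have "\<forall>\<^sub>F n in sequentially. ln (real n) / real n * real n powr (3/4) < 1 / (8 * c)"
    using c by (intro order_tendstoD) auto
  with critical_bounds eventually_p_le[of "1/2", simplified] eventually_ge_at_top[of "2::nat"]
  have "\<forall>\<^sub>F n in sequentially. exp (- (16 * c + 1)) \<le> measure_pmf.prob (fire_on_rrt (p n) n) {(E, s). fireproof_vertex E s 1}"
  proof eventually_elim
    case (elim n)
    let ?L = "ln (real n)"
    have n: "n \<ge> 2" "n \<ge> 1" and L: "?L > 0" using elim by auto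
    have pn: "0 \<le> p n" "p n \<le> 1" using p n by auto
    have "2 * p n * (4 * real n / ?L + 2 * real n powr (3/4)) \<le>
        2 * (2 * c * (?L / real n)) * (4 * real n / ?L + 2 * real n powr (3/4))"
      using elim(1) L by (intro mult_right_mono mult_left_mono) auto
    also have "\<dots> = 16 * c + 8 * c * (?L / real n * real n powr (3/4))"
      using L n by (simp add: field_simps)
    also have "\<dots> \<le> 16 * c + 8 * c * (1 / (8 * c))"
      using elim(4) c by (intro add_left_mono mult_left_mono) auto
    also have "\<dots> = 16 * c + 1" using c by simp
    finally have "exp (- (16 * c + 1)) \<le> exp (- 2 * p n * (4 * real n / ?L + 2 * real n powr (3/4)))" by simp
    also have "\<dots> \<le> measure_pmf.prob (coupling (p n) n) {(f, vs, b). \<not> (\<exists>x\<in>{2..n}. ignites f b vs 1 x)}"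
      using elim(2) by (intro prob_root_fireproof_ge[OF n(1) pn]) simp
    also have "\<dots> = measure_pmf.prob (fire_on_rrt (p n) n) {(E, s). fireproof_vertex E s 1}"
      by (rule prob_root_fireproof[OF n(2), symmetric])
    finally show ?case .
  qed
  then show ?thesis by (intro exI[of _ "exp (- (16 * c + 1))"]) simp
qed

text \<open>\<open>64 * c\<close> is \<open>32 * 2 * c\<close> from the main term; relative to
  \<open>n / ln n\<close> the other term tends to \<open>0\<close> and is covered by the
  \<open>1\<close>.\<close>

lemma eventually_burnt_below_bound:
  "\<forall>\<^sub>F n in sequentially. p n * (32 * (real n / ln (real n))\<^sup>2 + 2 * real n powr (7/4) * ln (real n)) \<le>
     (64 * c + 1) * (real n / ln (real n))"
proof -
  have "(\<lambda>n. (ln (real n))^3 / real n ^ 2 * real n powr (7/4)) \<longlonglongrightarrow> 0" by real_asymp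
  then have "\<forall>\<^sub>F n in sequentially. (ln (real n))^3 / real n ^ 2 * real n powr (7/4) < 1 / (4 * c)"
    using c by (intro order_tendstoD) auto
  with critical_bounds eventually_ge_at_top[of "2::nat"] show ?thesis
  proof eventually_elim
    case (elim n)
    let ?L = "ln (real n)" and ?w = "real n powr (7/4)"
    have n: "real n > 0" and L: "?L > 0" using elim by auto
    have "p n * (32 * (real n / ?L)\<^sup>2 + 2 * ?w * ?L) \<le> 2 * c * (?L / real n) * (32 * (real n / ?L)\<^sup>2 + 2 * ?w * ?L)"
      using elim(1) L by (intro mult_right_mono) auto
    also have "\<dots> = (64 * c + 4 * c * (?L^3 / real n ^ 2 * ?w)) * (real n / ?L)"
      using n L by (simp add: field_simps power2_eq_square power3_eq_cube)
    also have "\<dots> \<le> (64 * c + 4 * c * (1 / (4 * c))) * (real n / ?L)"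
      using elim(3) c L n by (intro mult_right_mono add_left_mono mult_left_mono) auto
    also have "\<dots> = (64 * c + 1) * (real n / ?L)" using c by simp
    finally show ?case .
  qed
qed

text \<open>Conditioning costs only a factor \<open>1 / q\<close>, and the resulting bound is of
  order \<open>1 / ln n\<close>.\<close>

lemma root_fireproof_giant:
  assumes e: "\<epsilon> > 0"
  shows "(\<lambda>n. measure_pmf.prob (root_fireproof_law (p n) n)
     {(E, s). \<bar>real (largest_fireproof n E s) / real n - 1\<bar> > \<epsilon>}) \<longlonglongrightarrow> 0"
proof -
  obtain q where q: "q > 0" "\<forall>\<^sub>F n in sequentially. q \<le> measure_pmf.prob (fire_on_rrt (p n) n) {(E, s). fireproof_vertex E s 1}"
    using eventually_root_fireproof_ge by blast
  let ?A = "\<lambda>n. {(E, s). \<epsilon> < \<bar>real (largest_fireproof n E s) / real n - 1\<bar>}"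
  have lim: "(\<lambda>n. (64 * c + 1) / (\<epsilon> * q) * (1 / ln (real n))) \<longlonglongrightarrow> (64 * c + 1) / (\<epsilon> * q) * 0"
    by (intro tendsto_mult_left) real_asymp
  have upper: "\<forall>\<^sub>F n in sequentially. measure_pmf.prob (root_fireproof_law (p n) n) (?A n) \<le> (64 * c + 1) / (\<epsilon> * q) * (1 / ln (real n))"
    using q(2) eventually_burnt_below_bound eventually_ge_at_top[of "2::nat"]
  proof eventually_elim
    case (elim n)
    have n: "n \<ge> 2" "n \<ge> 1" using elim by auto
    have pn: "0 \<le> p n" "p n \<le> 1" using p n by auto
    let ?P = "measure_pmf.prob (fire_on_rrt (p n) n)" and ?S = "{(E, s). fireproof_vertex E s 1}"
    have pos: "?P ?S > 0" using q(1) elim(1) by linarith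
    have "measure_pmf.prob (root_fireproof_law (p n) n) (?A n) = ?P (?S \<inter> ?A n) / ?P ?S"
      unfolding root_fireproof_law_def by (rule prob_cond_pmf[OF pos])
    also have "?S \<inter> ?A n = {(E, s). fireproof_vertex E s 1 \<and> \<epsilon> < \<bar>real (largest_fireproof n E s) / real n - 1\<bar>}" by auto
    also have "?P \<dots> / ?P ?S \<le> ((64 * c + 1) * (real n / ln (real n)) / (\<epsilon> * real n)) / q"
    proof (intro frac_le)
      have "?P {(E, s). fireproof_vertex E s 1 \<and> \<epsilon> < \<bar>real (largest_fireproof n E s) / real n - 1\<bar>} \<le>
          p n * (32 * (real n / ln (real n))\<^sup>2 + 2 * real n powr (7/4) * ln (real n)) / (\<epsilon> * real n)"
        by (rule prob_root_fireproof_not_giant[OF n(1) pn e])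
      also have "\<dots> \<le> (64 * c + 1) * (real n / ln (real n)) / (\<epsilon> * real n)"
        using elim(2) e by (intro divide_right_mono) auto
      finally show "?P {(E, s). fireproof_vertex E s 1 \<and> \<epsilon> < \<bar>real (largest_fireproof n E s) / real n - 1\<bar>} \<le>
          (64 * c + 1) * (real n / ln (real n)) / (\<epsilon> * real n)" .
    qed (use q(1) elim(1) e c n in auto)
    also have "\<dots> = (64 * c + 1) / (\<epsilon> * q) * (1 / ln (real n))"
      using n e q(1) by (simp add: field_simps)
    finally show ?case .
  qed
  have lower: "\<forall>\<^sub>F n in sequentially. 0 \<le> measure_pmf.prob (root_fireproof_law (p n) n) (?A n)" by simp
  have "(\<lambda>n. (64 * c + 1) / (\<epsilon> * q) * (1 / ln (real n))) \<longlonglongrightarrow> 0"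
    using lim by (simp only: mult_zero_right)
  from tendsto_sandwich[OF lower upper tendsto_const this] show ?thesis .
qed

lemma root_burns_eventually_small:
  assumes e: "\<epsilon> > 0"
  shows "\<exists>K. \<forall>\<^sub>F n in sequentially. measure_pmf.prob (root_burns_law (p n) n)
     {(E, s). K < ln (real n) / real n * real (largest_fireproof n E s)} < \<epsilon>"
proof -
  obtain q where q: "q > 0" "\<forall>\<^sub>F n in sequentially. q \<le> measure_pmf.prob (fire_on_rrt (p n) n) {(E, s). \<not> fireproof_vertex E s 1}"
    using eventually_root_burns_ge by blast
  \<comment> \<open>Three error terms of size at most \<delta> will remain; divided by
    \<open>q\<close> they give \<open>3/4 * \<epsilon>\<close>.\<close>
  define \<delta> where "\<delta> = \<epsilon> * q / 4"
  have d: "\<delta> > 0" using e q by (simp add: \<delta>_def)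
  \<comment> \<open>Chosen so that late fires contribute at most \<delta>; the \<open>1\<close> in
    the exponent \<open>1 - T\<close> allows for rounding \<open>M\<close> down.\<close>
  define T where "T = max 1 (1 - ln (\<delta> / (16 * c)))"
  have T: "T \<ge> 1" "16 * c * exp (1 - T) \<le> \<delta>"
  proof -
    have "exp (1 - T) \<le> exp (ln (\<delta> / (16 * c)))" by (simp add: T_def)
    then have "exp (1 - T) \<le> \<delta> / (16 * c)" using d c by simp
    then show "16 * c * exp (1 - T) \<le> \<delta>" using c by (simp add: field_simps)
  qed (simp add: T_def)
  \<comment> \<open>\<open>K\<close> enters through \<open>1 / y\<close>; this value makes the two
    terms proportional to \<open>1 / K\<close> add up to \<delta>.\<close>
  define K where "K = (6 * T + (64 * c + 1)) / \<delta>"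
  have K: "K > 0" "6 * T / K + (64 * c + 1) / K = \<delta>"
  proof -
    have "6 * T + (64 * c + 1) > 0" using T c by (simp add: add_pos_pos)
    then show "K > 0" and "6 * T / K + (64 * c + 1) / K = \<delta>"
      unfolding add_divide_distrib[symmetric] using d by (simp_all add: K_def)
  qed
  have lim: "(\<lambda>n. 2 * T * (1 / ln (real n)) + 4 * c * (ln (real n) / real n * real n powr (3/4))) \<longlonglongrightarrow> 2 * T * 0 + 4 * c * 0"
    by (intro tendsto_add tendsto_mult_left) real_asymp+
  have ev_small: "\<forall>\<^sub>F n in sequentially. 2 * T * (1 / ln (real n)) + 4 * c * (ln (real n) / real n * real n powr (3/4)) < \<delta>"
    using order_tendstoD(2)[OF lim] d by simp
  have "(\<lambda>n. ln (real n) / real n) \<longlonglongrightarrow> 0" by real_asymp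
  then have ev_ln: "\<forall>\<^sub>F n in sequentially. ln (real n) / real n < 1"
    by (rule order_tendstoD) simp
  have "filterlim (\<lambda>n. ln (real n)) at_top sequentially" by real_asymp
  then have ev_L: "\<forall>\<^sub>F n in sequentially. 2 * T \<le> ln (real n)" by (simp add: filterlim_at_top)
  have "\<forall>\<^sub>F n in sequentially. measure_pmf.prob (root_burns_law (p n) n)
     {(E, s). K < ln (real n) / real n * real (largest_fireproof n E s)} < \<epsilon>"
    using q(2) eventually_burnt_below_bound critical_bounds ev_small ev_ln ev_L eventually_ge_at_top[of "2::nat"]
  proof eventually_elim
    case (elim n)
    let ?L = "ln (real n)"
    have n: "n \<ge> 2" "n \<ge> 1" "real n \<ge> 2" and L: "?L > 0" using elim by auto
    have pn: "0 \<le> p n" "p n \<le> 1" using p n by auto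
    let ?P = "measure_pmf.prob (fire_on_rrt (p n) n)" and ?S = "{(E, s). \<not> fireproof_vertex E s 1}"
    define y where "y = K * real n / ?L"
    have y: "y > 0" using K n L by (simp add: y_def)
    define a where "a = T * real n / ?L"
    have a: "a \<le> real n / 2" "0 \<le> a" using elim(6) L n T by (auto simp: a_def field_simps)
    define M where "M = nat \<lfloor>a\<rfloor>"
    have M: "real M \<le> a" "a - 1 \<le> real M" using a by (auto simp: M_def)
    have Mn: "M \<le> n - 1" using M(1) a(1) n by linarith
    have frac_up: "real M / (real n - 1) \<le> 2 * T / ?L"
    proof -
      have "real M / (real n - 1) \<le> a / (real n / 2)" using M n a by (intro frac_le) auto
      also have "\<dots> = 2 * T / ?L" using n by (simp add: a_def)
      finally show ?thesis .
    qed
    \<comment> \<open>Rounding \<open>a\<close> down to \<open>M\<close> costs at most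
      \<open>ln n / n\<close>, hence less than \<open>1\<close>, in the exponent.\<close>
    have "?L * (a - 1) / real n \<le> ?L * real M / (real n - 1)"
      using M L n by (intro frac_le mult_left_mono mult_nonneg_nonneg) auto
    moreover have "?L * (a - 1) / real n = T - ?L / real n" using L n by (simp add: a_def field_simps)
    ultimately have frac_low: "T - 1 \<le> ?L * real M / (real n - 1)" using elim(5) by linarith
    have late: "real n powr (1 - real M / (real n - 1)) \<le> real n * exp (1 - T)"
    proof -
      have "real n powr (1 - real M / (real n - 1)) = exp (?L - ?L * real M / (real n - 1))"
        using n by (simp add: powr_def algebra_simps)
      also have "\<dots> \<le> exp (?L + (1 - T))" using frac_low by simp
      also have "\<dots> = real n * exp (1 - T)" using n by (simp only: exp_add) simp
      finally show ?thesis .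
    qed
    have t1: "real M / (real n - 1) * (3 * (real n / y) + 1) \<le> 6 * T / K + 2 * T * (1 / ?L)"
    proof -
      have "real M / (real n - 1) * (3 * (real n / y) + 1) \<le> 2 * T / ?L * (3 * (real n / y) + 1)"
        using frac_up y by (intro mult_right_mono) auto
      also have "\<dots> = 6 * T / K + 2 * T * (1 / ?L)"
      proof -
        have ny: "real n / y = ?L / K" using n by (simp add: y_def)
        show ?thesis unfolding ny using L by (simp add: field_simps)
      qed
      finally show ?thesis .
    qed
    have t2: "p n * (8 / ?L * real n powr (1 - real M / (real n - 1)) + 2 * real n powr (3/4)) \<le>
        16 * c * exp (1 - T) + 4 * c * (?L / real n * real n powr (3/4))"
    proof -
      have "p n * (8 / ?L * real n powr (1 - real M / (real n - 1)) + 2 * real n powr (3/4)) \<le>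
          2 * c * (?L / real n) * (8 / ?L * (real n * exp (1 - T)) + 2 * real n powr (3/4))"
        using elim(3) late pn L c by (intro mult_mono add_mono mult_left_mono) auto
      also have "\<dots> = 16 * c * exp (1 - T) + 4 * c * (?L / real n * real n powr (3/4))"
        using L n by (simp add: field_simps)
      finally show ?thesis .
    qed
    have t3: "p n * (32 * (real n / ?L)\<^sup>2 + 2 * real n powr (7/4) * ?L) / y \<le> (64 * c + 1) / K"
    proof -
      have "p n * (32 * (real n / ?L)\<^sup>2 + 2 * real n powr (7/4) * ?L) / y \<le> (64 * c + 1) * (real n / ?L) / y"
        using elim(2) y by (intro divide_right_mono) auto
      also have "\<dots> = (64 * c + 1) / K" using n L K by (simp add: y_def field_simps)
      finally show ?thesis .
    qed
    have small: "?P {(E, s). \<not> fireproof_vertex E s 1 \<and> y < real (largest_fireproof n E s)} \<le> 3 * \<delta>"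
      using prob_root_burns_large_fireproof[OF n(1) pn y Mn] t1 t2 t3 T(2) K(2) elim(4) by linarith
    have pos: "?P ?S > 0" using q(1) elim(1) by linarith
    have "measure_pmf.prob (root_burns_law (p n) n) {(E, s). K < ?L / real n * real (largest_fireproof n E s)} =
        ?P (?S \<inter> {(E, s). K < ?L / real n * real (largest_fireproof n E s)}) / ?P ?S"
      unfolding root_burns_law_def by (rule prob_cond_pmf[OF pos])
    also have "?S \<inter> {(E, s). K < ?L / real n * real (largest_fireproof n E s)} =
        {(E, s). \<not> fireproof_vertex E s 1 \<and> y < real (largest_fireproof n E s)}"
      using n L by (auto simp: y_def field_simps)
    also have "?P \<dots> / ?P ?S \<le> 3 * \<delta> / q"
      using small elim(1) q(1) d by (intro frac_le) auto
    also have "\<dots> < \<epsilon>" using q(1) e by (simp add: \<delta>_def)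
    finally show ?case .
  qed
  then show ?thesis by blast
qed

end

theorem corollary3:
  fixes c :: real and p :: "nat \<Rightarrow> real"
  assumes "c > 0"
    and "\<And>n. n \<ge> 1 \<Longrightarrow> 0 \<le> p n \<and> p n \<le> 1"
    and "p \<sim>[at_top] (\<lambda>n. c * ln (real n) / real n)"
  shows "tight (\<lambda>k. let n = Suc k in
           distr (measure_pmf (root_burns_law (p n) n)) borel
             (\<lambda>(E, s). ln (real n) / real n * real (largest_fireproof n E s))) \<and>
         (\<forall>\<epsilon>>0. (\<lambda>n. measure_pmf.prob (root_fireproof_law (p n) n)
           {(E, s). \<bar>real (largest_fireproof n E s) / real n - 1\<bar> > \<epsilon>}) \<longlonglongrightarrow> 0)"
proof
  show "tight (\<lambda>k. let n = Suc k in
           distr (measure_pmf (root_burns_law (p n) n)) borel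
             (\<lambda>(E, s). ln (real n) / real n * real (largest_fireproof n E s)))"
    unfolding Let_def
  proof (rule tight_distrI)
    fix k :: nat and \<omega> :: "nat set set \<times> (nat set \<Rightarrow> edge_status)"
    show "0 \<le> (case \<omega> of (E, s) \<Rightarrow> ln (real (Suc k)) / real (Suc k) * real (largest_fireproof (Suc k) E s))"
      by (simp add: case_prod_unfold)
  next
    fix \<epsilon> :: real assume "\<epsilon> > 0"
    from root_burns_eventually_small[OF assms this]
    obtain K where "\<forall>\<^sub>F n in sequentially. measure_pmf.prob (root_burns_law (p n) n)
        {(E, s). K < ln (real n) / real n * real (largest_fireproof n E s)} < \<epsilon>" by blast
    then have "\<forall>\<^sub>F k in sequentially. measure_pmf.prob (root_burns_law (p (Suc k)) (Suc k))
        {(E, s). K < ln (real (Suc k)) / real (Suc k) * real (largest_fireproof (Suc k) E s)} < \<epsilon>"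
      by (subst eventually_sequentially_Suc)
    then show "\<exists>b. \<forall>\<^sub>F k in sequentially. measure_pmf.prob (root_burns_law (p (Suc k)) (Suc k))
        {\<omega>. b < (case \<omega> of (E, s) \<Rightarrow> ln (real (Suc k)) / real (Suc k) * real (largest_fireproof (Suc k) E s))} < \<epsilon>"
      by (auto simp: case_prod_unfold)
  qed
qed (use root_fireproof_giant[OF assms] in blast)

end
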